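(* Let $X$ be a smooth projective split toric variety over $\mathbb{Q}$ with $-K_X$ globally generated, $r=\operatorname{rank}\operatorname{Pic}(X)$, with canonical model $\mathcal{X}$. Let $Z\subset X$ be Zariski closed of codimension at least two and $\mathcal{Z}$ its Zariski closure in $\mathcal{X}$. Then uniformly for every $N>1$, $$\#\{P\in T_O(\mathbb{Q}):H_{\mathrm{tor}}(P)\le B,\ \exists\,p\ge N\text{ prime with }\widetilde P\bmod p\in\mathcal{Z}(\mathbb{F}_p)\}\ll_Z\frac{B(\log B)^{r-1}}{N\log N}+B(\log B)^{r-2}\log\log B.$$
   Context: $X$ is given by a complete regular fan $\Delta$, $T_O$ is the open torus orbit, $\mathcal{X}=\mathrm{Tor}_\mathbb{Z}(\Delta)$ is the canonical smooth projective $\mathbb{Z}$-model, and for $P\in X(\mathbb{Q})$, $\widetilde P\in\mathcal{X}(\mathbb{Z})$ is its unique lift. $H_{\mathrm{tor}}(P)=H_{\mathcal{O}(1)}(i(P))$, where $i:X\to\mathbb{P}^K$ is given by the basis of torus characters of $H^0(X,-K_X)$ and $H_{\mathcal{O}(1)}([x_0:\dots:x_K])=\max|x_i|$ for coprime integer coordinates. *)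

theory Defs
  imports "HOL-Analysis.Analysis" "HOL-Library.Poly_Mapping"
begin

(* ---------------------------------------------------------------------
   Toric data.  N = Z^n is modelled by functions nat => int (coordinates
   j < n are the relevant ones).  The fan Delta is given by its rays
   v 0, ..., v (k-1) in Z^n and its set Sigma of maximal cones, each
   maximal cone being a set of ray indices.
   --------------------------------------------------------------------- *)

definition ip :: "nat \<Rightarrow> (nat \<Rightarrow> int) \<Rightarrow> (nat \<Rightarrow> int) \<Rightarrow> int" where
  "ip n m u = (\<Sum>j<n. m j * u j)"

definition rcone :: "nat \<Rightarrow> (nat \<Rightarrow> nat \<Rightarrow> int) \<Rightarrow> nat set \<Rightarrow> (nat \<Rightarrow> real) set" where
  "rcone n v S = {u. (\<forall>j\<ge>n. u j = 0) \<and>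
      (\<exists>c::nat \<Rightarrow> real. (\<forall>\<rho>\<in>S. c \<rho> \<ge> 0) \<and> (\<forall>j<n. u j = (\<Sum>\<rho>\<in>S. c \<rho> * real_of_int (v \<rho> j))))}"

definition complete_regular_fan ::
  "nat \<Rightarrow> nat \<Rightarrow> (nat \<Rightarrow> nat \<Rightarrow> int) \<Rightarrow> nat set set \<Rightarrow> bool" where
  "complete_regular_fan n k v \<Sigma> \<longleftrightarrow>
     \<Sigma> \<noteq> {} \<and>
     inj_on v {..<k} \<and>
     (\<forall>\<rho><k. \<forall>j\<ge>n. v \<rho> j = 0) \<and>
     (\<forall>\<sigma>\<in>\<Sigma>. \<sigma> \<subseteq> {..<k} \<and> card \<sigma> = n) \<and>
     (\<forall>\<rho><k. \<exists>\<sigma>\<in>\<Sigma>. \<rho> \<in> \<sigma>) \<and>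
     \<comment> \<open>regularity: the rays of each maximal cone form a Z-basis of Z^n\<close>
     (\<forall>\<sigma>\<in>\<Sigma>. (\<forall>u::nat \<Rightarrow> int. \<exists>c::nat \<Rightarrow> int.
                    \<forall>j<n. u j = (\<Sum>\<rho>\<in>\<sigma>. c \<rho> * v \<rho> j)) \<and>
                 (\<forall>c::nat \<Rightarrow> int. (\<forall>j<n. (\<Sum>\<rho>\<in>\<sigma>. c \<rho> * v \<rho> j) = 0)
                    \<longrightarrow> (\<forall>\<rho>\<in>\<sigma>. c \<rho> = 0))) \<and>
     \<comment> \<open>fan condition: cones meet along common faces\<close>
     (\<forall>\<sigma>\<in>\<Sigma>. \<forall>\<tau>\<in>\<Sigma>. rcone n v \<sigma> \<inter> rcone n v \<tau> = rcone n v (\<sigma> \<inter> \<tau>)) \<and>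
     \<comment> \<open>completeness\<close>
     (\<forall>u::nat \<Rightarrow> real. (\<forall>j\<ge>n. u j = 0) \<longrightarrow> (\<exists>\<sigma>\<in>\<Sigma>. u \<in> rcone n v \<sigma>))"

(* projectivity: existence of a strictly convex piecewise linear support
   function, i.e. of an ample torus-invariant divisor - sum a_rho D_rho *)
definition projective_fan :: "nat \<Rightarrow> nat \<Rightarrow> (nat \<Rightarrow> nat \<Rightarrow> int) \<Rightarrow> nat set set \<Rightarrow> bool" where
  "projective_fan n k v \<Sigma> \<longleftrightarrow>
     (\<exists>a::nat \<Rightarrow> int. \<forall>\<sigma>\<in>\<Sigma>. \<exists>m::nat \<Rightarrow> int.
         (\<forall>\<rho>\<in>\<sigma>. ip n m (v \<rho>) = a \<rho>) \<and>
         (\<forall>\<rho><k. \<rho> \<notin> \<sigma> \<longrightarrow> ip n m (v \<rho>) > a \<rho>))"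

(* -K_X = sum D_rho globally generated (equivalently nef, for toric varieties) *)
definition anticanonical_gg :: "nat \<Rightarrow> nat \<Rightarrow> (nat \<Rightarrow> nat \<Rightarrow> int) \<Rightarrow> nat set set \<Rightarrow> bool" where
  "anticanonical_gg n k v \<Sigma> \<longleftrightarrow>
     (\<forall>\<sigma>\<in>\<Sigma>. \<exists>m::nat \<Rightarrow> int.
         (\<forall>\<rho>\<in>\<sigma>. ip n m (v \<rho>) = -1) \<and> (\<forall>\<rho><k. ip n m (v \<rho>) \<ge> -1))"

definition torus_points :: "nat \<Rightarrow> (nat \<Rightarrow> rat) set" where
  "torus_points n = {t. (\<forall>j<n. t j \<noteq> 0) \<and> (\<forall>j\<ge>n. t j = 1)}"

(* lattice points of the anticanonical polytope = torus characters forming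
   a basis of H^0(X, -K_X) *)
definition antican_chars :: "nat \<Rightarrow> nat \<Rightarrow> (nat \<Rightarrow> nat \<Rightarrow> int) \<Rightarrow> (nat \<Rightarrow> int) set" where
  "antican_chars n k v = {m. (\<forall>j\<ge>n. m j = 0) \<and> (\<forall>\<rho><k. ip n m (v \<rho>) \<ge> -1)}"

definition char_val :: "nat \<Rightarrow> (nat \<Rightarrow> int) \<Rightarrow> (nat \<Rightarrow> rat) \<Rightarrow> rat" where
  "char_val n m t = (\<Prod>j<n. t j powi m j)"

definition proj_height :: "'a set \<Rightarrow> ('a \<Rightarrow> rat) \<Rightarrow> real" where
  "proj_height A y = (THE h. \<exists>c::rat. c > 0 \<and> (\<forall>a\<in>A. c * y a \<in> \<int>) \<and>
       Gcd ((\<lambda>a. \<lfloor>c * y a\<rfloor>) ` A) = 1 \<and>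
       h = real_of_rat (Max ((\<lambda>a. \<bar>c * y a\<bar>) ` A)))"

definition H_tor :: "nat \<Rightarrow> nat \<Rightarrow> (nat \<Rightarrow> nat \<Rightarrow> int) \<Rightarrow> (nat \<Rightarrow> rat) \<Rightarrow> real" where
  "H_tor n k v t = proj_height (antican_chars n k v) (\<lambda>m. char_val n m t)"

definition mp_eval :: "('b \<Rightarrow> 'a::comm_ring_1) \<Rightarrow> ((nat \<Rightarrow>\<^sub>0 nat) \<Rightarrow>\<^sub>0 'b::zero) \<Rightarrow> (nat \<Rightarrow> 'a) \<Rightarrow> 'a" where
  "mp_eval \<phi> f z = (\<Sum>(a::nat \<Rightarrow>\<^sub>0 nat)\<in>Poly_Mapping.keys f. \<phi> (Poly_Mapping.lookup f a) * (\<Prod>i\<in>Poly_Mapping.keys a. z i ^ Poly_Mapping.lookup a i))"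

definition vars_below :: "nat \<Rightarrow> ((nat \<Rightarrow>\<^sub>0 nat) \<Rightarrow>\<^sub>0 'b::zero) \<Rightarrow> bool" where
  "vars_below k f \<longleftrightarrow> (\<forall>(a::nat \<Rightarrow>\<^sub>0 nat)\<in>Poly_Mapping.keys f. \<forall>i\<in>Poly_Mapping.keys a. i < k)"

(* homogeneous for the Pic(X)-grading of the Cox ring: exponent vectors of
   any two monomials differ by an element of the image of M = Z^n *)
definition pic_homogeneous :: "nat \<Rightarrow> nat \<Rightarrow> (nat \<Rightarrow> nat \<Rightarrow> int) \<Rightarrow> ((nat \<Rightarrow>\<^sub>0 nat) \<Rightarrow>\<^sub>0 'b::zero) \<Rightarrow> bool" where
  "pic_homogeneous n k v f \<longleftrightarrow>
     (\<forall>(a::nat \<Rightarrow>\<^sub>0 nat)\<in>Poly_Mapping.keys f. \<forall>(b::nat \<Rightarrow>\<^sub>0 nat)\<in>Poly_Mapping.keys f. \<exists>m::nat \<Rightarrow> int.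
        \<forall>\<rho><k. int (Poly_Mapping.lookup a \<rho>) - int (Poly_Mapping.lookup b \<rho>) = ip n m (v \<rho>))"

definition cox_space :: "nat \<Rightarrow> (nat \<Rightarrow> complex) set" where
  "cox_space k = {z. \<forall>i\<ge>k. z i = 0}"

definition cox_U :: "nat \<Rightarrow> nat set set \<Rightarrow> (nat \<Rightarrow> complex) set" where
  "cox_U k \<Sigma> = {z \<in> cox_space k. \<exists>\<sigma>\<in>\<Sigma>. \<forall>\<rho><k. \<rho> \<notin> \<sigma> \<longrightarrow> z \<rho> \<noteq> 0}"

definition zar_closed :: "nat \<Rightarrow> (nat \<Rightarrow> complex) set \<Rightarrow> bool" where
  "zar_closed k Y \<longleftrightarrow> (\<exists>S::((nat \<Rightarrow>\<^sub>0 nat) \<Rightarrow>\<^sub>0 complex) set.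
      (\<forall>f\<in>S. vars_below k f) \<and> Y = {z \<in> cox_space k. \<forall>f\<in>S. mp_eval id f z = 0})"

definition zar_irreducible :: "nat \<Rightarrow> (nat \<Rightarrow> complex) set \<Rightarrow> bool" where
  "zar_irreducible k Y \<longleftrightarrow> zar_closed k Y \<and> Y \<noteq> {} \<and>
     (\<forall>A B. zar_closed k A \<and> zar_closed k B \<and> Y \<subseteq> A \<union> B \<longrightarrow> Y \<subseteq> A \<or> Y \<subseteq> B)"

(* the affine cone over Z (F: homogeneous equations with rational coefficients) *)
definition cone_Z :: "nat \<Rightarrow> ((nat \<Rightarrow>\<^sub>0 nat) \<Rightarrow>\<^sub>0 rat) set \<Rightarrow> (nat \<Rightarrow> complex) set" where
  "cone_Z k F = {z \<in> cox_space k. \<forall>f\<in>F. mp_eval of_rat f z = 0}"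

(* Z = image of cone_Z \<inter> U in X has codimension >= 2, i.e.
   dim (cone_Z \<inter> U) = dim Z + r <= (n - 2) + (k - n) = k - 2 (Krull dimension
   of the locally closed set cone_Z \<inter> U, via chains of irreducible closed sets) *)
definition codim_ge_2 :: "nat \<Rightarrow> nat set set \<Rightarrow> ((nat \<Rightarrow>\<^sub>0 nat) \<Rightarrow>\<^sub>0 rat) set \<Rightarrow> bool" where
  "codim_ge_2 k \<Sigma> F \<longleftrightarrow>
     (\<forall>(Y::nat \<Rightarrow> (nat \<Rightarrow> complex) set) (l::nat).
        (\<forall>i\<le>l. zar_irreducible k (Y i)) \<and> (\<forall>i<l. Y i \<subset> Y (Suc i)) \<and>
        Y l \<subseteq> cone_Z k F \<and> Y 0 \<inter> cox_U k \<Sigma> \<noteq> {} \<longrightarrow> l + 2 \<le> k)"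

(* x in Z^k is a Cox lift of t: it represents the unique integral point
   P~ in X_Z(Z) extending P = t *)
definition cox_lift :: "nat \<Rightarrow> nat \<Rightarrow> (nat \<Rightarrow> nat \<Rightarrow> int) \<Rightarrow> nat set set \<Rightarrow> (nat \<Rightarrow> int) \<Rightarrow> (nat \<Rightarrow> rat) \<Rightarrow> bool" where
  "cox_lift n k v \<Sigma> x t \<longleftrightarrow>
     (\<forall>\<rho><k. x \<rho> \<noteq> 0) \<and>
     (\<forall>p::nat. prime p \<longrightarrow> (\<exists>\<sigma>\<in>\<Sigma>. \<forall>\<rho><k. \<rho> \<notin> \<sigma> \<longrightarrow> \<not> int p dvd x \<rho>)) \<and>
     (\<forall>j<n. t j = (\<Prod>\<rho><k. of_int (x \<rho>) powi v \<rho> j))"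

(* P~ mod p lies in the Zariski closure of Z in the canonical model:
   every integral polynomial vanishing on cone_Z \<inter> U vanishes mod p at x *)
definition red_in_closure ::
  "nat \<Rightarrow> nat \<Rightarrow> (nat \<Rightarrow> nat \<Rightarrow> int) \<Rightarrow> nat set set \<Rightarrow> ((nat \<Rightarrow>\<^sub>0 nat) \<Rightarrow>\<^sub>0 rat) set \<Rightarrow> nat \<Rightarrow> (nat \<Rightarrow> rat) \<Rightarrow> bool" where
  "red_in_closure n k v \<Sigma> F p t \<longleftrightarrow>
     (\<exists>x. cox_lift n k v \<Sigma> x t \<and>
        (\<forall>f::((nat \<Rightarrow>\<^sub>0 nat) \<Rightarrow>\<^sub>0 int). vars_below k f \<and>
            (\<forall>z\<in>cone_Z k F \<inter> cox_U k \<Sigma>. mp_eval of_int f z = 0)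
            \<longrightarrow> int p dvd mp_eval id f x))"

end

theory Submission
  imports Defs "HOL-Complex_Analysis.Complex_Analysis" "HOL-Real_Asymp.Real_Asymp"
begin

text \<open>
  A torus point of height at most \<open>B\<close> is given by nonzero integral Cox coordinates \<open>x\<close>, and the
  coprimality of Cox coordinates turns the height into the maximum of the monomials attached to the
  lattice points of the anticanonical polytope. Cutting the coordinates into dyadic boxes
  \<open>2 ^ \<alpha> \<rho> \<le> \<bar>x \<rho>\<bar> < 2 ^ (\<alpha> \<rho> + 1)\<close>, the exponents \<open>\<alpha>\<close> lie in a polytope on which
  \<open>\<Sum>\<rho>. \<alpha> \<rho>\<close> is at most \<open>log B\<close>; writing \<open>-(\<Sum>\<rho>. \<alpha> \<rho> v \<rho>)\<close> in the cone that contains it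
  shows that the volume decays exponentially away from a face of dimension \<open>r - 1\<close>, which gives
  \<open>B (log B) ^ (r - 1)\<close> for the sum of the volumes, and a further factor \<open>1 / log B\<close> for the sum of
  the volumes divided by one side of the box.

  Codimension two means that for every \<open>i\<close> some nonzero integral polynomial \<open>d i\<close> not involving
  \<open>x i\<close> vanishes on the cone over \<open>Z\<close>: otherwise the cone contains the graph of a local root function
  over a polydisc, and the Zariski closures of its coordinate slices form a chain that is too long.

  In a single box, induct on the number of variables and eliminate the variable \<open>x j\<close> with the
  longest side \<open>R\<close>. If some \<open>d i\<close> is nonzero modulo \<open>p\<close> as a polynomial in \<open>x j\<close>, then \<open>x j\<close> is
  confined to boundedly many classes modulo \<open>p\<close>, while \<open>p\<close> also divides \<open>d j\<close>; otherwise \<open>p\<close>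
  divides a chosen nonzero coefficient of each \<open>d i\<close>, and these coefficients satisfy the same
  hypothesis in one variable less. Since \<open>R\<close> is the longest side, a nonzero value of \<open>d j\<close> has only
  boundedly many prime factors exceeding \<open>R\<close>, so large primes cost no more than the volume over a side.
\<close>

section \<open>Evaluation of multivariate polynomials\<close>

text \<open>Both terms of the bound come from one count. For a prime \<open>p\<close> below the
  longest side \<open>R\<close> of a box of volume \<open>vol\<close>, the condition on
  \<open>d j\<close> and the roots in \<open>x j\<close> leave about
  \<open>vol * (1 / p + recip) * (1 / p)\<close> points, where \<open>recip\<close> sums the
  reciprocals of the sides. With Chebyshev's bound for primes in dyadic intervals, summing
  \<open>1 / p ^ 2\<close> over \<open>p \<ge> N\<close> gives \<open>1 / (N * ln N)\<close>, and
  summing \<open>1 / p\<close> up to \<open>R \<le> B\<close> gives the factor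
  \<open>ln (ln B)\<close> beside \<open>vol * recip\<close>. The obstacle is that \<open>p\<close>
  is unbounded: above \<open>R\<close> a root class modulo \<open>p\<close> may still contain a
  value of \<open>x j\<close>, so a further prime brings no saving. Only the number of prime factors
  of \<open>d j\<close> limits this cost, which requires \<open>d j\<close> to be nonzero, constant
  along the fibre and of size polynomial in \<open>R\<close>. Hence the choice of the longest side,
  and the need for an equation omitting a variable given in advance. The factor \<open>ln B\<close>
  lost in \<open>vol * recip\<close> requires, for each ray \<open>\<rho>\<close>, that
  \<open>\<alpha> \<rho>\<close> does not stay small on the whole dominant face.\<close>

abbreviation "keys \<equiv> Poly_Mapping.keys"
abbreviation "lookup \<equiv> Poly_Mapping.lookup"
abbreviation "single \<equiv> Poly_Mapping.single"

definition mon_eval :: "(nat \<Rightarrow>\<^sub>0 nat) \<Rightarrow> (nat \<Rightarrow> 'a::comm_ring_1) \<Rightarrow> 'a" where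
  "mon_eval a z = (\<Prod>i\<in>keys a. z i ^ lookup a i)"

lemma mon_eval_superset:
  assumes "finite A" "keys a \<subseteq> A"
  shows "mon_eval a z = (\<Prod>i\<in>A. z i ^ lookup a i)"
  unfolding mon_eval_def using assms
  by (intro prod.mono_neutral_left) (auto simp: in_keys_iff)

lemma mon_eval_add: "mon_eval (a + b) z = mon_eval a z * mon_eval b z"
proof -
  let ?A = "keys a \<union> keys b"
  have "keys (a + b) \<subseteq> ?A" by (rule keys_add)
  then show ?thesis
    by (simp add: mon_eval_superset[of ?A] lookup_add power_add prod.distrib)
qed

lemma mon_eval_zero [simp]: "mon_eval 0 z = 1"
  by (simp add: mon_eval_def)

lemma mon_eval_single [simp]: "mon_eval (single i e) z = z i ^ e"
  by (cases "e = 0") (simp_all add: mon_eval_def)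

lemma mp_eval_mon: "mp_eval \<phi> f z = (\<Sum>a\<in>keys f. \<phi> (lookup f a) * mon_eval a z)"
  by (simp add: mp_eval_def mon_eval_def)

lemma poly_mapping_sum_singles:
  fixes f :: "'a \<Rightarrow>\<^sub>0 'b::comm_monoid_add"
  shows "f = (\<Sum>a\<in>keys f. single a (lookup f a))"
proof (rule poly_mapping_eqI)
  fix b
  show "lookup f b = lookup (\<Sum>a\<in>keys f. single a (lookup f a)) b"
    by (simp add: lookup_sum lookup_single when_def in_keys_iff)
qed

text \<open>The coefficient map of \<open>mp_eval\<close> is a bare function. This predicate lets
  the same lemmas serve \<open>id\<close>, \<open>of_int\<close>, \<open>of_rat\<close> and, through
  \<open>ring_map_mp_eval\<close>, evaluation at a point as a coefficient map in its turn.\<close>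

definition ring_map :: "('a::comm_ring_1 \<Rightarrow> 'b::comm_ring_1) \<Rightarrow> bool" where
  "ring_map h \<longleftrightarrow> h 0 = 0 \<and> h 1 = 1 \<and> (\<forall>x y. h (x + y) = h x + h y) \<and> (\<forall>x y. h (x * y) = h x * h y)"

lemma ring_mapD:
  assumes "ring_map h"
  shows "h 0 = 0" "h 1 = 1" "h (x + y) = h x + h y" "h (x * y) = h x * h y"
  using assms by (auto simp: ring_map_def)

lemma ring_map_power: "ring_map h \<Longrightarrow> h (x ^ m) = h x ^ m"
  by (induction m) (auto simp: ring_mapD)

lemma ring_map_of_int [simp]: "ring_map of_int"
  by (simp add: ring_map_def)

lemma ring_map_of_rat [simp]: "ring_map (of_rat :: rat \<Rightarrow> 'a::field_char_0)"
  by (simp add: ring_map_def of_rat_add of_rat_mult)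

lemma ring_map_id [simp]: "ring_map id"
  by (simp add: ring_map_def)

lemma mp_eval_superset:
  assumes "ring_map \<phi>" "finite A" "keys f \<subseteq> A"
  shows "mp_eval \<phi> f z = (\<Sum>a\<in>A. \<phi> (lookup f a) * mon_eval a z)"
  unfolding mp_eval_mon using assms
  by (intro sum.mono_neutral_left) (auto simp: in_keys_iff ring_mapD)

lemma mp_eval_zero [simp]: "mp_eval \<phi> 0 z = 0"
  by (simp add: mp_eval_def)

lemma mp_eval_add:
  assumes "ring_map \<phi>"
  shows "mp_eval \<phi> (f + g) z = mp_eval \<phi> f z + mp_eval \<phi> g z"
proof -
  let ?A = "keys f \<union> keys g"
  have "keys (f + g) \<subseteq> ?A" by (rule keys_add)
  then show ?thesis
    by (simp add: mp_eval_superset[OF assms, of ?A] lookup_add ring_mapD[OF assms] distrib_right sum.distrib)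
qed

lemma mp_eval_sum:
  assumes "ring_map \<phi>"
  shows "mp_eval \<phi> (\<Sum>a\<in>A. f a) z = (\<Sum>a\<in>A. mp_eval \<phi> (f a) z)"
  by (induction A rule: infinite_finite_induct) (auto simp: mp_eval_add[OF assms])

lemma mp_eval_single:
  assumes "ring_map \<phi>"
  shows "mp_eval \<phi> (single a c) z = \<phi> c * mon_eval a z"
  by (cases "c = 0") (simp_all add: mp_eval_mon ring_mapD[OF assms])

lemma mp_eval_mult:
  assumes "ring_map \<phi>"
  shows "mp_eval \<phi> (f * g) z = mp_eval \<phi> f z * mp_eval \<phi> g z"
proof -
  have "f * g = (\<Sum>a\<in>keys f. \<Sum>b\<in>keys g.
     single (a + b) (lookup f a * lookup g b))"
    by (subst poly_mapping_sum_singles[of f], subst poly_mapping_sum_singles[of g])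
      (simp only: sum_product mult_single)
  then have "mp_eval \<phi> (f * g) z = (\<Sum>a\<in>keys f. \<Sum>b\<in>keys g.
     \<phi> (lookup f a * lookup g b) * mon_eval (a + b) z)"
    by (simp only: mp_eval_sum[OF assms] mp_eval_single[OF assms])
  also have "\<dots> = mp_eval \<phi> f z * mp_eval \<phi> g z"
    by (simp add: mon_eval_add ring_mapD[OF assms] mp_eval_mon sum_product mult_ac)
  finally show ?thesis .
qed

lemma mp_eval_one: "ring_map \<phi> \<Longrightarrow> mp_eval \<phi> 1 z = 1"
  using mp_eval_single[of \<phi> 0 1 z] by (simp add: ring_mapD)

lemma ring_map_mp_eval: "ring_map \<phi> \<Longrightarrow> ring_map (\<lambda>f. mp_eval \<phi> f z)"
  by (simp add: ring_map_def[of "\<lambda>f. mp_eval \<phi> f z"] mp_eval_add mp_eval_mult mp_eval_one)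

text \<open>Extends \<open>vars_below\<close> to arbitrary index sets, so that the absence of a
  single variable can be expressed.\<close>

definition vars_in :: "nat set \<Rightarrow> ((nat \<Rightarrow>\<^sub>0 nat) \<Rightarrow>\<^sub>0 'b::zero) \<Rightarrow> bool" where
  "vars_in S f \<longleftrightarrow> (\<forall>a\<in>keys f. keys a \<subseteq> S)"

lemma vars_below_vars_in: "vars_below k f \<longleftrightarrow> vars_in {..<k} f"
  by (auto simp: vars_below_def vars_in_def)

lemma vars_in_mono: "vars_in S f \<Longrightarrow> S \<subseteq> T \<Longrightarrow> vars_in T f"
  by (auto simp: vars_in_def)

lemma vars_in_zero [simp]: "vars_in S 0" and vars_in_one [simp]: "vars_in S 1"
  by (auto simp: vars_in_def)

lemma vars_in_single: "keys a \<subseteq> S \<Longrightarrow> vars_in S (single a c)"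
  by (auto simp: vars_in_def)

lemma vars_in_add: "vars_in S f \<Longrightarrow> vars_in S g \<Longrightarrow> vars_in S (f + g)"
  using keys_add[of f g] by (fastforce simp: vars_in_def)

lemma vars_in_uminus: "vars_in S f \<Longrightarrow> vars_in S (- f :: (nat \<Rightarrow>\<^sub>0 nat) \<Rightarrow>\<^sub>0 'b::ab_group_add)"
  by (auto simp: vars_in_def in_keys_iff)

lemma vars_in_diff: "vars_in S f \<Longrightarrow> vars_in S g \<Longrightarrow> vars_in S (f - g :: (nat \<Rightarrow>\<^sub>0 nat) \<Rightarrow>\<^sub>0 'b::ab_group_add)"
  using vars_in_add[OF _ vars_in_uminus, of S f g] by simp

lemma vars_in_mult:
  fixes f g :: "(nat \<Rightarrow>\<^sub>0 nat) \<Rightarrow>\<^sub>0 'b::comm_ring_1"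
  assumes "vars_in S f" "vars_in S g"
  shows "vars_in S (f * g)"
  unfolding vars_in_def
proof
  fix c assume "c \<in> keys (f * g)"
  then obtain a b where "c = a + b" "a \<in> keys f" "b \<in> keys g"
    using keys_mult[of f g] by blast
  then show "keys c \<subseteq> S" using assms keys_add[of a b] by (fastforce simp: vars_in_def)
qed

lemma vars_in_sum: "(\<And>a. a \<in> A \<Longrightarrow> vars_in S (f a)) \<Longrightarrow> vars_in S (\<Sum>a\<in>A. f a)"
  by (induction A rule: infinite_finite_induct) (auto intro: vars_in_add)

lemma mon_eval_cong: "(\<And>i. i \<in> keys a \<Longrightarrow> z i = w i) \<Longrightarrow> mon_eval a z = mon_eval a w"
  unfolding mon_eval_def by (intro prod.cong) auto

lemma mp_eval_cong:
  assumes "vars_in S f" "\<And>i. i \<in> S \<Longrightarrow> z i = w i"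
  shows "mp_eval \<phi> f z = mp_eval \<phi> f w"
proof -
  have "mon_eval a z = mon_eval a w" if "a \<in> keys f" for a
    using assms that by (intro mon_eval_cong) (auto simp: vars_in_def)
  then show ?thesis by (simp add: mp_eval_mon)
qed

text \<open>Characters of a monoid with values in a domain are linearly independent (Artin);
  here the characters are the monomials.\<close>

lemma monomials_independent:
  fixes c :: "(nat \<Rightarrow>\<^sub>0 nat) \<Rightarrow> int"
  assumes "finite A" "\<And>x. (\<Sum>a\<in>A. c a * mon_eval a x) = 0" "a \<in> A"
  shows "c a = 0"
  using assms
proof (induction A arbitrary: c a rule: finite_induct)
  case (insert b A)
  have mult: "mon_eval a (\<lambda>i. x i * y i) = mon_eval a x * mon_eval a y" for a and x y :: "nat \<Rightarrow> int"
    by (simp add: mon_eval_def power_mult_distrib prod.distrib)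
  have A: "c a = 0" if a: "a \<in> A" for a
  proof -
    have "a \<noteq> b" using a insert.hyps by auto
    then obtain i where i: "lookup a i \<noteq> lookup b i"
      using poly_mapping_eqI[of a b] by blast
    \<comment> \<open>At this point the characters \<open>a\<close> and \<open>b\<close> take
      different values. Translating the relation by \<open>y\<close> and subtracting
      \<open>mon_eval b y\<close> times the relation itself removes \<open>b\<close>.\<close>
    define y where "y = (\<lambda>j. if j = i then 2 else 1 :: int)"
    have y: "mon_eval d y = 2 ^ lookup d i" for d
    proof -
      have "mon_eval d y = (\<Prod>j\<in>insert i (keys d). y j ^ lookup d j)"
        by (rule mon_eval_superset) auto
      also have "\<dots> = (\<Prod>j\<in>{i}. y j ^ lookup d j)"
        by (rule prod.mono_neutral_right) (auto simp: y_def)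
      finally show ?thesis by (simp add: y_def)
    qed
    have "(\<Sum>a\<in>A. (c a * (mon_eval a y - mon_eval b y)) * mon_eval a x) = 0" for x
    proof -
      have "c b * mon_eval b (\<lambda>i. x i * y i) + (\<Sum>a\<in>A. c a * mon_eval a (\<lambda>i. x i * y i)) = 0"
        using insert.prems(1)[of "\<lambda>i. x i * y i"] insert.hyps by simp
      moreover have "c b * mon_eval b x + (\<Sum>a\<in>A. c a * mon_eval a x) = 0"
        using insert.prems(1)[of x] insert.hyps by simp
      ultimately have "c b * (mon_eval b x * mon_eval b y) + (\<Sum>a\<in>A. c a * (mon_eval a x * mon_eval a y))
         - mon_eval b y * (c b * mon_eval b x + (\<Sum>a\<in>A. c a * mon_eval a x)) = 0"
        by (simp add: mult)
      then have "(\<Sum>a\<in>A. c a * (mon_eval a x * mon_eval a y)) - mon_eval b y * (\<Sum>a\<in>A. c a * mon_eval a x) = 0"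
        by (simp add: algebra_simps)
      moreover have "(\<Sum>a\<in>A. (c a * (mon_eval a y - mon_eval b y)) * mon_eval a x)
         = (\<Sum>a\<in>A. c a * (mon_eval a x * mon_eval a y) - mon_eval b y * (c a * mon_eval a x))"
        by (intro sum.cong refl) (simp add: algebra_simps)
      ultimately show ?thesis by (simp only: sum_subtractf sum_distrib_left)
    qed
    from insert.IH[OF this a] have "c a * (mon_eval a y - mon_eval b y) = 0" .
    moreover have "mon_eval a y \<noteq> mon_eval b y" unfolding y using i by simp
    ultimately show ?thesis by simp
  qed
  have "(\<Sum>a\<in>insert b A. c a * mon_eval a (\<lambda>_. 1)) = c b"
    using insert.hyps A by (simp add: mon_eval_def)
  with insert.prems(1)[of "\<lambda>_. 1"] have "c b = 0" by simp
  with A insert.prems(2) show ?case by auto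
qed simp

lemma mp_eval_nonzero_exists:
  fixes f :: "(nat \<Rightarrow>\<^sub>0 nat) \<Rightarrow>\<^sub>0 int"
  assumes "f \<noteq> 0"
  shows "\<exists>x. mp_eval id f x \<noteq> 0"
proof (rule ccontr)
  assume "\<not> ?thesis"
  then have "(\<Sum>a\<in>keys f. lookup f a * mon_eval a x) = 0" for x
    by (simp add: mp_eval_mon)
  from monomials_independent[OF _ this] have "lookup f a = 0" if "a \<in> keys f" for a
    using that by simp
  then have "lookup f a = 0" for a by (cases "a \<in> keys f") (auto simp: in_keys_iff)
  then have "f = 0" by (intro poly_mapping_eqI) simp
  with assms show False by simp
qed

text \<open>Multiplication by the product of all denominators keeps the zero set, so the elimination
  can be done with integral coefficients, as reduction modulo primes demands.\<close>

lemma mp_clear_denominators: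
  fixes f :: "(nat \<Rightarrow>\<^sub>0 nat) \<Rightarrow>\<^sub>0 rat"
  assumes "vars_in S f"
  shows "\<exists>f' :: (nat \<Rightarrow>\<^sub>0 nat) \<Rightarrow>\<^sub>0 int. vars_in S f' \<and>
     (\<forall>z::nat \<Rightarrow> complex. mp_eval of_int f' z = 0 \<longleftrightarrow> mp_eval of_rat f z = 0)"
proof -
  let ?K = "keys f"
  let ?c = "lookup f"
  define d where "d = (\<lambda>a. snd (quotient_of (?c a)))"
  have d: "d a > 0" for a unfolding d_def by (rule quotient_of_denom_pos')
  define N where "N = (\<lambda>a. fst (quotient_of (?c a)) * (\<Prod>b\<in>?K - {a}. d b))"
  have N: "of_int (N a) = of_int (\<Prod>b\<in>?K. d b) * ?c a" if "a \<in> ?K" for a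
  proof -
    have "?c a = of_int (fst (quotient_of (?c a))) / of_int (d a)"
      unfolding d_def by (metis prod.collapse quotient_of_div)
    moreover have "(of_int (d a) :: rat) \<noteq> 0" using d[of a] by simp
    ultimately have "of_int (fst (quotient_of (?c a))) = of_int (d a) * ?c a"
      by (metis nonzero_eq_divide_eq mult.commute)
    then show ?thesis using that unfolding N_def by (subst prod.remove[of _ a]) auto
  qed
  define f' where "f' = (\<Sum>a\<in>?K. single a (N a))"
  have "vars_in S f'" unfolding f'_def using assms by (intro vars_in_sum vars_in_single) (auto simp: vars_in_def)
  moreover have "mp_eval of_int f' z = of_int (\<Prod>b\<in>?K. d b) * mp_eval of_rat f z" for z :: "nat \<Rightarrow> complex"
  proof -
    have "mp_eval of_int f' z = (\<Sum>a\<in>?K. of_int (N a) * mon_eval a z)"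
      by (simp add: f'_def mp_eval_sum mp_eval_single)
    also have "\<dots> = (\<Sum>a\<in>?K. of_int (\<Prod>b\<in>?K. d b) * (of_rat (?c a) * mon_eval a z))"
    proof (rule sum.cong[OF refl])
      fix a assume "a \<in> ?K"
      then have "(of_rat (of_int (N a)) :: complex) = of_rat (of_int (\<Prod>b\<in>?K. d b) * ?c a)" by (simp only: N)
      then show "of_int (N a) * mon_eval a z = of_int (\<Prod>b\<in>?K. d b) * (of_rat (?c a) * mon_eval a z)"
        by (simp only: of_rat_mult of_rat_of_int_eq mult.assoc)
    qed
    finally show ?thesis by (simp add: mp_eval_mon sum_distrib_left)
  qed
  moreover have "(of_int (\<Prod>b\<in>?K. d b) :: complex) \<noteq> 0"
    using d by (simp add: less_imp_neq[symmetric] del: of_int_prod)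
  ultimately show ?thesis by (intro exI[of _ f']) auto
qed

text \<open>Needed because \<open>zar_closed\<close> speaks of complex coefficients evaluated with
  \<open>id\<close>, whereas the equations in \<open>F\<close> are rational.\<close>

lemma mp_push_coefficients:
  assumes "ring_map \<phi>" "vars_in S f"
  shows "\<exists>f'. vars_in S f' \<and> (\<forall>z. mp_eval id f' z = mp_eval \<phi> f z)"
proof -
  define f' where "f' = (\<Sum>a\<in>keys f. single a (\<phi> (lookup f a)))"
  have "vars_in S f'" unfolding f'_def using assms by (intro vars_in_sum vars_in_single) (auto simp: vars_in_def)
  moreover have "mp_eval id f' z = mp_eval \<phi> f z" for z
  proof -
    have "mp_eval id f' z = (\<Sum>a\<in>keys f. id (\<phi> (lookup f a)) * mon_eval a z)"
      by (simp only: f'_def mp_eval_sum[OF ring_map_id] mp_eval_single[OF ring_map_id])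
    then show ?thesis by (simp add: mp_eval_mon)
  qed
  ultimately show ?thesis by blast
qed

section \<open>Polynomials in one distinguished variable: evaluation and pseudo-division\<close>

definition coeffs_in :: "'a::zero set \<Rightarrow> 'a poly \<Rightarrow> bool" where
  "coeffs_in R p \<longleftrightarrow> (\<forall>m. coeff p m \<in> R)"

text \<open>With \<open>h\<close> the evaluation of coefficients at a point, this is the value of a
  multivariate polynomial whose distinguished variable has been given the value \<open>y\<close>
  separately.\<close>

definition hom_eval :: "('a::comm_ring_1 \<Rightarrow> 'b::comm_ring_1) \<Rightarrow> 'b \<Rightarrow> 'a poly \<Rightarrow> 'b" where
  "hom_eval h y p = poly (map_poly h p) y"

lemma map_poly_add: "ring_map h \<Longrightarrow> map_poly h (p + q) = map_poly h p + map_poly h q"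
  by (intro poly_eqI) (simp add: coeff_map_poly ring_mapD)

lemma hom_eval_add: "ring_map h \<Longrightarrow> hom_eval h y (p + q) = hom_eval h y p + hom_eval h y q"
  by (simp add: hom_eval_def map_poly_add)

lemma hom_eval_smult: "ring_map h \<Longrightarrow> hom_eval h y (smult c p) = h c * hom_eval h y p"
  unfolding hom_eval_def by (subst map_poly_smult) (auto simp: ring_mapD)

lemma hom_eval_pCons: "ring_map h \<Longrightarrow> hom_eval h y (pCons c p) = h c + y * hom_eval h y p"
  unfolding hom_eval_def by (subst map_poly_pCons) (auto simp: ring_mapD)

lemma hom_eval_zero [simp]: "hom_eval h y 0 = 0"
  by (simp add: hom_eval_def)

lemma hom_eval_mult:
  assumes "ring_map h"
  shows "hom_eval h y (p * q) = hom_eval h y p * hom_eval h y q"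
  by (induction p) (simp_all add: hom_eval_add[OF assms] hom_eval_smult[OF assms] hom_eval_pCons[OF assms]
      ring_mapD[OF assms] algebra_simps)

lemma hom_eval_sum: "ring_map h \<Longrightarrow> hom_eval h y (\<Sum>a\<in>A. f a) = (\<Sum>a\<in>A. hom_eval h y (f a))"
  by (induction A rule: infinite_finite_induct) (auto simp: hom_eval_add)

lemma hom_eval_monom: "ring_map h \<Longrightarrow> hom_eval h y (monom c m) = h c * y ^ m"
  unfolding hom_eval_def by (subst map_poly_monom) (auto simp: ring_mapD poly_monom)

lemma hom_eval_alt:
  assumes "ring_map h"
  shows "hom_eval h y p = (\<Sum>m\<le>degree p. h (coeff p m) * y ^ m)"
  by (subst poly_as_sum_of_monoms[of p, symmetric]) (simp add: hom_eval_sum[OF assms] hom_eval_monom[OF assms])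

lemma split_variable:
  fixes f :: "(nat \<Rightarrow>\<^sub>0 nat) \<Rightarrow>\<^sub>0 int"
  assumes "vars_in S f"
  shows "\<exists>P. coeffs_in {c. vars_in (S - {i}) c} P \<and>
    (\<forall>z::nat \<Rightarrow> complex. mp_eval of_int f z = hom_eval (\<lambda>c. mp_eval of_int c z) (z i) P)"
proof -
  let ?K = "keys f"
  \<comment> \<open>The exponent of \<open>i\<close> is erased from each monomial and becomes the
    degree.\<close>
  define P where "P = (\<Sum>a\<in>?K. monom (single (Poly_Mapping.update i 0 a) (lookup f a)) (lookup a i))"
  have "coeffs_in {c. vars_in (S - {i}) c} P"
    unfolding coeffs_in_def P_def coeff_sum
  proof (intro allI CollectI vars_in_sum)
    fix m a assume a: "a \<in> ?K"
    have "keys (Poly_Mapping.update i 0 a) \<subseteq> S - {i}"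
      using a assms by (auto simp: vars_in_def keys_update)
    then show "vars_in (S - {i}) (coeff (monom (single (Poly_Mapping.update i 0 a) (lookup f a)) (lookup a i)) m)"
      by (auto simp: coeff_monom vars_in_single)
  qed
  moreover have "mp_eval of_int f z = hom_eval (\<lambda>c. mp_eval of_int c z) (z i) P" for z :: "nat \<Rightarrow> complex"
  proof -
    have h: "ring_map (\<lambda>c. mp_eval of_int c z)" by (rule ring_map_mp_eval) simp
    have m: "mon_eval a z = mon_eval (Poly_Mapping.update i 0 a) z * z i ^ lookup a i" for a
    proof -
      have "a = Poly_Mapping.update i 0 a + single i (lookup a i)"
        by (rule poly_mapping_eqI) (simp add: lookup_add lookup_update lookup_single when_def)
      then show ?thesis by (metis mon_eval_add mon_eval_single)
    qed
    have "hom_eval (\<lambda>c. mp_eval of_int c z) (z i) P = (\<Sum>a\<in>?K. of_int (lookup f a) * mon_eval (Poly_Mapping.update i 0 a) z * z i ^ lookup a i)"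
      by (simp add: P_def hom_eval_sum[OF h] hom_eval_monom[OF h] mp_eval_single)
    also have "\<dots> = mp_eval of_int f z" by (simp add: mp_eval_mon m[symmetric] mult.assoc)
    finally show ?thesis by simp
  qed
  ultimately show ?thesis by blast
qed

text \<open>The polynomials without the variable \<open>i\<close> are a subset of a type and not a
  type of their own; this predicate carries them through the division algorithm.\<close>

definition subring_set :: "'a::comm_ring_1 set \<Rightarrow> bool" where
  "subring_set R \<longleftrightarrow> 0 \<in> R \<and> 1 \<in> R \<and> (\<forall>x\<in>R. \<forall>y\<in>R. x + y \<in> R \<and> x - y \<in> R \<and> x * y \<in> R)"

lemma subring_setD:
  assumes "subring_set R"
  shows "0 \<in> R" "1 \<in> R" "x \<in> R \<Longrightarrow> y \<in> R \<Longrightarrow> x + y \<in> R" "x \<in> R \<Longrightarrow> y \<in> R \<Longrightarrow> x - y \<in> R"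
    "x \<in> R \<Longrightarrow> y \<in> R \<Longrightarrow> x * y \<in> R"
  using assms by (auto simp: subring_set_def)

lemma subring_set_sum: "subring_set R \<Longrightarrow> (\<And>a. a \<in> A \<Longrightarrow> f a \<in> R) \<Longrightarrow> (\<Sum>a\<in>A. f a) \<in> R"
  by (induction A rule: infinite_finite_induct) (auto intro: subring_setD)

lemma subring_set_of_nat: "subring_set R \<Longrightarrow> of_nat m \<in> R"
  by (induction m) (auto intro: subring_setD)

lemma subring_set_power: "subring_set R \<Longrightarrow> x \<in> R \<Longrightarrow> x ^ m \<in> R"
  by (induction m) (auto intro: subring_setD)

lemma subring_vars_in: "subring_set {c::(nat \<Rightarrow>\<^sub>0 nat) \<Rightarrow>\<^sub>0 int. vars_in S c}"
  by (auto simp: subring_set_def intro: vars_in_add vars_in_diff vars_in_mult)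

lemma coeffs_in_ops:
  assumes R: "subring_set R"
  shows "coeffs_in R 0" "coeffs_in R p \<Longrightarrow> coeffs_in R q \<Longrightarrow> coeffs_in R (p + q)"
    "coeffs_in R p \<Longrightarrow> coeffs_in R q \<Longrightarrow> coeffs_in R (p - q)"
    "c \<in> R \<Longrightarrow> coeffs_in R p \<Longrightarrow> coeffs_in R (smult c p)"
    "coeffs_in R p \<Longrightarrow> coeffs_in R q \<Longrightarrow> coeffs_in R (p * q)"
    "c \<in> R \<Longrightarrow> coeffs_in R (monom c m)"
  using subring_setD[OF R] subring_set_sum[OF R] by (auto simp: coeffs_in_def coeff_mult coeff_monom intro!: subring_set_sum[OF R] subring_setD(5)[OF R])

lemma coeffs_in_pderiv: "subring_set R \<Longrightarrow> coeffs_in R p \<Longrightarrow> coeffs_in R (pderiv p)"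
  using subring_set_of_nat[of R "Suc _"] by (auto simp: coeffs_in_def coeff_pderiv intro!: subring_setD(5) simp del: of_nat_Suc)

text \<open>Leading coefficients cannot be inverted in \<open>R\<close>, so \<open>p\<close> is
  multiplied by \<open>lead_coeff g\<close> before its leading term is cancelled; each round lowers
  the degree and stays over \<open>R\<close>.\<close>

lemma pseudo_division:
  fixes g p :: "'a::idom poly"
  assumes R: "subring_set R" and g: "coeffs_in R g" "g \<noteq> 0" and p: "coeffs_in R p"
  shows "\<exists>m q r. coeffs_in R q \<and> coeffs_in R r \<and> smult (lead_coeff g ^ m) p = g * q + r \<and> (r = 0 \<or> degree r < degree g)"
  using p
proof (induction "degree p" arbitrary: p rule: less_induct)
  case (less p)
  show ?case
  proof (cases "p = 0 \<or> degree p < degree g")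
    case True
    then show ?thesis using less.prems coeffs_in_ops(1)[OF R]
      by (intro exI[of _ 0] exI[of _ 0] exI[of _ p]) auto
  next
    case False
    define t where "t = monom (lead_coeff p) (degree p - degree g)"
    define p' where "p' = smult (lead_coeff g) p - t * g"
    have lc: "lead_coeff g \<in> R" "lead_coeff p \<in> R" using g less.prems by (auto simp: coeffs_in_def)
    have t: "coeffs_in R t" unfolding t_def by (intro coeffs_in_ops(6)[OF R] lc)
    have p': "coeffs_in R p'" unfolding p'_def by (intro coeffs_in_ops[OF R] lc t g less.prems)
    have step: "smult (lead_coeff g) p = t * g + p'" by (simp add: p'_def)
    have "degree g \<le> degree p" using False by simp
    then have dt: "degree (t * g) \<le> degree p"
      using degree_mult_le[of t g] degree_monom_le[of "lead_coeff p" "degree p - degree g"] unfolding t_def by linarith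
    have "degree p' \<le> degree p" unfolding p'_def using dt by (intro degree_diff_le) (auto simp: degree_smult_le)
    moreover have "coeff p' (degree p) = 0"
      unfolding p'_def t_def using False by (simp add: coeff_monom_mult)
    ultimately have "p' = 0 \<or> degree p' < degree p" by (rule eq_zero_or_degree_less)
    then have "\<exists>m q r. coeffs_in R q \<and> coeffs_in R r \<and> smult (lead_coeff g ^ m) p' = g * q + r \<and> (r = 0 \<or> degree r < degree g)"
    proof
      assume "p' = 0"
      then show ?thesis using coeffs_in_ops(1)[OF R] by (intro exI[of _ 0] exI[of _ 0] exI[of _ 0]) auto
    qed (use less.hyps p' in blast)
    then obtain m q r where qr: "coeffs_in R q" "coeffs_in R r" "smult (lead_coeff g ^ m) p' = g * q + r" "r = 0 \<or> degree r < degree g"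
      by blast
    have "smult (lead_coeff g ^ Suc m) p = smult (lead_coeff g ^ m) (smult (lead_coeff g) p)" by (simp add: mult.commute)
    also have "\<dots> = g * (smult (lead_coeff g ^ m) t + q) + r"
      unfolding step smult_add_right qr(3) by (simp add: algebra_simps)
    finally show ?thesis using qr t lc
      by (intro exI[of _ "Suc m"] exI[of _ "smult (lead_coeff g ^ m) t + q"] exI[of _ r])
        (auto intro!: coeffs_in_ops[OF R] subring_set_power[OF R])
  qed
qed

section \<open>Root functions and Zariski chains\<close>

text \<open>Coordinates outside \<open>S\<close> are frozen at those of the centre, so a disc around
  a point of \<open>cox_space k\<close> with \<open>S\<close> below \<open>k\<close> stays in that
  space.\<close>

definition polydisc :: "nat set \<Rightarrow> (nat \<Rightarrow> complex) \<Rightarrow> real \<Rightarrow> (nat \<Rightarrow> complex) set" where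
  "polydisc S z \<delta> = {w. (\<forall>j\<in>S. dist (w j) (z j) < \<delta>) \<and> (\<forall>j. j \<notin> S \<longrightarrow> w j = z j)}"

text \<open>The complex line through \<open>a\<close> (at 0) and \<open>b\<close> (at 1). All
  analysis is done along such lines, which reduces several complex variables to one.\<close>

definition cline :: "(nat \<Rightarrow> complex) \<Rightarrow> (nat \<Rightarrow> complex) \<Rightarrow> complex \<Rightarrow> nat \<Rightarrow> complex" where
  "cline a b s = (\<lambda>j. a j + s * (b j - a j))"

lemma center_in_polydisc: "\<delta> > 0 \<Longrightarrow> z \<in> polydisc S z \<delta>"
  by (simp add: polydisc_def)

lemma open_contains_polydisc:
  assumes "open U" "z \<in> U" "finite S"
  shows "\<exists>\<delta>>0. polydisc S z \<delta> \<subseteq> U"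
proof -
  have "openin (product_topology (\<lambda>i. euclidean) UNIV) U" using assms(1) unfolding open_fun_def .
  from product_topology_open_contains_basis[OF this assms(2)]
  obtain X where X: "z \<in> (\<Pi>\<^sub>E i\<in>UNIV. X i)" "\<And>i. open (X i)" "(\<Pi>\<^sub>E i\<in>UNIV. X i) \<subseteq> U"
    by auto
  have "\<forall>j. \<exists>e>0. ball (z j) e \<subseteq> X j"
  proof
    fix j
    have "z j \<in> X j" using X(1) by (auto simp: PiE_iff)
    with X(2) show "\<exists>e>0. ball (z j) e \<subseteq> X j" by (meson openE)
  qed
  then obtain e where e: "\<And>j. e j > 0" "\<And>j. ball (z j) (e j) \<subseteq> X j" by metis
  \<comment> \<open>Inserting 1 keeps the minimum defined and positive when \<open>S\<close> is
    empty.\<close>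
  define \<delta> where "\<delta> = Min (insert 1 (e ` S))"
  have \<delta>: "\<delta> > 0" unfolding \<delta>_def using assms(3) e(1) by (subst Min_gr_iff) auto
  have le: "\<delta> \<le> e j" if "j \<in> S" for j unfolding \<delta>_def using assms(3) that by (intro Min_le) auto
  have "polydisc S z \<delta> \<subseteq> U"
  proof
    fix w assume w: "w \<in> polydisc S z \<delta>"
    have "w j \<in> X j" for j
    proof (cases "j \<in> S")
      case True
      then have "dist (z j) (w j) < e j" using w le[of j] by (force simp: polydisc_def dist_commute)
      then show ?thesis using e(2)[of j] by auto
    next
      case False
      then show ?thesis using w X(1) by (auto simp: polydisc_def PiE_iff)
    qed
    then show "w \<in> U" using X(3) by (auto simp: PiE_iff)
  qed
  with \<delta> show ?thesis by blast
qed

lemma cline_0 [simp]: "cline a b 0 = a" and cline_1 [simp]: "cline a b 1 = b"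
  by (auto simp: cline_def)

lemma cline_polydisc_set:
  assumes "a \<in> polydisc S z \<delta>" "b \<in> polydisc S z \<delta>"
  shows "{s. cline a b s \<in> polydisc S z \<delta>} = (\<Inter>j\<in>S. {s. dist (cline a b s j) (z j) < \<delta>})"
proof -
  have "cline a b s j = z j" if "j \<notin> S" for s j
    using assms that by (simp add: polydisc_def cline_def)
  then show ?thesis by (auto simp: polydisc_def)
qed

lemma open_cline_polydisc:
  assumes "finite S" "a \<in> polydisc S z \<delta>" "b \<in> polydisc S z \<delta>"
  shows "open {s. cline a b s \<in> polydisc S z \<delta>}"
  unfolding cline_polydisc_set[OF assms(2,3)]
proof (rule open_INT[OF assms(1)], rule ballI)
  fix j
  show "open {s. dist (cline a b s j) (z j) < \<delta>}"
    unfolding cline_def by (intro open_Collect_less continuous_intros)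
qed

text \<open>Each condition is the preimage of a ball under an affine map. Convexity provides the
  connected domain for the identity theorem.\<close>

lemma convex_cline_polydisc:
  assumes "a \<in> polydisc S z \<delta>" "b \<in> polydisc S z \<delta>"
  shows "convex {s. cline a b s \<in> polydisc S z \<delta>}"
  unfolding cline_polydisc_set[OF assms]
proof (rule convex_INT)
  fix j
  have eq: "{s. dist (cline a b s j) (z j) < \<delta>} = (\<lambda>s. a j + (b j - a j) * s) -` ball (z j) \<delta>"
    by (auto simp: cline_def dist_commute mult.commute)
  have "convex ((\<lambda>s. (b j - a j) * s) -` ((\<lambda>x. - a j + x) ` ball (z j) \<delta>))"
    by (intro convex_linear_vimage convex_translation convex_ball bounded_linear.linear bounded_linear_mult_right)
  also have "(\<lambda>s. (b j - a j) * s) -` ((\<lambda>x. - a j + x) ` ball (z j) \<delta>) = (\<lambda>s. a j + (b j - a j) * s) -` ball (z j) \<delta>"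
    by (force simp: image_iff algebra_simps)
  finally show "convex {s. dist (cline a b s j) (z j) < \<delta>}" unfolding eq .
qed

lemma continuous_on_mp_eval:
  "continuous_on UNIV (\<lambda>w :: nat \<Rightarrow> complex. mp_eval \<phi> f w)"
  unfolding mp_eval_def
  by (intro continuous_intros continuous_on_product_coordinates)

lemma holomorphic_on_mp_eval:
  assumes "\<And>j. (\<lambda>s. u s j) holomorphic_on A"
  shows "(\<lambda>s. mp_eval \<phi> f (u s)) holomorphic_on A"
  unfolding mp_eval_def by (intro holomorphic_intros assms)

lemma ring_map_of_nat: "ring_map h \<Longrightarrow> h (of_nat m) = of_nat m"
  by (induction m) (auto simp: ring_mapD)

lemma map_poly_pderiv: "ring_map h \<Longrightarrow> map_poly h (pderiv p) = pderiv (map_poly h p)"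
  by (intro poly_eqI) (simp add: coeff_map_poly coeff_pderiv ring_mapD ring_map_of_nat del: of_nat_Suc)

abbreviation ceval :: "(nat \<Rightarrow> complex) \<Rightarrow> ((nat \<Rightarrow>\<^sub>0 nat) \<Rightarrow>\<^sub>0 int) \<Rightarrow> complex" where
  "ceval w c \<equiv> mp_eval of_int c w"

lemma ring_map_ceval: "ring_map (ceval w)"
  by (rule ring_map_mp_eval) simp

lemma hom_eval_DERIV:
  assumes "ring_map h"
  shows "((\<lambda>y. hom_eval h y g) has_field_derivative hom_eval h y (pderiv g)) (at y within A)"
  unfolding hom_eval_def map_poly_pderiv[OF assms]
  by (rule has_field_derivative_at_within[OF poly_DERIV])

lemma continuous_on_hom_eval:
  "continuous_on UNIV (\<lambda>p. hom_eval (ceval (fst p)) (snd p) g)"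
  unfolding hom_eval_alt[OF ring_map_ceval]
  by (intro continuous_intros continuous_on_compose2[OF continuous_on_mp_eval]) auto

lemma holomorphic_on_hom_eval:
  assumes "\<And>j. (\<lambda>s. u s j) holomorphic_on A" "f holomorphic_on A"
  shows "(\<lambda>s. hom_eval (ceval (u s)) (f s) g) holomorphic_on A"
  unfolding hom_eval_alt[OF ring_map_ceval]
  by (intro holomorphic_intros holomorphic_on_mp_eval assms)

lemma holomorphic_on_cline: "(\<lambda>s. cline a b s j) holomorphic_on A"
  unfolding cline_def by (intro holomorphic_intros)

text \<open>The root is the limit of the simplified Newton iteration
  \<open>y \<mapsto> y - G w y / G' z y0\<close>; the iterates are polynomial in \<open>w\<close> and converge uniformly,
  so the limit is holomorphic along lines.\<close>

lemma local_root_function: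
  fixes g :: "((nat \<Rightarrow>\<^sub>0 nat) \<Rightarrow>\<^sub>0 int) poly"
  assumes S: "finite S" and root: "hom_eval (ceval z) y0 g = 0" and simple: "hom_eval (ceval z) y0 (pderiv g) \<noteq> 0"
    and l: "ceval z l \<noteq> 0"
  shows "\<exists>\<delta>>0. \<exists>\<phi>. \<phi> z = y0 \<and>
    (\<forall>w\<in>polydisc S z \<delta>. hom_eval (ceval w) (\<phi> w) g = 0 \<and> ceval w l \<noteq> 0) \<and>
    (\<forall>a\<in>polydisc S z \<delta>. \<forall>b\<in>polydisc S z \<delta>. (\<lambda>s. \<phi> (cline a b s)) holomorphic_on {s. cline a b s \<in> polydisc S z \<delta>})"
proof -
  define G where "G = (\<lambda>w y. hom_eval (ceval w) y g)"
  define G' where "G' = (\<lambda>w y. hom_eval (ceval w) y (pderiv g))"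
  define A where "A = G' z y0"
  have A: "A \<noteq> 0" using simple by (simp add: A_def G'_def)
  have contG: "continuous_on UNIV (\<lambda>p. G (fst p) (snd p))" and contG': "continuous_on UNIV (\<lambda>p. G' (fst p) (snd p))"
    unfolding G_def G'_def by (rule continuous_on_hom_eval)+
  have contGy: "continuous_on UNIV (\<lambda>w. G w y)" for y
    using continuous_on_compose2[OF contG, of UNIV "\<lambda>w. (w, y)"] by (simp add: continuous_intros)
  have contGw: "continuous_on UNIV (G w)" for w
    using continuous_on_compose2[OF contG, of UNIV "\<lambda>y. (w, y)"] by (simp add: continuous_intros)
  have DG: "(G w has_field_derivative G' w y) (at y within X)" for w y X
    unfolding G_def G'_def by (rule hom_eval_DERIV[OF ring_map_ceval])
  \<comment> \<open>The derivative of the Newton map is \<open>1 - G' / A\<close>. It vanishes at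
    \<open>(z, y0)\<close>, so near that point the map contracts by the factor 1/2.\<close>
  define V where "V = {p. norm (1 - G' (fst p) (snd p) / A) < 1 / 2}"
  have V: "open V" unfolding V_def
    using A by (intro open_Collect_less continuous_intros contG') auto
  have "(z, y0) \<in> V" using A by (simp add: V_def A_def)
  with V obtain U1 U2 where "open U1" "open U2" "(z, y0) \<in> U1 \<times> U2" "U1 \<times> U2 \<subseteq> V"
    by (rule open_prod_elim)
  then have U: "open U1" "open U2" "z \<in> U1" "y0 \<in> U2" "U1 \<times> U2 \<subseteq> V" by auto
  obtain \<rho> where \<rho>: "\<rho> > 0" "cball y0 \<rho> \<subseteq> U2" using U by (meson open_contains_cball)
  \<comment> \<open>The first Newton step is required to be shorter than \<open>\<rho> / 2\<close>;
    with contraction by 1/2 all iterates then stay within distance \<open>\<rho>\<close> of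
    \<open>y0\<close>.\<close>
  have "open ({w. norm (G w y0 / A) < \<rho> / 2} \<inter> U1 \<inter> {w. ceval w l \<noteq> 0})"
    using U A by (intro open_Int open_Collect_less open_Collect_neq continuous_intros contGy continuous_on_mp_eval) auto
  moreover have "z \<in> {w. norm (G w y0 / A) < \<rho> / 2} \<inter> U1 \<inter> {w. ceval w l \<noteq> 0}"
    using U \<rho> root l by (simp add: G_def)
  ultimately obtain \<delta> where \<delta>: "\<delta> > 0" "polydisc S z \<delta> \<subseteq> {w. norm (G w y0 / A) < \<rho> / 2} \<inter> U1 \<inter> {w. ceval w l \<noteq> 0}"
    using open_contains_polydisc[OF _ _ S] by blast
  let ?D = "polydisc S z \<delta>"
  define T where "T = (\<lambda>w y. y - G w y / A)"
  define Y where "Y = (\<lambda>m w. (T w ^^ m) y0)"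
  have Y0: "Y 0 w = y0" and YS: "Y (Suc m) w = T w (Y m w)" for m w by (simp_all add: Y_def)
  have lip: "norm (T w y - T w y') \<le> 1 / 2 * norm (y - y')" if "w \<in> ?D" "y \<in> cball y0 \<rho>" "y' \<in> cball y0 \<rho>" for w y y'
  proof (rule field_differentiable_bound[OF convex_cball _ _ that(2,3), where f' = "\<lambda>y. 1 - G' w y / A"])
    show "(T w has_field_derivative 1 - G' w y / A) (at y within cball y0 \<rho>)" for y
      unfolding T_def by (intro DERIV_diff DERIV_ident DERIV_cdivide DG)
    show "norm (1 - G' w y / A) \<le> 1 / 2" if "y \<in> cball y0 \<rho>" for y
    proof -
      have "(w, y) \<in> U1 \<times> U2" using \<delta>(2) \<rho>(2) \<open>w \<in> ?D\<close> that by auto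
      with U(5) have "(w, y) \<in> V" by blast
      then show ?thesis by (simp add: V_def)
    qed
  qed
  have first: "norm (T w y0 - y0) \<le> \<rho> / 2" if "w \<in> ?D" for w
    using \<delta>(2) that by (auto simp: T_def norm_minus_commute intro: less_imp_le)
  have step: "Y m w \<in> cball y0 (\<rho> * (1 - (1 / 2) ^ m)) \<and> norm (Y (Suc m) w - Y m w) \<le> \<rho> / 2 * (1 / 2) ^ m" if w: "w \<in> ?D" for m w
  proof (induction m)
    case 0
    then show ?case using first[OF w] by (simp add: YS Y0)
  next
    case (Suc m)
    have "dist y0 (Y (Suc m) w) \<le> dist y0 (Y m w) + dist (Y m w) (Y (Suc m) w)" by (rule dist_triangle)
    also have "\<dots> \<le> \<rho> * (1 - (1 / 2) ^ m) + \<rho> / 2 * (1 / 2) ^ m"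
      using Suc by (intro add_mono) (auto simp: dist_norm norm_minus_commute)
    also have "\<dots> = \<rho> * (1 - (1 / 2) ^ Suc m)" by (simp add: algebra_simps)
    finally have 1: "dist y0 (Y (Suc m) w) \<le> \<rho> * (1 - (1 / 2) ^ Suc m)" .
    have in\<rho>: "y \<in> cball y0 \<rho>" if "dist y0 y \<le> \<rho> * (1 - (1 / 2) ^ j)" for y j
    proof -
      have "\<rho> * (1 - (1 / 2) ^ j) \<le> \<rho> * 1" using \<rho>(1) by (intro mult_left_mono) auto
      with that show ?thesis by simp
    qed
    have "norm (Y (Suc (Suc m)) w - Y (Suc m) w) = norm (T w (Y (Suc m) w) - T w (Y m w))" by (simp add: YS)
    also have "\<dots> \<le> 1 / 2 * norm (Y (Suc m) w - Y m w)"
      using Suc 1 by (intro lip[OF w] in\<rho>[of _ "Suc m"] in\<rho>[of _ m]) auto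
    also have "\<dots> \<le> 1 / 2 * (\<rho> / 2 * (1 / 2) ^ m)" using Suc by (intro mult_left_mono) auto
    finally show ?case using 1 by simp
  qed
  have dist_le: "dist (Y m w) (Y (m + j) w) \<le> \<rho> * (1 / 2) ^ m * (1 - (1 / 2) ^ j)" if w: "w \<in> ?D" for m j w
  proof (induction j)
    case (Suc j)
    have "dist (Y m w) (Y (m + Suc j) w) \<le> dist (Y m w) (Y (m + j) w) + dist (Y (m + j) w) (Y (m + Suc j) w)"
      by (rule dist_triangle)
    also have "\<dots> \<le> \<rho> * (1 / 2) ^ m * (1 - (1 / 2) ^ j) + \<rho> / 2 * (1 / 2) ^ (m + j)"
      using Suc step[OF w, of "m + j"] by (intro add_mono) (auto simp: dist_norm norm_minus_commute)
    also have "\<dots> = \<rho> * (1 / 2) ^ m * (1 - (1 / 2) ^ Suc j)" by (simp add: algebra_simps power_add)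
    finally show ?case .
  qed simp
  have dist_le': "dist (Y m w) (Y m' w) \<le> \<rho> * (1 / 2) ^ m" if "w \<in> ?D" "m \<le> m'" for m m' w
  proof -
    have "dist (Y m w) (Y m' w) \<le> \<rho> * (1 / 2) ^ m * (1 - (1 / 2) ^ (m' - m))"
      using dist_le[OF that(1), of m "m' - m"] that(2) by simp
    also have "\<dots> \<le> \<rho> * (1 / 2) ^ m * 1" using \<rho>(1) by (intro mult_left_mono) auto
    finally show ?thesis by simp
  qed
  have pow0: "(\<lambda>m. \<rho> * (1 / 2) ^ m) \<longlonglongrightarrow> 0"
    by (intro tendsto_mult_right_zero LIMSEQ_realpow_zero) auto
  have "convergent (\<lambda>m. Y m w)" if w: "w \<in> ?D" for w
  proof (rule Cauchy_convergent, rule CauchyI')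
    fix e :: real assume "e > 0"
    with pow0 obtain M where M: "\<And>m. m \<ge> M \<Longrightarrow> norm (\<rho> * (1 / 2) ^ m - 0) < e" by (meson LIMSEQ_D)
    show "\<exists>M. \<forall>m\<ge>M. \<forall>n>m. dist (Y m w) (Y n w) < e"
    proof (intro exI allI impI)
      fix m n assume mn: "M \<le> m" "m < n"
      have "dist (Y m w) (Y n w) \<le> \<rho> * (1 / 2) ^ m" using dist_le'[OF w, of m n] mn by simp
      also have "\<dots> < e" using M[OF mn(1)] by (simp add: abs_if split: if_splits)
      finally show "dist (Y m w) (Y n w) < e" .
    qed
  qed
  define \<phi> where "\<phi> = (\<lambda>w. lim (\<lambda>m. Y m w))"
  have lim: "(\<lambda>m. Y m w) \<longlonglongrightarrow> \<phi> w" if "w \<in> ?D" for w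
    unfolding \<phi>_def using \<open>\<And>w. w \<in> ?D \<Longrightarrow> convergent (\<lambda>m. Y m w)\<close>[OF that] by (simp add: convergent_LIMSEQ_iff)
  have rate: "dist (Y m w) (\<phi> w) \<le> \<rho> * (1 / 2) ^ m" if w: "w \<in> ?D" for m w
  proof (rule tendsto_upperbound)
    show "((\<lambda>m'. dist (Y m w) (Y m' w)) \<longlongrightarrow> dist (Y m w) (\<phi> w)) sequentially"
      by (intro tendsto_intros lim[OF w])
    show "\<forall>\<^sub>F m' in sequentially. dist (Y m w) (Y m' w) \<le> \<rho> * (1 / 2) ^ m"
      using eventually_ge_at_top[of m] by eventually_elim (rule dist_le'[OF w])
  qed simp
  have "Y m z = y0" for m
    using root by (induction m) (auto simp: YS Y0 T_def G_def)
  then have \<phi>z: "\<phi> z = y0" unfolding \<phi>_def by simp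
  have G0: "G w (\<phi> w) = 0" if w: "w \<in> ?D" for w
  proof -
    have "isCont (T w) (\<phi> w)"
      unfolding T_def using contGw[of w] A by (intro continuous_intros) (auto simp: continuous_on_eq_continuous_at)
    then have "(\<lambda>m. T w (Y m w)) \<longlonglongrightarrow> T w (\<phi> w)" using lim[OF w] by (rule isCont_tendsto_compose)
    moreover have "(\<lambda>m. T w (Y m w)) \<longlonglongrightarrow> \<phi> w" using LIMSEQ_Suc[OF lim[OF w]] by (simp add: YS)
    ultimately have "T w (\<phi> w) = \<phi> w" by (rule LIMSEQ_unique)
    then show ?thesis using A by (simp add: T_def)
  qed
  have hol: "(\<lambda>s. \<phi> (cline a b s)) holomorphic_on {s. cline a b s \<in> ?D}" if ab: "a \<in> ?D" "b \<in> ?D" for a b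
  proof (rule holomorphic_uniform_sequence[where f = "\<lambda>m s. Y m (cline a b s)"])
    show op: "open {s. cline a b s \<in> ?D}" by (rule open_cline_polydisc[OF S ab])
    show "(\<lambda>s. Y m (cline a b s)) holomorphic_on {s. cline a b s \<in> ?D}" for m
    proof (induction m)
      case (Suc m)
      then show ?case unfolding YS T_def G_def using A
        by (intro holomorphic_intros holomorphic_on_hom_eval holomorphic_on_cline)
    qed (simp add: Y0)
    fix s assume "s \<in> {s. cline a b s \<in> ?D}"
    with op obtain d where d: "d > 0" "cball s d \<subseteq> {s. cline a b s \<in> ?D}" by (meson open_contains_cball)
    have "uniform_limit (cball s d) (\<lambda>m s. Y m (cline a b s)) (\<lambda>s. \<phi> (cline a b s)) sequentially"
    proof (rule uniform_limitI)
      fix e :: real assume "e > 0"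
      with pow0 have "\<forall>\<^sub>F m in sequentially. \<rho> * (1 / 2) ^ m < e" by (rule order_tendstoD)
      then show "\<forall>\<^sub>F m in sequentially. \<forall>x\<in>cball s d. dist (Y m (cline a b x)) (\<phi> (cline a b x)) < e"
      proof eventually_elim
        case (elim m)
        show ?case
        proof
          fix x assume "x \<in> cball s d"
          then have "cline a b x \<in> ?D" using d(2) by blast
          from rate[OF this, of m] elim show "dist (Y m (cline a b x)) (\<phi> (cline a b x)) < e" by simp
        qed
      qed
    qed
    with d show "\<exists>d>0. cball s d \<subseteq> {s. cline a b s \<in> ?D} \<and>
       uniform_limit (cball s d) (\<lambda>m s. Y m (cline a b s)) (\<lambda>s. \<phi> (cline a b s)) sequentially" by blast
  qed
  have nz: "ceval w l \<noteq> 0" if "w \<in> ?D" for w using \<delta>(2) that by auto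
  show ?thesis using \<delta>(1) \<phi>z G0 hol nz unfolding G_def by blast
qed

section \<open>Zariski closures and the consequence of codimension two\<close>

definition zariski_closure :: "nat \<Rightarrow> (nat \<Rightarrow> complex) set \<Rightarrow> (nat \<Rightarrow> complex) set" where
  "zariski_closure k W = {x \<in> cox_space k. \<forall>f. vars_below k f \<and> (\<forall>w\<in>W. mp_eval id f w = 0) \<longrightarrow> mp_eval id f x = 0}"

lemma zar_closed_closure: "zar_closed k (zariski_closure k W)"
  unfolding zar_closed_def zariski_closure_def
  by (rule exI[of _ "{f. vars_below k f \<and> (\<forall>w\<in>W. mp_eval id f w = 0)}"]) auto

lemma zariski_closure_superset: "W \<subseteq> cox_space k \<Longrightarrow> W \<subseteq> zariski_closure k W"
  by (auto simp: zariski_closure_def)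

lemma zariski_closure_minimal:
  assumes "zar_closed k A" "W \<subseteq> A"
  shows "zariski_closure k W \<subseteq> A"
  using assms unfolding zar_closed_def zariski_closure_def by blast

lemma zariski_closure_mono: "W \<subseteq> W' \<Longrightarrow> zariski_closure k W \<subseteq> zariski_closure k W'"
  unfolding zariski_closure_def by blast

lemma zar_closed_cone_Z:
  assumes "\<forall>f\<in>F. vars_below k f"
  shows "zar_closed k (cone_Z k F)"
proof -
  have "\<forall>f\<in>F. \<exists>f'. vars_below k f' \<and> (\<forall>z::nat \<Rightarrow> complex. mp_eval id f' z = mp_eval of_rat f z)"
    using assms mp_push_coefficients[OF ring_map_of_rat] unfolding vars_below_vars_in by blast
  then obtain c where c: "\<And>f. f \<in> F \<Longrightarrow> vars_below k (c f)"
    "\<And>f z. f \<in> F \<Longrightarrow> mp_eval id (c f) z = mp_eval of_rat f (z :: nat \<Rightarrow> complex)" by metis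
  then show ?thesis unfolding zar_closed_def cone_Z_def by (intro exI[of _ "c ` F"]) auto
qed

text \<open>This makes the Zariski closure of a graph over a polydisc irreducible: two points of the graph
  lie on the holomorphic image of a convex subset of a complex line.\<close>

lemma holomorphic_product_zero:
  assumes f: "f holomorphic_on A" "g holomorphic_on A" and A: "open A" "connected A"
    and z: "\<And>s. s \<in> A \<Longrightarrow> f s * g s = 0" and a: "a \<in> A" "f a \<noteq> 0" and b: "b \<in> A"
  shows "g b = 0"
proof -
  have "continuous_on A f" using f(1) by (rule holomorphic_on_imp_continuous_on)
  then have op: "open (A \<inter> f -` (- {0}))" using A(1) by (intro continuous_open_preimage) auto
  have "g s = 0" if "s \<in> A \<inter> f -` (- {0})" for s using z[of s] that by auto
  moreover have "a islimpt (A \<inter> f -` (- {0}))" using a by (intro interior_limit_point) (unfold interior_open[OF op], auto)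
  ultimately show ?thesis using analytic_continuation[OF f(2) A _ a(1), of "A \<inter> f -` (- {0})" b] b by auto
qed

text \<open>Let only the first \<open>l\<close> coordinates of \<open>S\<close> vary and take the
  closure \<open>Y l\<close> of the graph over this slice. Each \<open>Y l\<close> is irreducible by
  the identity theorem along lines, and the inclusions are strict because the next coordinate is
  constant on \<open>Y l\<close> only. As \<open>S\<close> has \<open>k - 1\<close> elements, the
  chain has length \<open>k - 1\<close>, one more than \<open>codim_ge_2\<close> permits, and
  \<open>Y 0\<close> meets \<open>cox_U\<close> in \<open>z\<close>.\<close>

lemma chain_in_graph:
  assumes k: "i < k" and z: "z \<in> cox_U k \<Sigma>" and \<delta>: "\<delta> > 0"
    and S: "S = {..<k} - {i}"
    and \<phi>z: "\<phi> z = z i"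
    and V: "\<And>w. w \<in> polydisc S z \<delta> \<Longrightarrow> w(i := \<phi> w) \<in> cone_Z k F"
    and hol: "\<And>a b. a \<in> polydisc S z \<delta> \<Longrightarrow> b \<in> polydisc S z \<delta> \<Longrightarrow>
       (\<lambda>s. \<phi> (cline a b s)) holomorphic_on {s. cline a b s \<in> polydisc S z \<delta>}"
    and F: "\<forall>f\<in>F. vars_below k f"
  shows "\<not> codim_ge_2 k \<Sigma> F"
proof
  assume codim: "codim_ge_2 k \<Sigma> F"
  \<comment> \<open>Enumerates the indices below \<open>k\<close> other than \<open>i\<close>, by
    skipping \<open>i\<close>.\<close>
  define e where "e = (\<lambda>m. if m < i then m else Suc m)"
  have eS: "e m \<in> S" if "m < k - 1" for m using that k by (auto simp: e_def S)
  have einj: "inj e" by (auto simp: inj_def e_def split: if_splits)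
  define D where "D = (\<lambda>l. {w \<in> polydisc S z \<delta>. \<forall>j. j \<notin> e ` {..<l} \<longrightarrow> w j = z j})"
  define \<Phi> where "\<Phi> = (\<lambda>w. w(i := \<phi> w))"
  define Y where "Y = (\<lambda>l. zariski_closure k (\<Phi> ` D l))"
  have \<Phi>cone: "\<Phi> ` D l \<subseteq> cone_Z k F" for l using V by (auto simp: D_def \<Phi>_def)
  have \<Phi>cox: "\<Phi> ` D l \<subseteq> cox_space k" for l using \<Phi>cone[of l] by (auto simp: cone_Z_def)
  have zD: "z \<in> D l" for l using center_in_polydisc[OF \<delta>] by (auto simp: D_def)
  have \<Phi>z: "\<Phi> z = z" by (simp add: \<Phi>_def \<phi>z)
  have zY: "z \<in> Y l" for l
  proof -
    have "\<Phi> z \<in> \<Phi> ` D l" using zD by (rule imageI)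
    then show ?thesis using zariski_closure_superset[OF \<Phi>cox[of l]] unfolding Y_def \<Phi>z by blast
  qed
  have irr: "zar_irreducible k (Y l)" for l
    unfolding zar_irreducible_def
  proof (intro conjI allI impI)
    show "zar_closed k (Y l)" unfolding Y_def by (rule zar_closed_closure)
    show "Y l \<noteq> {}" using zY by blast
    fix A B assume AB: "zar_closed k A \<and> zar_closed k B \<and> Y l \<subseteq> A \<union> B"
    show "Y l \<subseteq> A \<or> Y l \<subseteq> B"
    proof (rule ccontr)
      assume neg: "\<not> ?thesis"
      obtain SA SB where A: "A = {z \<in> cox_space k. \<forall>f\<in>SA. mp_eval id f z = 0}"
        and B: "B = {z \<in> cox_space k. \<forall>f\<in>SB. mp_eval id f z = 0}"
        using AB unfolding zar_closed_def by auto
      have "\<not> \<Phi> ` D l \<subseteq> A" "\<not> \<Phi> ` D l \<subseteq> B"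
        using neg AB zariski_closure_minimal unfolding Y_def by blast+
      \<comment> \<open>A graph point outside \<open>A\<close> and one outside \<open>B\<close> are
        joined by a line. The product of an equation of \<open>A\<close> and one of \<open>B\<close>
        vanishes on the part of the graph over it, yet neither factor vanishes identically
        there.\<close>
      then obtain a b where ab: "a \<in> D l" "b \<in> D l" "\<Phi> a \<notin> A" "\<Phi> b \<notin> B" by blast
      then obtain f g where fg: "f \<in> SA" "mp_eval id f (\<Phi> a) \<noteq> 0" "g \<in> SB" "mp_eval id g (\<Phi> b) \<noteq> 0"
        using \<Phi>cox A B by blast
      have abP: "a \<in> polydisc S z \<delta>" "b \<in> polydisc S z \<delta>" using ab by (auto simp: D_def)
      let ?\<Omega> = "{s. cline a b s \<in> polydisc S z \<delta>}"
      have fin: "finite S" by (simp add: S)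
      have hol': "(\<lambda>s. mp_eval id h (\<Phi> (cline a b s))) holomorphic_on ?\<Omega>" for h
      proof (rule holomorphic_on_mp_eval)
        fix j
        show "(\<lambda>s. \<Phi> (cline a b s) j) holomorphic_on ?\<Omega>"
          using hol[OF abP] by (cases "j = i") (auto simp: \<Phi>_def intro: holomorphic_on_cline)
      qed
      have "mp_eval id g (\<Phi> (cline a b 1)) = 0"
      proof (rule holomorphic_product_zero[OF hol'[of f] hol'[of g]])
        show "open ?\<Omega>" by (rule open_cline_polydisc[OF fin abP])
        show "connected ?\<Omega>" by (rule convex_connected[OF convex_cline_polydisc[OF abP]])
        show "0 \<in> ?\<Omega>" "1 \<in> ?\<Omega>" using abP by auto
        show "mp_eval id f (\<Phi> (cline a b 0)) \<noteq> 0" using fg by simp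
        fix s assume s: "s \<in> ?\<Omega>"
        have "cline a b s j = z j" if "j \<notin> e ` {..<l}" for j using ab that by (auto simp: D_def cline_def)
        with s have "cline a b s \<in> D l" by (auto simp: D_def)
        then have "\<Phi> (cline a b s) \<in> Y l" using zariski_closure_superset[OF \<Phi>cox[of l]] by (auto simp: Y_def)
        with AB have "\<Phi> (cline a b s) \<in> A \<union> B" by blast
        then show "mp_eval id f (\<Phi> (cline a b s)) * mp_eval id g (\<Phi> (cline a b s)) = 0"
          using fg A B by auto
      qed
      with fg show False by simp
    qed
  qed
  have strict: "Y l \<subset> Y (Suc l)" if l: "l < k - 1" for l
  proof -
    have "e ` {..<l} \<subseteq> e ` {..<Suc l}" by auto
    then have "D l \<subseteq> D (Suc l)" unfolding D_def by blast
    then have sub: "Y l \<subseteq> Y (Suc l)" unfolding Y_def by (intro zariski_closure_mono image_mono)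
    define j where "j = e l"
    have j: "j \<in> S" "j \<noteq> i" "j < k" using eS[OF l] by (auto simp: j_def S)
    define w where "w = z(j := z j + of_real (\<delta> / 2))"
    have "w \<in> polydisc S z \<delta>" using \<delta> j by (auto simp: polydisc_def w_def dist_norm)
    then have wD: "w \<in> D (Suc l)" by (auto simp: D_def w_def j_def)
    then have wY: "\<Phi> w \<in> Y (Suc l)" using zariski_closure_superset[OF \<Phi>cox[of "Suc l"]] by (auto simp: Y_def)
    \<comment> \<open>The equation \<open>x j = z j\<close> holds on \<open>Y l\<close> and fails at
      the shifted point of \<open>Y (Suc l)\<close>.\<close>
    define f :: "(nat \<Rightarrow>\<^sub>0 nat) \<Rightarrow>\<^sub>0 complex" where "f = single (single j 1) 1 + single 0 (- z j)"
    have f: "mp_eval id f x = x j - z j" for x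
      by (simp add: f_def mp_eval_add mp_eval_single)
    have vf: "vars_below k f" unfolding f_def vars_below_vars_in
      using j by (intro vars_in_add vars_in_single) auto
    have "mp_eval id f (\<Phi> x) = 0" if "x \<in> D l" for x
    proof -
      have "j \<notin> e ` {..<l}" unfolding j_def using einj by (auto simp: inj_def)
      then show ?thesis using that j by (simp add: f D_def \<Phi>_def)
    qed
    then have "mp_eval id f x = 0" if "x \<in> Y l" for x
      using that vf by (auto simp: Y_def zariski_closure_def)
    moreover have "mp_eval id f (\<Phi> w) \<noteq> 0" using \<delta> j by (simp add: f \<Phi>_def w_def)
    ultimately have "\<Phi> w \<notin> Y l" by blast
    with sub wY show ?thesis by blast
  qed
  have "Y (k - 1) \<subseteq> cone_Z k F" unfolding Y_def by (rule zariski_closure_minimal[OF zar_closed_cone_Z[OF F] \<Phi>cone])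
  moreover have "Y 0 \<inter> cox_U k \<Sigma> \<noteq> {}" using zY z by blast
  ultimately have "k - 1 + 2 \<le> k"
    using codim[unfolded codim_ge_2_def, rule_format, of "k - 1" Y] irr strict by blast
  with k show False by simp
qed

text \<open>If there is no such equation, take \<open>g\<close> of least degree in
  \<open>x i\<close> among the nonzero polynomials vanishing on \<open>V\<close>. Minimality makes
  \<open>g\<close> separable at some point of \<open>V\<close>, so its root extends to a function
  \<open>\<phi>\<close> on a polydisc. Pseudo-division by \<open>g\<close> leaves remainder 0 on
  every equation of the cone, so the graph of \<open>\<phi>\<close> lies in the cone, against
  \<open>chain_in_graph\<close>.\<close>

lemma codim_2_equation_exists:
  assumes k: "i < k" and codim: "codim_ge_2 k \<Sigma> F"
    and F: "\<forall>f\<in>F. vars_below k f"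
    and \<Sigma>: "\<Sigma> \<noteq> {}"
  shows "\<exists>c :: (nat \<Rightarrow>\<^sub>0 nat) \<Rightarrow>\<^sub>0 int. c \<noteq> 0 \<and> vars_in ({..<k} - {i}) c \<and>
    (\<forall>z\<in>cone_Z k F \<inter> cox_U k \<Sigma>. mp_eval of_int c z = 0)"
proof (rule ccontr)
  assume neg: "\<not> ?thesis"
  define S where "S = {..<k} - {i}"
  have fin: "finite S" by (simp add: S_def)
  define R where "R = {c :: (nat \<Rightarrow>\<^sub>0 nat) \<Rightarrow>\<^sub>0 int. vars_in S c}"
  have R: "subring_set R" unfolding R_def by (rule subring_vars_in)
  define V where "V = cone_Z k F \<inter> cox_U k \<Sigma>"
  have nz: "c = 0" if "c \<in> R" "\<And>z. z \<in> V \<Longrightarrow> ceval z c = 0" for c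
    using neg that unfolding R_def V_def S_def by blast
  define J where "J = {P. coeffs_in R P \<and> (\<forall>z\<in>V. hom_eval (ceval z) (z i) P = 0)}"
  have "\<forall>f\<in>F. \<exists>P. coeffs_in R P \<and> (\<forall>z::nat \<Rightarrow> complex. hom_eval (ceval z) (z i) P = 0 \<longleftrightarrow> mp_eval of_rat f z = 0)"
  proof
    fix f assume "f \<in> F"
    then have "vars_in {..<k} f" using F by (simp add: vars_below_vars_in)
    then obtain f' :: "(nat \<Rightarrow>\<^sub>0 nat) \<Rightarrow>\<^sub>0 int" where f': "vars_in {..<k} f'"
      "\<And>z::nat \<Rightarrow> complex. mp_eval of_int f' z = 0 \<longleftrightarrow> mp_eval of_rat f z = 0"
      using mp_clear_denominators by blast
    obtain P where "coeffs_in {c. vars_in ({..<k} - {i}) c} P"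
      "\<And>z::nat \<Rightarrow> complex. mp_eval of_int f' z = hom_eval (ceval z) (z i) P"
      using split_variable[OF f'(1), of i] by blast
    with f'(2) show "\<exists>P. coeffs_in R P \<and> (\<forall>z::nat \<Rightarrow> complex. hom_eval (ceval z) (z i) P = 0 \<longleftrightarrow> mp_eval of_rat f z = 0)"
      unfolding R_def S_def by (intro exI[of _ P]) auto
  qed
  then obtain P where P: "\<And>f. f \<in> F \<Longrightarrow> coeffs_in R (P f)"
    "\<And>f z. f \<in> F \<Longrightarrow> hom_eval (ceval z) (z i) (P f) = 0 \<longleftrightarrow> mp_eval of_rat f (z :: nat \<Rightarrow> complex) = 0"
    by metis
  have PJ: "P f \<in> J" if "f \<in> F" for f
    using P[OF that] that by (auto simp: J_def V_def cone_Z_def)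
  show False
  proof (cases "J \<subseteq> {0}")
    case True
    then have "P f = 0" if "f \<in> F" for f using PJ[OF that] by blast
    then have F0: "mp_eval of_rat f z = 0" if "f \<in> F" for f and z :: "nat \<Rightarrow> complex"
      using P(2)[OF that, of z] that by simp
    \<comment> \<open>With all equations zero the cone is the whole space, and the constant function
      1 already has its graph in it.\<close>
    define z :: "nat \<Rightarrow> complex" where "z = (\<lambda>j. if j < k then 1 else 0)"
    have "z \<in> cox_U k \<Sigma>" using \<Sigma> by (auto simp: cox_U_def cox_space_def z_def)
    then have "\<not> codim_ge_2 k \<Sigma> F"
    proof (rule chain_in_graph[where \<phi> = "\<lambda>_. 1", OF k _ zero_less_one S_def _ _ _ F])
      show "(1 :: complex) = z i" using k by (simp add: z_def)
      show "w(i := 1) \<in> cone_Z k F" if "w \<in> polydisc S z 1" for w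
        using that k F0 by (auto simp: cone_Z_def cox_space_def polydisc_def S_def z_def)
    qed auto
    with codim show False by blast
  next
    case False
    define g where "g = arg_min degree (\<lambda>P. P \<in> J \<and> P \<noteq> 0)"
    obtain P0 where "P0 \<in> J \<and> P0 \<noteq> 0" using False by blast
    then have g: "g \<in> J" "g \<noteq> 0" and gmin: "\<And>P. P \<in> J \<Longrightarrow> P \<noteq> 0 \<Longrightarrow> degree g \<le> degree P"
      unfolding g_def using arg_min_natI[of "\<lambda>P. P \<in> J \<and> P \<noteq> 0" P0 degree] arg_min_nat_le[of "\<lambda>P. P \<in> J \<and> P \<noteq> 0" _ degree]
      by blast+
    have gR: "coeffs_in R g" using g by (simp add: J_def)
    define l where "l = lead_coeff g"
    have l: "l \<in> R" "l \<noteq> 0" using gR g(2) by (auto simp: l_def coeffs_in_def)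
    \<comment> \<open>A constant \<open>g\<close> would be an equation without \<open>x i\<close>,
      excluded by \<open>nz\<close>.\<close>
    have deg: "degree g > 0"
    proof (rule ccontr)
      assume "\<not> ?thesis"
      then obtain c where c: "g = [:c:]" by (metis degree_eq_zeroE gr0I)
      have "c = 0"
      proof (rule nz)
        show "c \<in> R" using gR c unfolding coeffs_in_def by (metis coeff_pCons_0)
        show "ceval z c = 0" if "z \<in> V" for z
          using g(1) that c by (simp add: J_def hom_eval_pCons[OF ring_map_ceval])
      qed
      with c g(2) show False by simp
    qed
    \<comment> \<open>Multiplying by the leading coefficient yields one point where both it and the
      derivative are nonzero: the root is simple there, and the factor from pseudo-division can be
      cancelled nearby.\<close>
    define g2 where "g2 = smult l (pderiv g)"
    have "pderiv g \<noteq> 0" using deg by (simp add: pderiv_eq_0_iff)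
    then have "g2 \<noteq> 0" using l by (simp add: g2_def)
    moreover have "degree g2 < degree g"
      using deg l by (simp add: g2_def degree_pderiv)
    ultimately have "g2 \<notin> J" using gmin by (meson not_less)
    moreover have "coeffs_in R g2" unfolding g2_def by (intro coeffs_in_ops(4)[OF R] l coeffs_in_pderiv[OF R] gR)
    ultimately obtain z where z: "z \<in> V" "hom_eval (ceval z) (z i) g2 \<noteq> 0" by (auto simp: J_def)
    then have z2: "ceval z l \<noteq> 0" "hom_eval (ceval z) (z i) (pderiv g) \<noteq> 0"
      by (auto simp: g2_def hom_eval_smult[OF ring_map_ceval])
    have z1: "hom_eval (ceval z) (z i) g = 0" using g z by (simp add: J_def)
    obtain \<delta> \<phi> where \<delta>: "\<delta> > 0" "\<phi> z = z i" "\<And>w. w \<in> polydisc S z \<delta> \<Longrightarrow> hom_eval (ceval w) (\<phi> w) g = 0"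
      "\<And>w. w \<in> polydisc S z \<delta> \<Longrightarrow> ceval w l \<noteq> 0"
      "\<And>a b. a \<in> polydisc S z \<delta> \<Longrightarrow> b \<in> polydisc S z \<delta> \<Longrightarrow> (\<lambda>s. \<phi> (cline a b s)) holomorphic_on {s. cline a b s \<in> polydisc S z \<delta>}"
      using local_root_function[OF fin z1 z2(2) z2(1)] by metis
    have "w(i := \<phi> w) \<in> cone_Z k F" if w: "w \<in> polydisc S z \<delta>" for w
    proof -
      \<comment> \<open>Coefficients over \<open>R\<close> do not see the coordinate
        \<open>i\<close>, so it may be replaced by the root.\<close>
      have upd: "ceval (w(i := y)) c = ceval w c" if "c \<in> R" for c y
        using that by (intro mp_eval_cong[of S]) (auto simp: R_def S_def)
      have hupd: "hom_eval (ceval (w(i := y))) y' p = hom_eval (ceval w) y' p" if "coeffs_in R p" for p y y'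
        unfolding hom_eval_alt[OF ring_map_ceval] using that by (intro sum.cong) (auto simp: coeffs_in_def upd)
      have "z \<in> cox_space k" using z by (auto simp: V_def cone_Z_def)
      then have "w(i := \<phi> w) \<in> cox_space k" using w k by (auto simp: cox_space_def polydisc_def S_def)
      moreover have "mp_eval of_rat f (w(i := \<phi> w)) = 0" if f: "f \<in> F" for f
      proof -
        obtain m q r where qr: "coeffs_in R q" "coeffs_in R r" "smult (lead_coeff g ^ m) (P f) = g * q + r" "r = 0 \<or> degree r < degree g"
          using pseudo_division[OF R gR g(2) P(1)[OF f]] by blast
        \<comment> \<open>The remainder vanishes on \<open>V\<close> and has smaller degree than
          \<open>g\<close>, hence is zero by minimality.\<close>
        have "hom_eval (ceval z) (z i) r = 0" if "z \<in> V" for z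
        proof -
          have "hom_eval (ceval z) (z i) (smult (lead_coeff g ^ m) (P f)) = 0"
            using PJ[OF f] that by (simp add: J_def hom_eval_smult[OF ring_map_ceval])
          moreover have "hom_eval (ceval z) (z i) g = 0" using g that by (simp add: J_def)
          ultimately show ?thesis unfolding qr(3) by (simp add: hom_eval_add[OF ring_map_ceval] hom_eval_mult[OF ring_map_ceval])
        qed
        then have "r \<in> J" using qr(2) by (simp add: J_def)
        then have r: "r = 0" using qr(4) gmin by (meson not_less)
        have "hom_eval (ceval w) (\<phi> w) (smult (lead_coeff g ^ m) (P f)) = 0"
          unfolding qr(3) r using \<delta>(3)[OF w] by (simp add: hom_eval_mult[OF ring_map_ceval])
        then have "hom_eval (ceval w) (\<phi> w) (P f) = 0"
          using \<delta>(4)[OF w] by (simp add: hom_eval_smult[OF ring_map_ceval] ring_map_power[OF ring_map_ceval] l_def)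
        then have "hom_eval (ceval (w(i := \<phi> w))) ((w(i := \<phi> w)) i) (P f) = 0"
          using hupd[OF P(1)[OF f]] by simp
        then show ?thesis using P(2)[OF f] by blast
      qed
      ultimately show ?thesis by (simp add: cone_Z_def)
    qed
    moreover have "z \<in> cox_U k \<Sigma>" using z(1) by (simp add: V_def)
    ultimately have "\<not> codim_ge_2 k \<Sigma> F"
      by (intro chain_in_graph[OF k _ \<delta>(1) S_def \<delta>(2) _ \<delta>(5) F])
    with codim show False by blast
  qed
qed

section \<open>Dyadic boxes and prime sums\<close>

text \<open>On a residue class the quotient \<open>(y - u) div m\<close> is injective, with values
  from 0 to \<open>(l - 1) div m\<close>.\<close>

lemma card_int_interval_residue:
  fixes u m r :: int and l :: nat
  assumes "m > 0"
  shows "real (card {y \<in> {u..<u + int l}. y mod m = r}) \<le> real l / real_of_int m + 1"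
proof (cases "l = 0")
  case False
  let ?A = "{y \<in> {u..<u + int l}. y mod m = r}"
  have inj: "inj_on (\<lambda>y. (y - u) div m) ?A"
  proof (rule inj_onI)
    fix x y assume x: "x \<in> ?A" and y: "y \<in> ?A" and e: "(x - u) div m = (y - u) div m"
    have "(x - u) mod m = (y - u) mod m" using x y by (intro mod_diff_cong) auto
    with e have "x - u = y - u" by (metis mult_div_mod_eq)
    then show "x = y" by simp
  qed
  have sub: "(\<lambda>y. (y - u) div m) ` ?A \<subseteq> {0..(int l - 1) div m}"
    using assms by (auto intro!: zdiv_mono1 simp: pos_imp_zdiv_nonneg_iff)
  have "card ?A \<le> card {0..(int l - 1) div m}"
    by (rule card_inj_on_le[OF inj sub]) auto
  also have "\<dots> = nat ((int l - 1) div m + 1)" by simp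
  finally have "real (card ?A) \<le> real (nat ((int l - 1) div m + 1))" by simp
  also have "\<dots> = real_of_int ((int l - 1) div m) + 1"
  proof -
    have "(int l - 1) div m \<ge> 0" using assms False by (simp add: pos_imp_zdiv_nonneg_iff)
    then show ?thesis by simp
  qed
  also have "real_of_int ((int l - 1) div m) \<le> real_of_int (int l - 1) / real_of_int m"
    by (metis of_int_floor_le floor_divide_of_int_eq)
  also have "\<dots> \<le> real l / real_of_int m" using assms by (intro divide_right_mono) auto
  finally show ?thesis by simp
qed auto

definition dyadic :: "nat \<Rightarrow> int set" where
  "dyadic a = {y. 2 ^ a \<le> \<bar>y\<bar> \<and> \<bar>y\<bar> < 2 ^ (a + 1)}"

text \<open>Two runs of \<open>2 ^ a\<close> integers. The negative one is shifted by 1 because the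
  bound \<open>2 ^ (a + 1)\<close> on the absolute value is strict.\<close>

lemma dyadic_eq: "dyadic a = {2 ^ a..<2 ^ a + int (2 ^ a)} \<union> {- (2 ^ (a + 1)) + 1..<- (2 ^ (a + 1)) + 1 + int (2 ^ a)}"
  by (auto simp: dyadic_def)

lemma finite_dyadic [simp]: "finite (dyadic a)"
  by (simp add: dyadic_eq)

lemma card_dyadic_le: "card (dyadic a) \<le> 2 * 2 ^ a"
  unfolding dyadic_eq by (rule order.trans[OF card_Un_le]) (simp add: nat_power_eq)

lemma card_dyadic_residue:
  assumes "m > 0"
  shows "real (card {y \<in> dyadic a. y mod m = r}) \<le> 2 * (2 ^ a / real_of_int m + 1)"
proof -
  have "{y \<in> dyadic a. y mod m = r} = {y \<in> {2 ^ a..<2 ^ a + int (2 ^ a)}. y mod m = r} \<union>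
     {y \<in> {- (2 ^ (a + 1)) + 1..<- (2 ^ (a + 1)) + 1 + int (2 ^ a)}. y mod m = r}"
    (is "_ = ?A \<union> ?B") unfolding dyadic_eq by blast
  then have "real (card {y \<in> dyadic a. y mod m = r}) \<le> real (card ?A) + real (card ?B)"
    using card_Un_le[of ?A ?B] by simp
  also have "\<dots> \<le> (real (2 ^ a) / real_of_int m + 1) + (real (2 ^ a) / real_of_int m + 1)"
    by (intro add_mono card_int_interval_residue assms)
  finally show ?thesis by simp
qed

text \<open>Lagrange's bound over the field of \<open>p\<close> elements, argued with integers:
  after splitting off a root \<open>s\<close>, not all coefficients of the quotient are divisible by
  \<open>p\<close>, since otherwise all those of \<open>q\<close> would be.\<close>

lemma card_roots_mod_prime:
  fixes q :: "int poly" and p :: nat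
  assumes "prime p" and "\<not> int p dvd coeff q i"
  shows "card {r \<in> {0..<int p}. int p dvd poly q r} \<le> degree q"
  using assms(2)
proof (induction "degree q" arbitrary: q i)
  case 0
  then obtain c where "q = [:c:]" by (metis degree_eq_zeroE)
  with 0 have "\<not> int p dvd c" by (cases i) auto
  with \<open>q = [:c:]\<close> show ?case by simp
next
  case (Suc d)
  show ?case
  proof (cases "\<exists>s\<in>{0..<int p}. int p dvd poly q s")
    case False
    then have "{r \<in> {0..<int p}. int p dvd poly q r} = {}" by blast
    then show ?thesis by (metis card.empty le0)
  next
    case True
    then obtain s where s: "s \<in> {0..<int p}" "int p dvd poly q s" by blast
    define h where "h = synthetic_div q s"
    have q: "[:-s, 1:] * h + [:poly q s:] = q"
      unfolding h_def by (rule synthetic_div_correct')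
    have dh: "d = degree h" unfolding h_def using Suc.hyps(2) by (simp add: degree_synthetic_div)
    have "\<exists>i. \<not> int p dvd coeff h i"
    proof (rule ccontr)
      assume "\<not> ?thesis"
      then have h: "\<And>i. int p dvd coeff h i" by blast
      have "int p dvd coeff ([:-s, 1:] * h + [:poly q s:]) i"
        using s(2) h by (cases i) (auto simp: coeff_pCons)
      with Suc.prems show False unfolding q by blast
    qed
    then obtain i' where i': "\<not> int p dvd coeff h i'" by blast
    have IH: "card {r \<in> {0..<int p}. int p dvd poly h r} \<le> d"
      using Suc.hyps(1)[OF dh i'] dh by simp
    have "{r \<in> {0..<int p}. int p dvd poly q r} \<subseteq> insert s {r \<in> {0..<int p}. int p dvd poly h r}"
    proof
      fix r assume r: "r \<in> {r \<in> {0..<int p}. int p dvd poly q r}"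
      have "poly q r = (r - s) * poly h r + poly q s" by (subst q[symmetric]) (simp add: left_diff_distrib)
      with r s(2) have "int p dvd (r - s) * poly h r" by (metis (no_types, lifting) dvd_add_left_iff mem_Collect_eq)
      then have "int p dvd r - s \<or> int p dvd poly h r"
        using assms(1) by (simp add: prime_dvd_mult_iff)
      moreover have "r = s" if "int p dvd r - s"
      proof (rule ccontr)
        assume "r \<noteq> s"
        with that have "int p \<le> \<bar>r - s\<bar>" by (intro zdvd_imp_le) auto
        with r s(1) show False by auto
      qed
      ultimately show "r \<in> insert s {r \<in> {0..<int p}. int p dvd poly h r}" using r by blast
    qed
    moreover have "finite {r \<in> {0..<int p}. int p dvd poly h r}"
      by (rule finite_subset[of _ "{0..<int p}"]) auto
    ultimately have "card {r \<in> {0..<int p}. int p dvd poly q r} \<le> card (insert s {r \<in> {0..<int p}. int p dvd poly h r})"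
      by (intro card_mono) auto
    also have "\<dots> \<le> Suc d" using IH by (intro order.trans[OF card_insert_le_m1]) (auto simp: card_insert_if)
    finally show ?thesis using Suc.hyps(2) by simp
  qed
qed

text \<open>Up to \<open>D\<close> classes modulo \<open>p\<close>, each met by both halves of
  \<open>dyadic a\<close>. For \<open>p > 2 ^ a\<close> the summand 1 dominates and larger primes
  give no further saving; this is what makes large primes delicate.\<close>

lemma card_dyadic_roots:
  fixes q :: "int poly" and p :: nat
  assumes "prime p" and "\<not> int p dvd coeff q i" and "degree q \<le> D"
  shows "real (card {y \<in> dyadic a. int p dvd poly q y}) \<le> real D * (2 * (2 ^ a / real p + 1))"
proof -
  have p0: "p > 0" using assms(1) prime_gt_0_nat by blast
  let ?R = "{r \<in> {0..<int p}. int p dvd poly q r}"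
  have finR: "finite ?R" by (rule finite_subset[of _ "{0..<int p}"]) auto
  have "{y \<in> dyadic a. int p dvd poly q y} \<subseteq> (\<Union>r\<in>?R. {y \<in> dyadic a. y mod int p = r})"
  proof
    fix y assume y: "y \<in> {y \<in> dyadic a. int p dvd poly q y}"
    have "y - y mod int p = int p * (y div int p)" by (simp add: minus_mod_eq_mult_div)
    then have "int p dvd y - y mod int p" by simp
    moreover have "y - y mod int p dvd poly q y - poly q (y mod int p)"
    proof -
      have "poly q y = poly ([:- (y mod int p), 1:] * synthetic_div q (y mod int p) + [:poly q (y mod int p):]) y"
        by (simp only: synthetic_div_correct')
      then have "poly q y - poly q (y mod int p) = (y - y mod int p) * poly (synthetic_div q (y mod int p)) y"
        by (simp add: left_diff_distrib)
      then show ?thesis by simp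
    qed
    ultimately have "int p dvd poly q y - poly q (y mod int p)" by (rule dvd_trans)
    with y have "int p dvd poly q (y mod int p)" by (simp add: dvd_diff_right_iff)
    with y p0 show "y \<in> (\<Union>r\<in>?R. {y \<in> dyadic a. y mod int p = r})" by auto
  qed
  then have "card {y \<in> dyadic a. int p dvd poly q y} \<le> card (\<Union>r\<in>?R. {y \<in> dyadic a. y mod int p = r})"
    using finR by (intro card_mono) auto
  also have "\<dots> \<le> (\<Sum>r\<in>?R. card {y \<in> dyadic a. y mod int p = r})"
    by (rule card_UN_le[OF finR])
  finally have "real (card {y \<in> dyadic a. int p dvd poly q y}) \<le> (\<Sum>r\<in>?R. real (card {y \<in> dyadic a. y mod int p = r}))"
    unfolding of_nat_sum[symmetric] of_nat_le_iff .
  also have "\<dots> \<le> (\<Sum>r\<in>?R. 2 * (2 ^ a / real_of_int (int p) + 1))"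
    using p0 by (intro sum_mono card_dyadic_residue) auto
  also have "\<dots> = real (card ?R) * (2 * (2 ^ a / real p + 1))" by simp
  also have "\<dots> \<le> real D * (2 * (2 ^ a / real p + 1))"
    using card_roots_mod_prime[OF assms(1,2)] assms(3) by (intro mult_right_mono) auto
  finally show ?thesis .
qed

section \<open>Chebyshev bounds and sums over primes\<close>

lemma prod_dvd_of_coprime:
  fixes m :: nat
  assumes "finite A" and "\<And>p. p \<in> A \<Longrightarrow> p dvd m"
    and "\<And>p q. p \<in> A \<Longrightarrow> q \<in> A \<Longrightarrow> p \<noteq> q \<Longrightarrow> coprime p q"
  shows "\<Prod>A dvd m"
  using assms
proof (induction A rule: finite_induct)
  case (insert p A)
  have "coprime p (\<Prod>A)"
    using insert.hyps insert.prems(2) by (intro prod_coprime_right) (auto intro: insert.prems(2))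
  then show ?case using insert by (simp add: divides_mult)
qed simp

text \<open>With \<open>n = 2 ^ a\<close>, the primes between \<open>n\<close> and
  \<open>2 * n\<close> all divide the central binomial coefficient, which is at most
  \<open>2 ^ (2 * n)\<close>, while each of them exceeds \<open>2 ^ a\<close>.\<close>

lemma card_primes_dyadic:
  assumes "a \<ge> 1"
  shows "real (card {p::nat. prime p \<and> 2 ^ a < p \<and> p \<le> 2 ^ (a + 1)}) \<le> 2 * 2 ^ a / real a"
proof -
  define n :: nat where "n = 2 ^ a"
  let ?A = "{p::nat. prime p \<and> 2 ^ a < p \<and> p \<le> 2 ^ (a + 1)}"
  have fin: "finite ?A" by (rule finite_subset[of _ "{..2 ^ (a + 1)}"]) auto
  have "\<Prod>?A dvd ((2 * n) choose n)"
  proof (rule prod_dvd_of_coprime[OF fin])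
    fix p assume p: "p \<in> ?A"
    have pp: "prime p" "n < p" "p \<le> 2 * n" using p by (auto simp: n_def)
    have "p dvd fact (2 * n)" using pp by (simp add: prime_dvd_fact_iff)
    moreover have "(fact n * fact n * ((2 * n) choose n) :: nat) = fact (2 * n)"
      using binomial_fact_lemma[of n "2 * n"] by simp
    ultimately have d: "p dvd fact n * fact n * ((2 * n) choose n)" by metis
    have "\<not> p dvd fact n" using pp by (simp add: prime_dvd_fact_iff)
    with d pp(1) show "p dvd ((2 * n) choose n)" by (simp add: prime_dvd_mult_iff)
  next
    fix p q assume "p \<in> ?A" "q \<in> ?A" "p \<noteq> q"
    then show "coprime p q" by (simp add: primes_coprime)
  qed
  then have "\<Prod>?A \<le> ((2 * n) choose n)" by (intro dvd_imp_le) auto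
  also have "\<dots> \<le> 2 ^ (2 * n)" by (rule binomial_le_pow2)
  finally have "\<Prod>?A \<le> 2 ^ (2 * n)" .
  moreover have "(\<Prod>p\<in>?A. 2 ^ a) \<le> \<Prod>?A" by (rule prod_mono) (simp add: less_imp_le)
  moreover have "(\<Prod>p\<in>?A. 2 ^ a) = (2::nat) ^ (a * card ?A)" by (simp only: prod_constant power_mult)
  ultimately have "(2::nat) ^ (a * card ?A) \<le> 2 ^ (2 * n)" by linarith
  then have "a * card ?A \<le> 2 * n" by (rule power_le_imp_le_exp[rotated]) simp
  then have "real (a * card ?A) \<le> real (2 * n)" by (simp only: of_nat_le_iff)
  then have "real a * real (card ?A) \<le> 2 * 2 ^ a" by (simp add: n_def)
  then show ?thesis using assms by (simp add: field_simps)
qed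

text \<open>An upper bound of Mertens type. The dyadic block at \<open>A\<close> contributes at most
  \<open>2 / A\<close>, which is dominated by the increment of
  \<open>6 * ln (1 + A)\<close>.\<close>

lemma sum_inverse_primes_le:
  "(\<Sum>p | prime p \<and> p \<le> 2 ^ A. 1 / real p) \<le> 6 * (1 + ln (1 + real A))"
proof (induction A)
  case 0
  have "{p::nat. prime p \<and> p \<le> 2 ^ 0} = {}" by (auto dest: prime_ge_2_nat)
  then show ?case by (simp only: sum.empty) simp
next
  case (Suc A)
  show ?case
  proof (cases "A = 0")
    case True
    have "{p::nat. prime p \<and> p \<le> 2 ^ Suc A} \<subseteq> {2}" using True by (auto dest: prime_ge_2_nat)
    then have "(\<Sum>p | prime p \<and> p \<le> 2 ^ Suc A. 1 / real p) \<le> (\<Sum>p\<in>{2}. 1 / real p)"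
      by (intro sum_mono2) auto
    also have "\<dots> \<le> 6 * (1 + ln (1 + real (Suc A)))" using True by simp
    finally show ?thesis .
  next
    case False
    let ?D = "{p::nat. prime p \<and> 2 ^ A < p \<and> p \<le> 2 ^ (A + 1)}"
    let ?E = "{p::nat. prime p \<and> p \<le> 2 ^ A}"
    have fin: "finite ?D" "finite ?E"
      by (rule finite_subset[of _ "{..2 ^ (A + 1)}"], auto)+
    have "(\<Sum>p\<in>?D. 1 / real p) \<le> (\<Sum>p\<in>?D. 1 / 2 ^ A)"
    proof (rule sum_mono)
      fix p assume "p \<in> ?D"
      then have "real (2 ^ A) \<le> real p" by (simp only: of_nat_le_iff) simp
      then show "1 / real p \<le> 1 / 2 ^ A" by (intro frac_le) auto
    qed
    also have "\<dots> = real (card ?D) / 2 ^ A" by simp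
    also have "\<dots> \<le> (2 * 2 ^ A / real A) / 2 ^ A"
      using card_primes_dyadic[of A] False by (intro divide_right_mono) auto
    \<comment> \<open>This fixes the constant 6: equality holds at \<open>A = 1\<close>.\<close>
    also have "\<dots> \<le> 6 / (real A + 2)" using False by (simp add: field_simps)
    also have "1 / (real A + 2) \<le> ln ((real A + 2) / (real A + 1))"
    proof -
      have "ln ((real A + 1) / (real A + 2)) \<le> (real A + 1) / (real A + 2) - 1"
        by (rule ln_le_minus_one) auto
      moreover have "ln ((real A + 1) / (real A + 2)) = - ln ((real A + 2) / (real A + 1))"
        by (simp add: ln_div)
      ultimately show ?thesis by (simp add: field_simps)
    qed
    then have "6 / (real A + 2) \<le> 6 * ln (2 + real A) - 6 * ln (1 + real A)"
      by (simp add: ln_div add.commute)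
    finally have D: "(\<Sum>p\<in>?D. 1 / real p) \<le> 6 * ln (2 + real A) - 6 * ln (1 + real A)" .
    have "{p::nat. prime p \<and> p \<le> 2 ^ Suc A} = ?E \<union> ?D"
    proof -
      have "p \<le> 2 ^ Suc A" if "p \<le> 2 ^ A" for p :: nat
        using that by (rule order.trans) simp
      then show ?thesis by auto
    qed
    then have "(\<Sum>p | prime p \<and> p \<le> 2 ^ Suc A. 1 / real p) = (\<Sum>p\<in>?E. 1 / real p) + (\<Sum>p\<in>?D. 1 / real p)"
      using fin by (simp only:) (rule sum.union_disjoint, auto)
    with D Suc.IH show ?thesis by simp
  qed
qed

text \<open>The block at \<open>M\<close> contributes at most \<open>2 / (M * 2 ^ M)\<close>;
  replacing \<open>M\<close> by \<open>b\<close> in the first factor makes the bound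
  telescope.\<close>

lemma sum_inverse_square_primes_aux:
  assumes "b \<ge> 1" "b \<le> M"
  shows "(\<Sum>p | prime p \<and> 2 ^ b < p \<and> p \<le> 2 ^ M. 1 / real p ^ 2) \<le> 4 / real b * (1 / 2 ^ b - 1 / 2 ^ M)"
  using assms(2)
proof (induction M rule: dec_induct)
  case base
  have "{p::nat. prime p \<and> 2 ^ b < p \<and> p \<le> 2 ^ b} = {}" by auto
  then show ?case by (simp only: sum.empty) simp
next
  case (step M)
  let ?D = "{p::nat. prime p \<and> 2 ^ M < p \<and> p \<le> 2 ^ (M + 1)}"
  let ?E = "{p::nat. prime p \<and> 2 ^ b < p \<and> p \<le> 2 ^ M}"
  have fin: "finite ?D" "finite ?E"
    by (rule finite_subset[of _ "{..2 ^ (M + 1)}"], auto)+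
  have "(\<Sum>p\<in>?D. 1 / real p ^ 2) \<le> (\<Sum>p\<in>?D. 1 / (2 ^ M) ^ 2)"
  proof (rule sum_mono)
    fix p assume "p \<in> ?D"
    then have "real (2 ^ M) \<le> real p" by (simp only: of_nat_le_iff) simp
    then show "1 / real p ^ 2 \<le> 1 / (2 ^ M) ^ 2" by (intro frac_le power_mono) auto
  qed
  also have "\<dots> = real (card ?D) / (2 ^ M) ^ 2" by simp
  also have "\<dots> \<le> (2 * 2 ^ M / real M) / (2 ^ M) ^ 2"
    using card_primes_dyadic[of M] assms step by (intro divide_right_mono) auto
  also have "\<dots> = 2 / (real M * 2 ^ M)" by (simp add: power2_eq_square)
  also have "\<dots> \<le> 2 / (real b * 2 ^ M)"
    using assms step by (intro divide_left_mono mult_right_mono) auto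
  also have "\<dots> = 4 / real b * (1 / 2 ^ M - 1 / 2 ^ Suc M)" using assms by (simp add: field_simps)
  finally have D: "(\<Sum>p\<in>?D. 1 / real p ^ 2) \<le> 4 / real b * (1 / 2 ^ M - 1 / 2 ^ Suc M)" .
  have "{p::nat. prime p \<and> 2 ^ b < p \<and> p \<le> 2 ^ Suc M} = ?E \<union> ?D"
  proof -
    have "p \<le> 2 ^ Suc M" if "p \<le> 2 ^ M" for p :: nat
      using that by (rule order.trans) simp
    moreover have "2 ^ b < p" if "2 ^ M < p" for p :: nat
      using order.strict_trans1[OF power_increasing[OF step(1), of "2::nat"] that] by simp
    ultimately show ?thesis by auto
  qed
  then have "(\<Sum>p | prime p \<and> 2 ^ b < p \<and> p \<le> 2 ^ Suc M. 1 / real p ^ 2) = (\<Sum>p\<in>?E. 1 / real p ^ 2) + (\<Sum>p\<in>?D. 1 / real p ^ 2)"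
    using fin by (simp only:) (rule sum.union_disjoint, auto)
  also have "\<dots> \<le> 4 / real b * (1 / 2 ^ b - 1 / 2 ^ M) + 4 / real b * (1 / 2 ^ M - 1 / 2 ^ Suc M)"
    using D step.IH by (rule add_mono[rotated])
  also have "\<dots> = 4 / real b * (1 / 2 ^ b - 1 / 2 ^ Suc M)" by (simp add: right_diff_distrib)
  finally show ?case .
qed

text \<open>With \<open>2 ^ b < N \<le> 2 ^ (b + 1)\<close> the bound \<open>4 / (b * 2 ^ b)\<close>
  costs a factor 2 in replacing \<open>2 ^ b\<close> by \<open>N\<close> and another 2 in
  \<open>ln N \<le> 2 * b\<close>, whence 16. The assumption \<open>N > 2\<close> ensures
  \<open>b \<ge> 1\<close>.\<close>

lemma sum_inverse_square_primes_le:
  fixes N :: real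
  assumes "N > 2"
  shows "(\<Sum>p | prime p \<and> N \<le> real p \<and> p \<le> 2 ^ M. 1 / real p ^ 2) \<le> 16 / (N * ln N)"
proof -
  define K where "K = nat \<lceil>N\<rceil>"
  have K: "2 < K" "real K \<ge> N" "real K < N + 1" using assms unfolding K_def by linarith+
  obtain b where b: "2 ^ b < K" "K \<le> 2 ^ (b + 1)" using ex_power_ivl2[of 2 K] K by auto
  have b1: "b \<ge> 1"
  proof (rule ccontr)
    assume "\<not> b \<ge> 1" then have "b = 0" by simp
    with b K show False by simp
  qed
  have bN: "(2::real) ^ b < N"
  proof -
    have "2 ^ b + 1 \<le> K" using b by simp
    then have "real (2 ^ b + 1) \<le> real K" by (simp only: of_nat_le_iff)
    with K show ?thesis by simp
  qed
  have Nb: "N \<le> 2 * 2 ^ b"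
  proof -
    have "real K \<le> real (2 ^ (b + 1))" using b by (simp only: of_nat_le_iff)
    with K show ?thesis by simp
  qed
  have lnN: "ln N \<le> 2 * real b"
  proof -
    have "ln N \<le> ln (2 ^ (b + 1))" using Nb assms by (intro ln_mono) auto
    also have "\<dots> = real (b + 1) * ln 2" by (rule ln_realpow)
    also have "\<dots> \<le> real (b + 1) * 1" using ln_2_less_1 by (intro mult_left_mono) auto
    also have "\<dots> \<le> 2 * real b" using b1 by simp
    finally show ?thesis .
  qed
  have lnpos: "ln N > 0" using assms by simp
  \<comment> \<open>Covers the case in which the upper limit lies below
    \<open>2 ^ b\<close>.\<close>
  let ?M = "max b M"
  have "(\<Sum>p | prime p \<and> N \<le> real p \<and> p \<le> 2 ^ M. 1 / real p ^ 2) \<le> (\<Sum>p | prime p \<and> 2 ^ b < p \<and> p \<le> 2 ^ ?M. 1 / real p ^ 2)"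
  proof (rule sum_mono2)
    show "finite {p::nat. prime p \<and> 2 ^ b < p \<and> p \<le> 2 ^ ?M}" by (rule finite_subset[of _ "{..2 ^ ?M}"]) auto
    have "2 ^ b < p \<and> p \<le> 2 ^ ?M" if "N \<le> real p" "p \<le> 2 ^ M" for p
    proof
      have "(2::real) ^ b < real p" using that(1) bN by linarith
      then show "2 ^ b < p" by simp
      have "(2::nat) ^ M \<le> 2 ^ ?M" by (rule power_increasing) auto
      with that(2) show "p \<le> 2 ^ ?M" by (rule order.trans)
    qed
    then show "{p. prime p \<and> N \<le> real p \<and> p \<le> 2 ^ M} \<subseteq> {p. prime p \<and> 2 ^ b < p \<and> p \<le> 2 ^ ?M}" by auto
  qed auto
  also have "\<dots> \<le> 4 / real b * (1 / 2 ^ b - 1 / 2 ^ ?M)"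
    using b1 by (intro sum_inverse_square_primes_aux) auto
  also have "\<dots> \<le> 4 / real b * (1 / 2 ^ b)" by (intro mult_left_mono) auto
  also have "\<dots> = 16 / ((2 * 2 ^ b) * (2 * real b))" by simp
  also have "\<dots> \<le> 16 / (N * ln N)"
    using Nb lnN lnpos assms b1 by (intro divide_left_mono mult_mono) auto
  finally show ?thesis .
qed

section \<open>Integral polynomial functions\<close>

text \<open>From here on polynomials are functions on integer points. Coefficients with respect to
  one variable are again such functions of the other variables, and being nonzero means having a
  point with nonzero value, so the induction never returns to formal polynomials.\<close>

inductive_set polyfun :: "nat set \<Rightarrow> ((nat \<Rightarrow> int) \<Rightarrow> int) set" for S where
  const: "(\<lambda>x. c) \<in> polyfun S"
| var: "i \<in> S \<Longrightarrow> (\<lambda>x. x i) \<in> polyfun S"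
| add: "f \<in> polyfun S \<Longrightarrow> g \<in> polyfun S \<Longrightarrow> (\<lambda>x. f x + g x) \<in> polyfun S"
| mult: "f \<in> polyfun S \<Longrightarrow> g \<in> polyfun S \<Longrightarrow> (\<lambda>x. f x * g x) \<in> polyfun S"

lemma polyfun_sum:
  "finite A \<Longrightarrow> (\<And>a. a \<in> A \<Longrightarrow> f a \<in> polyfun S) \<Longrightarrow> (\<lambda>x. \<Sum>a\<in>A. f a x) \<in> polyfun S"
  by (induction A rule: finite_induct) (auto intro: polyfun.intros)

lemma polyfun_power: "f \<in> polyfun S \<Longrightarrow> (\<lambda>x. f x ^ n) \<in> polyfun S"
  by (induction n) (auto intro: polyfun.intros)

lemma polyfun_prod:
  "finite A \<Longrightarrow> (\<And>a. a \<in> A \<Longrightarrow> f a \<in> polyfun S) \<Longrightarrow> (\<lambda>x. \<Prod>a\<in>A. f a x) \<in> polyfun S"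
  by (induction A rule: finite_induct) (auto intro: polyfun.intros)

lemma polyfun_cong:
  assumes "f \<in> polyfun S" "\<And>i. i \<in> S \<Longrightarrow> x i = y i"
  shows "f x = f y"
  using assms(1) by induction (auto simp: assms(2))

lemma polyfun_empty:
  assumes "f \<in> polyfun {}"
  obtains c where "f = (\<lambda>x. c)"
proof
  show "f = (\<lambda>x. f (\<lambda>_. 0))" using polyfun_cong[OF assms] by auto
qed

text \<open>The degree bound \<open>D\<close> is uniform in \<open>x\<close>; it later bounds the
  number of root classes in every fibre.\<close>

lemma polyfun_slice:
  assumes "f \<in> polyfun S"
  shows "\<exists>Q D. (\<forall>x. degree (Q x) \<le> D \<and> f x = poly (Q x) (x j)) \<and>
     (\<forall>a. (\<lambda>x. coeff (Q x) a) \<in> polyfun (S - {j}))"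
  using assms
proof induction
  case (const c)
  have "(\<lambda>x. coeff [:c:] a) \<in> polyfun (S - {j})" for a by (rule polyfun.const)
  then show ?case by (intro exI[of _ "\<lambda>x. [:c:]"] exI[of _ 0]) auto
next
  case (var i)
  show ?case
  proof (cases "i = j")
    case True
    have "(\<lambda>x. coeff [:0, 1:] a) \<in> polyfun (S - {j})" for a by (rule polyfun.const)
    then show ?thesis using True by (intro exI[of _ "\<lambda>x. [:0, 1:]"] exI[of _ 1]) auto
  next
    case False
    have "(\<lambda>x. coeff [:x i:] a) \<in> polyfun (S - {j})" for a
      using var False by (cases a) (auto intro: polyfun.intros)
    then show ?thesis by (intro exI[of _ "\<lambda>x. [:x i:]"] exI[of _ 0]) auto
  qed
next
  case (add f g)
  then obtain Q D Q' D' where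
    Q: "\<And>x. degree (Q x) \<le> D" "\<And>x. f x = poly (Q x) (x j)" "\<And>a. (\<lambda>x. coeff (Q x) a) \<in> polyfun (S - {j})" and
    Q': "\<And>x. degree (Q' x) \<le> D'" "\<And>x. g x = poly (Q' x) (x j)" "\<And>a. (\<lambda>x. coeff (Q' x) a) \<in> polyfun (S - {j})"
    by blast
  have "degree (Q x + Q' x) \<le> max D D'" for x
    using Q(1)[of x] Q'(1)[of x] degree_add_le_max[of "Q x" "Q' x"] by linarith
  then show ?case using Q Q'
    by (intro exI[of _ "\<lambda>x. Q x + Q' x"] exI[of _ "max D D'"]) (auto intro: polyfun.intros)
next
  case (mult f g)
  then obtain Q D Q' D' where
    Q: "\<And>x. degree (Q x) \<le> D" "\<And>x. f x = poly (Q x) (x j)" "\<And>a. (\<lambda>x. coeff (Q x) a) \<in> polyfun (S - {j})" and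
    Q': "\<And>x. degree (Q' x) \<le> D'" "\<And>x. g x = poly (Q' x) (x j)" "\<And>a. (\<lambda>x. coeff (Q' x) a) \<in> polyfun (S - {j})"
    by blast
  have "degree (Q x * Q' x) \<le> D + D'" for x
    using Q(1)[of x] Q'(1)[of x] degree_mult_le[of "Q x" "Q' x"] by linarith
  moreover have "(\<lambda>x. coeff (Q x * Q' x) a) \<in> polyfun (S - {j})" for a
    unfolding coeff_mult by (intro polyfun_sum) (auto intro: polyfun.mult Q Q')
  ultimately show ?case using Q Q'
    by (intro exI[of _ "\<lambda>x. Q x * Q' x"] exI[of _ "D + D'"]) auto
qed

text \<open>Polynomial growth limits the number of large prime factors of a nonzero value.\<close>

lemma polyfun_bound:
  assumes "f \<in> polyfun S"
  shows "\<exists>C E::nat. \<forall>x. \<forall>M::nat. M \<ge> 1 \<longrightarrow> (\<forall>i\<in>S. \<bar>x i\<bar> \<le> int M) \<longrightarrow> \<bar>f x\<bar> \<le> int (C * M ^ E)"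
  using assms
proof induction
  case (const c)
  show ?case by (rule exI[of _ "nat \<bar>c\<bar>"], rule exI[of _ 0]) auto
next
  case (var i)
  then show ?case by (intro exI[of _ 1]) auto
next
  case (add f g)
  then obtain C E C' E' where
    f: "\<And>x (M::nat). M \<ge> 1 \<Longrightarrow> (\<forall>i\<in>S. \<bar>x i\<bar> \<le> int M) \<Longrightarrow> \<bar>f x\<bar> \<le> int (C * M ^ E)" and
    g: "\<And>x (M::nat). M \<ge> 1 \<Longrightarrow> (\<forall>i\<in>S. \<bar>x i\<bar> \<le> int M) \<Longrightarrow> \<bar>g x\<bar> \<le> int (C' * M ^ E')"
    by blast
  show ?case
  proof (intro exI allI impI)
    fix x and M :: nat assume M: "M \<ge> 1" and x: "\<forall>i\<in>S. \<bar>x i\<bar> \<le> int M"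
    have "C * M ^ E + C' * M ^ E' \<le> C * M ^ (E + E') + C' * M ^ (E + E')"
      using M by (intro add_mono mult_left_mono power_increasing) auto
    then have "int (C * M ^ E) + int (C' * M ^ E') \<le> int ((C + C') * M ^ (E + E'))"
      unfolding of_nat_add[symmetric] of_nat_le_iff by (simp add: distrib_right)
    with f[OF M x] g[OF M x] show "\<bar>f x + g x\<bar> \<le> int ((C + C') * M ^ (E + E'))" by linarith
  qed
next
  case (mult f g)
  then obtain C E C' E' where
    f: "\<And>x (M::nat). M \<ge> 1 \<Longrightarrow> (\<forall>i\<in>S. \<bar>x i\<bar> \<le> int M) \<Longrightarrow> \<bar>f x\<bar> \<le> int (C * M ^ E)" and
    g: "\<And>x (M::nat). M \<ge> 1 \<Longrightarrow> (\<forall>i\<in>S. \<bar>x i\<bar> \<le> int M) \<Longrightarrow> \<bar>g x\<bar> \<le> int (C' * M ^ E')"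
    by blast
  show ?case
  proof (intro exI allI impI)
    fix x and M :: nat assume M: "M \<ge> 1" and x: "\<forall>i\<in>S. \<bar>x i\<bar> \<le> int M"
    have "\<bar>f x * g x\<bar> \<le> int (C * M ^ E) * int (C' * M ^ E')"
      unfolding abs_mult by (intro mult_mono f[OF M x] g[OF M x]) auto
    also have "\<dots> = int ((C * C') * M ^ (E + E'))" by (simp add: power_add)
    finally show "\<bar>f x * g x\<bar> \<le> int ((C * C') * M ^ (E + E'))" .
  qed
qed

section \<open>The sieve in dyadic boxes\<close>

definition dyadic_box :: "nat set \<Rightarrow> (nat \<Rightarrow> nat) \<Rightarrow> (nat \<Rightarrow> int) set" where
  "dyadic_box S \<alpha> = PiE S (\<lambda>s. dyadic (\<alpha> s))"

definition vol :: "nat set \<Rightarrow> (nat \<Rightarrow> nat) \<Rightarrow> real" where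
  "vol S \<alpha> = (\<Prod>s\<in>S. 2 ^ \<alpha> s)"

text \<open>\<open>vol S \<alpha> * recip S \<alpha>\<close> adds up the volume divided by each
  side, the order of the number of box points on a hypersurface.\<close>

definition recip :: "nat set \<Rightarrow> (nat \<Rightarrow> nat) \<Rightarrow> real" where
  "recip S \<alpha> = (\<Sum>s\<in>S. 1 / 2 ^ \<alpha> s)"

lemma vol_pos [simp]: "vol S \<alpha> > 0"
  by (simp add: vol_def prod_pos)

lemma vol_nonneg [simp]: "vol S \<alpha> \<ge> 0"
  by (simp add: less_imp_le)

lemma recip_nonneg [simp]: "recip S \<alpha> \<ge> 0"
  by (simp add: recip_def sum_nonneg)

lemma vol_insert: "finite S \<Longrightarrow> j \<notin> S \<Longrightarrow> vol (insert j S) \<alpha> = vol S \<alpha> * 2 ^ \<alpha> j"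
  by (simp add: vol_def)

lemma recip_insert: "finite S \<Longrightarrow> j \<notin> S \<Longrightarrow> recip (insert j S) \<alpha> = recip S \<alpha> + 1 / 2 ^ \<alpha> j"
  by (simp add: recip_def)

lemma finite_dyadic_box [simp]: "finite S \<Longrightarrow> finite (dyadic_box S \<alpha>)"
  by (simp add: dyadic_box_def finite_PiE)

lemma card_dyadic_box_le:
  assumes "finite S"
  shows "real (card (dyadic_box S \<alpha>)) \<le> 2 ^ card S * vol S \<alpha>"
proof -
  have "card (dyadic_box S \<alpha>) \<le> (\<Prod>s\<in>S. 2 * 2 ^ \<alpha> s)"
    unfolding dyadic_box_def card_PiE[OF assms]
    by (intro prod_mono) (simp add: card_dyadic_le)
  then have "real (card (dyadic_box S \<alpha>)) \<le> real (\<Prod>s\<in>S. 2 * 2 ^ \<alpha> s)"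
    by (simp only: of_nat_le_iff)
  also have "\<dots> = 2 ^ card S * vol S \<alpha>" by (simp add: vol_def prod.distrib)
  finally show ?thesis .
qed

lemma card_le_sum_fibres:
  fixes g :: "(nat \<Rightarrow> int) \<Rightarrow> real"
  assumes S: "finite S" "j \<notin> S" and A: "A \<subseteq> dyadic_box (insert j S) \<alpha>"
    and g: "\<And>x. x \<in> dyadic_box S \<alpha> \<Longrightarrow> real (card {y \<in> dyadic (\<alpha> j). x(j := y) \<in> A}) \<le> g x"
  shows "real (card A) \<le> (\<Sum>x\<in>dyadic_box S \<alpha>. g x)"
proof -
  let ?F = "\<lambda>x. {y \<in> dyadic (\<alpha> j). x(j := y) \<in> A}"
  have "A \<subseteq> (\<Union>x\<in>dyadic_box S \<alpha>. (\<lambda>y. x(j := y)) ` ?F x)"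
  proof
    fix z assume z: "z \<in> A"
    with A have "z \<in> PiE (insert j S) (\<lambda>s. dyadic (\<alpha> s))" by (auto simp: dyadic_box_def)
    then obtain y x where "y \<in> dyadic (\<alpha> j)" "x \<in> dyadic_box S \<alpha>" "z = x(j := y)"
      unfolding PiE_insert_eq dyadic_box_def by auto
    with z show "z \<in> (\<Union>x\<in>dyadic_box S \<alpha>. (\<lambda>y. x(j := y)) ` ?F x)" by blast
  qed
  then have "card A \<le> card (\<Union>x\<in>dyadic_box S \<alpha>. (\<lambda>y. x(j := y)) ` ?F x)"
    using S by (intro card_mono) auto
  also have "\<dots> \<le> (\<Sum>x\<in>dyadic_box S \<alpha>. card ((\<lambda>y. x(j := y)) ` ?F x))"
    using S by (intro card_UN_le) auto
  also have "\<dots> \<le> (\<Sum>x\<in>dyadic_box S \<alpha>. card (?F x))"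
    by (intro sum_mono card_image_le) auto
  finally have "real (card A) \<le> (\<Sum>x\<in>dyadic_box S \<alpha>. real (card (?F x)))"
    unfolding of_nat_sum[symmetric] of_nat_le_iff .
  also have "\<dots> \<le> (\<Sum>x\<in>dyadic_box S \<alpha>. g x)" by (intro sum_mono g)
  finally show ?thesis .
qed

lemma card_fibre_le: "real (card {y \<in> dyadic a. P y}) \<le> 2 * 2 ^ a"
proof -
  have "card {y \<in> dyadic a. P y} \<le> card (dyadic a)" by (intro card_mono) auto
  also have "\<dots> \<le> 2 * 2 ^ a" by (rule card_dyadic_le)
  finally have "real (card {y \<in> dyadic a. P y}) \<le> real (2 * 2 ^ a)" by (simp only: of_nat_le_iff)
  then show ?thesis by simp
qed

lemma polyfun_slice_fun_upd:
  assumes "\<And>a. (\<lambda>x. coeff (Q x) a) \<in> polyfun S" "j \<notin> S"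
  shows "Q (x(j := y)) = Q x"
proof (rule poly_eqI)
  fix a
  show "coeff (Q (x(j := y))) a = coeff (Q x) a"
    by (rule polyfun_cong[OF assms(1)]) (use assms(2) in auto)
qed

text \<open>Either \<open>p\<close> divides a fixed nonzero coefficient with respect to
  \<open>x j\<close>, a condition in fewer variables after which the whole fibre is counted, or
  \<open>f\<close> is nonzero modulo \<open>p\<close> along the fibre and has few roots. The
  threshold \<open>P0\<close> excludes the primes dividing the constant left at the end.\<close>

lemma card_box_dvd_le:
  assumes "finite S" "f \<in> polyfun S" "f x0 \<noteq> 0"
  shows "\<exists>C\<ge>0. \<exists>P0. \<forall>p::nat. \<forall>\<alpha>. prime p \<and> p > P0 \<longrightarrow>
    real (card {x \<in> dyadic_box S \<alpha>. int p dvd f x}) \<le> C * vol S \<alpha> * (1 / real p + recip S \<alpha>)"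
  using assms
proof (induction S arbitrary: f x0 rule: finite_induct)
  case empty
  then obtain c where c: "f = (\<lambda>x. c)" "c \<noteq> 0" using polyfun_empty by metis
  have "\<not> int p dvd c" if "p > nat \<bar>c\<bar>" for p
    using that c(2) zdvd_imp_le[of "int p" "\<bar>c\<bar>"] by auto
  then show ?case using c(1) by (intro exI[of _ 0] exI[of _ "nat \<bar>c\<bar>"]) (auto intro!: card_eq_0_iff[THEN iffD2])
next
  case (insert j S)
  from polyfun_slice[OF insert.prems(1), of j] insert.hyps obtain Q D where
    Q: "\<And>x. degree (Q x) \<le> D" "\<And>x. f x = poly (Q x) (x j)" "\<And>a. (\<lambda>x. coeff (Q x) a) \<in> polyfun S"
    by auto
  have "Q x0 \<noteq> 0" using insert.prems(2) Q(2) by auto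
  \<comment> \<open>The index \<open>a\<close> is chosen once, at the witness \<open>x0\<close>, so
    this coefficient is one fixed nonzero polynomial function.\<close>
  then obtain a where a: "coeff (Q x0) a \<noteq> 0" by (metis leading_coeff_0_iff)
  from insert.IH[OF Q(3) a] obtain C P0 where C: "C \<ge> 0" and IH:
    "\<And>p \<alpha>. prime p \<Longrightarrow> p > P0 \<Longrightarrow> real (card {x \<in> dyadic_box S \<alpha>. int p dvd coeff (Q x) a}) \<le> C * vol S \<alpha> * (1 / real p + recip S \<alpha>)"
    by blast
  let ?C = "2 * C + 2 ^ card S * real D * 2"
  have "real (card {x \<in> dyadic_box (insert j S) \<alpha>. int p dvd f x})
       \<le> ?C * vol (insert j S) \<alpha> * (1 / real p + recip (insert j S) \<alpha>)"
    if p: "prime p" "p > P0" for p \<alpha>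
  proof -
    define r :: real where "r = 2 ^ \<alpha> j"
    have r: "r \<ge> 1" by (simp add: r_def)
    have p0: "real p > 0" using p(1) prime_gt_0_nat by simp
    let ?A = "{x \<in> dyadic_box (insert j S) \<alpha>. int p dvd f x}"
    let ?B = "{x \<in> dyadic_box S \<alpha>. int p dvd coeff (Q x) a}"
    let ?h = "real D * (2 * (r / real p + 1))"
    have "real (card ?A) \<le> (\<Sum>x\<in>dyadic_box S \<alpha>. (if x \<in> ?B then 2 * r else 0) + ?h)"
    proof (rule card_le_sum_fibres[OF insert.hyps(1,2)])
      fix x assume x: "x \<in> dyadic_box S \<alpha>"
      have QQ: "Q (x(j := y)) = Q x" for y by (rule polyfun_slice_fun_upd[OF Q(3) insert.hyps(2)])
      show "real (card {y \<in> dyadic (\<alpha> j). x(j := y) \<in> ?A}) \<le> (if x \<in> ?B then 2 * r else 0) + ?h"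
      proof (cases "x \<in> ?B")
        case True
        have "real (card {y \<in> dyadic (\<alpha> j). x(j := y) \<in> ?A}) \<le> 2 * r"
          unfolding r_def by (rule card_fibre_le)
        also have "\<dots> \<le> 2 * r + ?h" using r p0 by simp
        finally show ?thesis using True by simp
      next
        case False
        with x have nd: "\<not> int p dvd coeff (Q x) a" by blast
        have "real (card {y \<in> dyadic (\<alpha> j). x(j := y) \<in> ?A}) \<le> real (card {y \<in> dyadic (\<alpha> j). int p dvd poly (Q x) y})"
          unfolding of_nat_le_iff by (intro card_mono) (auto simp: Q(2) QQ)
        also have "\<dots> \<le> ?h" unfolding r_def by (rule card_dyadic_roots[OF p(1) nd Q(1)])
        finally show ?thesis by (subst if_not_P[OF False]) simp
      qed
    qed auto
    also have "\<dots> = 2 * r * real (card ?B) + real (card (dyadic_box S \<alpha>)) * ?h"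
      using insert.hyps(1) by (simp add: sum.distrib sum.If_cases Int_def)
    also have "\<dots> \<le> 2 * r * (C * vol S \<alpha> * (1 / real p + recip S \<alpha>)) + 2 ^ card S * vol S \<alpha> * ?h"
      using IH[OF p] card_dyadic_box_le[OF insert.hyps(1)] r p0
      by (intro add_mono mult_left_mono mult_right_mono) auto
    also have "\<dots> = (vol S \<alpha> * r) * (2 * C * (1 / real p + recip S \<alpha>) + 2 ^ card S * real D * 2 * (1 / real p + 1 / r))"
      using r p0 by (simp add: field_simps)
    also have "\<dots> \<le> (vol S \<alpha> * r) * (2 * C * (1 / real p + (recip S \<alpha> + 1 / r)) + 2 ^ card S * real D * 2 * (1 / real p + (recip S \<alpha> + 1 / r)))"
      using r p0 C by (intro mult_left_mono add_mono) auto
    also have "\<dots> = ?C * vol (insert j S) \<alpha> * (1 / real p + recip (insert j S) \<alpha>)"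
      using insert.hyps by (simp add: vol_insert recip_insert r_def algebra_simps)
    finally show ?thesis .
  qed
  moreover have "?C \<ge> 0" using C by simp
  ultimately show ?case by blast
qed

text \<open>Zero is divisible by every prime, so \<open>p\<close> may tend to infinity in the
  preceding bound and the term \<open>1 / p\<close> disappears.\<close>

lemma card_box_zero_le:
  assumes "finite S" "f \<in> polyfun S" "f x0 \<noteq> 0"
  shows "\<exists>C\<ge>0. \<forall>\<alpha>. real (card {x \<in> dyadic_box S \<alpha>. f x = 0}) \<le> C * vol S \<alpha> * recip S \<alpha>"
proof -
  from card_box_dvd_le[OF assms] obtain C P0 where C: "C \<ge> 0" and H:
    "\<And>p \<alpha>. prime p \<Longrightarrow> p > P0 \<Longrightarrow> real (card {x \<in> dyadic_box S \<alpha>. int p dvd f x}) \<le> C * vol S \<alpha> * (1 / real p + recip S \<alpha>)"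
    by blast
  have "real (card {x \<in> dyadic_box S \<alpha>. f x = 0}) \<le> C * vol S \<alpha> * recip S \<alpha>" for \<alpha>
  proof (rule field_le_epsilon)
    fix e :: real assume e: "e > 0"
    obtain p where p: "prime p" "p > max P0 (nat \<lceil>C * vol S \<alpha> / e\<rceil>)" using bigger_prime by blast
    then have "real p \<ge> C * vol S \<alpha> / e" by linarith
    then have pe: "C * vol S \<alpha> * (1 / real p) \<le> e"
      using e p(1) prime_gt_0_nat[of p] by (simp add: field_simps)
    have "real (card {x \<in> dyadic_box S \<alpha>. f x = 0}) \<le> real (card {x \<in> dyadic_box S \<alpha>. int p dvd f x})"
      unfolding of_nat_le_iff using assms(1) by (intro card_mono) auto
    also have "\<dots> \<le> C * vol S \<alpha> * (1 / real p + recip S \<alpha>)" using p by (intro H) auto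
    finally show "real (card {x \<in> dyadic_box S \<alpha>. f x = 0}) \<le> C * vol S \<alpha> * recip S \<alpha> + e"
      using pe by (simp add: distrib_left)
  qed
  with C show ?thesis by blast
qed

text \<open>The product of these primes divides \<open>m\<close>, hence is at most
  \<open>2 ^ (C + (a + 1) * E)\<close>, and each factor is at least
  \<open>2 ^ max 1 a\<close>.\<close>

lemma card_large_prime_divisors_le:
  fixes m :: int
  assumes "m \<noteq> 0" "\<bar>m\<bar> \<le> int (C * (2 ^ (a + 1)) ^ E)"
  shows "card {p::nat. prime p \<and> int p dvd m \<and> p > 2 ^ a} \<le> C + 2 * E"
proof -
  let ?T = "{p::nat. prime p \<and> int p dvd m \<and> p > 2 ^ a}"
  \<comment> \<open>For \<open>a = 0\<close> the bound \<open>p \<ge> 2 ^ a\<close> says nothing;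
    \<open>p \<ge> 2\<close> takes over, and \<open>a + 1 \<le> 2 * b\<close> in all cases.\<close>
  define b where "b = max 1 a"
  have le: "p \<le> nat \<bar>m\<bar>" if "int p dvd m" for p
    using zdvd_imp_le[of "int p" "\<bar>m\<bar>"] that assms(1) by auto
  have fin: "finite ?T" by (rule finite_subset[of _ "{..nat \<bar>m\<bar>}"]) (use le in auto)
  have "\<Prod>?T dvd nat \<bar>m\<bar>"
  proof (rule prod_dvd_of_coprime[OF fin])
    fix p assume "p \<in> ?T"
    then have "int p dvd int (nat \<bar>m\<bar>)" by simp
    then show "p dvd nat \<bar>m\<bar>" by (simp only: int_dvd_int_iff)
  qed (auto simp: primes_coprime)
  then have "\<Prod>?T \<le> nat \<bar>m\<bar>" using assms(1) by (intro dvd_imp_le) auto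
  also have "\<dots> \<le> C * (2 ^ (a + 1)) ^ E" using assms(2) by linarith
  also have "\<dots> \<le> 2 ^ C * 2 ^ ((a + 1) * E)"
    by (simp only: power_mult) (intro mult_right_mono less_imp_le less_exp, simp)
  also have "\<dots> = 2 ^ (C + (a + 1) * E)" by (simp add: power_add)
  finally have 1: "\<Prod>?T \<le> 2 ^ (C + (a + 1) * E)" .
  have "(\<Prod>p\<in>?T. 2 ^ b) \<le> \<Prod>?T"
  proof (rule prod_mono)
    fix p assume "p \<in> ?T"
    then have "2 ^ 1 \<le> p" "2 ^ a \<le> p" using prime_ge_2_nat by auto
    then show "0 \<le> (2::nat) ^ b \<and> 2 ^ b \<le> p" by (auto simp: b_def max_def)
  qed
  moreover have "(\<Prod>p\<in>?T. 2 ^ b) = (2::nat) ^ (b * card ?T)" by (simp only: prod_constant power_mult)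
  ultimately have "(2::nat) ^ (b * card ?T) \<le> 2 ^ (C + (a + 1) * E)" using 1 by linarith
  then have "b * card ?T \<le> C + (a + 1) * E" by (rule power_le_imp_le_exp[rotated]) simp
  also have "\<dots> \<le> b * C + (2 * b) * E" by (intro add_mono mult_right_mono) (auto simp: b_def)
  also have "\<dots> = b * (C + 2 * E)" by (simp add: algebra_simps)
  finally show ?thesis by (simp add: b_def)
qed

text \<open>\<open>A\<close> is any bound for the exponents and not their maximum: the logarithmic
  factor then stays the same when a variable is removed, and one value \<open>L\<close> serves all
  boxes at the end.\<close>

definition sieve_bound :: "nat set \<Rightarrow> (nat \<Rightarrow> (nat \<Rightarrow> int) \<Rightarrow> int) \<Rightarrow> real \<Rightarrow> real \<Rightarrow> (nat \<Rightarrow> nat) \<Rightarrow> bool" where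
  "sieve_bound S d C P0 \<alpha> \<longleftrightarrow> (\<forall>N A. N \<ge> P0 \<longrightarrow> (\<forall>s\<in>S. \<alpha> s \<le> A) \<longrightarrow>
     real (card {x \<in> dyadic_box S \<alpha>. \<exists>p::nat. prime p \<and> N \<le> real p \<and> (\<forall>i\<in>S. int p dvd d i x)})
       \<le> C * vol S \<alpha> * (1 / (N * ln N) + (1 + ln (1 + real A)) * recip S \<alpha>))"

lemma sieve_bound_mono:
  assumes "sieve_bound S d C P0 \<alpha>" "C \<le> C'" "P0 \<le> P0'" "P0' > 1"
  shows "sieve_bound S d C' P0' \<alpha>"
  unfolding sieve_bound_def
proof (intro allI impI)
  fix N :: real and A assume N: "N \<ge> P0'" and A: "\<forall>s\<in>S. \<alpha> s \<le> A"
  have "real (card {x \<in> dyadic_box S \<alpha>. \<exists>p::nat. prime p \<and> N \<le> real p \<and> (\<forall>i\<in>S. int p dvd d i x)})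
       \<le> C * vol S \<alpha> * (1 / (N * ln N) + (1 + ln (1 + real A)) * recip S \<alpha>)"
    using assms(1,3) N A unfolding sieve_bound_def by (meson order.trans)
  also have "\<dots> \<le> C' * vol S \<alpha> * (1 / (N * ln N) + (1 + ln (1 + real A)) * recip S \<alpha>)"
    using assms N by (intro mult_right_mono) auto
  finally show "real (card {x \<in> dyadic_box S \<alpha>. \<exists>p::nat. prime p \<and> N \<le> real p \<and> (\<forall>i\<in>S. int p dvd d i x)})
       \<le> C' * vol S \<alpha> * (1 / (N * ln N) + (1 + ln (1 + real A)) * recip S \<alpha>)" .
qed

text \<open>Whole fibres are charged to \<open>?E\<close>, where one prime divides all
  \<open>c i\<close> (induction hypothesis), and to \<open>?Z\<close>, where \<open>d j\<close>
  vanishes. In every other fibre the prime divides the nonzero number \<open>d j x\<close>: primes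
  up to \<open>2 ^ \<alpha> j\<close> contribute \<open>r / p\<close> each and are summed over all
  \<open>x\<close>, and there are at most \<open>W\<close> larger ones.\<close>

lemma sieve_bound_step:
  assumes S: "finite S" "j \<notin> S" "S \<noteq> {}"
    and d: "\<And>i. i \<in> insert j S \<Longrightarrow> d i \<in> polyfun (insert j S - {i}) \<and> (\<exists>x. d i x \<noteq> 0)"
    and IH: "\<And>c. (\<And>i. i \<in> S \<Longrightarrow> c i \<in> polyfun (S - {i}) \<and> (\<exists>x. c i x \<noteq> 0)) \<Longrightarrow>
       \<exists>C\<ge>0. \<exists>P0. \<forall>\<alpha>. sieve_bound S c C P0 \<alpha>"
  shows "\<exists>C\<ge>0. \<exists>P0. \<forall>\<alpha>. (\<forall>s\<in>S. \<alpha> s \<le> \<alpha> j) \<longrightarrow> sieve_bound (insert j S) d C P0 \<alpha>"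
proof -
  have "\<forall>i\<in>S. \<exists>Q D a. (\<forall>x. degree (Q x) \<le> D \<and> d i x = poly (Q x) (x j)) \<and>
     (\<forall>a. (\<lambda>x. coeff (Q x) a) \<in> polyfun (S - {i})) \<and> (\<exists>x. coeff (Q x) a \<noteq> 0)"
  proof
    fix i assume i: "i \<in> S"
    have eq: "insert j S - {i} - {j} = S - {i}" using S(2) by auto
    have di: "d i \<in> polyfun (insert j S - {i})" "\<exists>x. d i x \<noteq> 0" using d[of i] i by auto
    from polyfun_slice[OF di(1), of j] obtain Q D where
      Q: "\<forall>x. degree (Q x) \<le> D \<and> d i x = poly (Q x) (x j)" "\<forall>a. (\<lambda>x. coeff (Q x) a) \<in> polyfun (S - {i})"
      unfolding eq by blast
    from di(2) obtain x where "d i x \<noteq> 0" by blast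
    with Q(1) have "Q x \<noteq> 0" by auto
    then have "coeff (Q x) (degree (Q x)) \<noteq> 0" by simp
    with Q show "\<exists>Q D a. (\<forall>x. degree (Q x) \<le> D \<and> d i x = poly (Q x) (x j)) \<and>
     (\<forall>a. (\<lambda>x. coeff (Q x) a) \<in> polyfun (S - {i})) \<and> (\<exists>x. coeff (Q x) a \<noteq> 0)" by blast
  qed
  then obtain Q D a where
    Q: "\<And>i x. i \<in> S \<Longrightarrow> degree (Q i x) \<le> D i" "\<And>i x. i \<in> S \<Longrightarrow> d i x = poly (Q i x) (x j)"
       "\<And>i a. i \<in> S \<Longrightarrow> (\<lambda>x. coeff (Q i x) a) \<in> polyfun (S - {i})" and
    a: "\<And>i. i \<in> S \<Longrightarrow> \<exists>x. coeff (Q i x) (a i) \<noteq> 0"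
    by metis
  \<comment> \<open>\<open>c i\<close> omits both \<open>x j\<close> and \<open>x i\<close>, so this
    family satisfies the hypothesis in the variables \<open>S\<close>.\<close>
  define c where "c = (\<lambda>i x. coeff (Q i x) (a i))"
  obtain C1 P1 where C1: "C1 \<ge> 0" and H1: "\<And>\<alpha>. sieve_bound S c C1 P1 \<alpha>"
    using IH[of c] Q(3) a unfolding c_def by blast
  have dj: "d j \<in> polyfun S" "\<exists>x. d j x \<noteq> 0" using d[of j] S(2) by auto
  from dj(2) obtain x0 where x0: "d j x0 \<noteq> 0" by blast
  obtain C2 P2 where C2: "C2 \<ge> 0" and H2:
    "\<And>p \<alpha>. prime p \<Longrightarrow> p > P2 \<Longrightarrow> real (card {x \<in> dyadic_box S \<alpha>. int p dvd d j x}) \<le> C2 * vol S \<alpha> * (1 / real p + recip S \<alpha>)"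
    using card_box_dvd_le[OF S(1) dj(1) x0] by blast
  obtain C3 where C3: "C3 \<ge> 0" and H3:
    "\<And>\<alpha>. real (card {x \<in> dyadic_box S \<alpha>. d j x = 0}) \<le> C3 * vol S \<alpha> * recip S \<alpha>"
    using card_box_zero_le[OF S(1) dj(1) x0] by blast
  obtain C4 E where H4: "\<And>x (M::nat). M \<ge> 1 \<Longrightarrow> (\<forall>i\<in>S. \<bar>x i\<bar> \<le> int M) \<Longrightarrow> \<bar>d j x\<bar> \<le> int (C4 * M ^ E)"
    using polyfun_bound[OF dj(1)] by blast
  define DD where "DD = (\<Sum>i\<in>S. D i)"
  define W where "W = C4 + 2 * E"
  \<comment> \<open>The summands belong, in order, to \<open>?E\<close>, to the sum of
    \<open>1 / p ^ 2\<close> (4 times 16), to \<open>?Z\<close>, to the sum of \<open>1 / p\<close>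
    (4 times 6) and to the large primes.\<close>
  define C where "C = 2 * C1 + 64 * real DD * C2 + 2 * C3 + 24 * real DD * C2 + 4 * real DD * real W * 2 ^ card S"
  \<comment> \<open>\<open>P2 + 1\<close> puts all primes \<open>p \<ge> N\<close> above
    \<open>P2\<close>; the 3 yields \<open>N > 2\<close> for the sum over inverse squares.\<close>
  define P0 where "P0 = max P1 (max (real P2 + 1) 3)"
  have "sieve_bound (insert j S) d C P0 \<alpha>" if \<alpha>: "\<forall>s\<in>S. \<alpha> s \<le> \<alpha> j" for \<alpha>
    unfolding sieve_bound_def
  proof (intro allI impI)
    fix N :: real and A assume N0: "N \<ge> P0" and A: "\<forall>s\<in>insert j S. \<alpha> s \<le> A"
    have N: "N \<ge> P1" "N > real P2" "N > 2" using N0 by (auto simp: P0_def)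
    define r :: real where "r = 2 ^ \<alpha> j"
    have r: "r \<ge> 1" by (simp add: r_def)
    define \<Lambda> where "\<Lambda> = 1 + ln (1 + real A)"
    have \<Lambda>: "\<Lambda> \<ge> 1" by (simp add: \<Lambda>_def)
    define NN where "NN = 1 / (N * ln N)"
    have NN: "NN \<ge> 0" using N by (simp add: NN_def)
    let ?A = "{x \<in> dyadic_box (insert j S) \<alpha>. \<exists>p::nat. prime p \<and> N \<le> real p \<and> (\<forall>i\<in>insert j S. int p dvd d i x)}"
    let ?E = "{x \<in> dyadic_box S \<alpha>. \<exists>p::nat. prime p \<and> N \<le> real p \<and> (\<forall>i\<in>S. int p dvd c i x)}"
    let ?Z = "{x \<in> dyadic_box S \<alpha>. d j x = 0}"
    let ?P = "{p. prime p \<and> N \<le> real p \<and> p \<le> 2 ^ \<alpha> j}"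
    have finP: "finite ?P" by (rule finite_subset[of _ "{..2 ^ \<alpha> j}"]) auto
    have pP: "real p > 0" "p > P2" "prime p" if "p \<in> ?P" for p using that N prime_gt_0_nat[of p] by auto
    let ?g = "\<lambda>x. (if x \<in> ?E then 2 * r else 0) + (if x \<in> ?Z then 2 * r else 0) +
       4 * real DD * ((\<Sum>p\<in>?P. if int p dvd d j x then r / real p else 0) + real W)"
    have "real (card ?A) \<le> (\<Sum>x\<in>dyadic_box S \<alpha>. ?g x)"
    proof (rule card_le_sum_fibres[OF S(1,2)])
      fix x assume x: "x \<in> dyadic_box S \<alpha>"
      let ?F = "{y \<in> dyadic (\<alpha> j). x(j := y) \<in> ?A}"
      have QQ: "Q i (x(j := y)) = Q i x" if "i \<in> S" for i y
        by (rule polyfun_slice_fun_upd[OF Q(3)[OF that]]) (use S(2) in auto)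
      have dd: "d j (x(j := y)) = d j x" for y
        by (rule polyfun_cong[OF dj(1)]) (use S(2) in auto)
      have s0: "(\<Sum>p\<in>?P. if int p dvd d j x then r / real p else 0) \<ge> 0"
        using r by (intro sum_nonneg) auto
      show "real (card ?F) \<le> ?g x"
      proof (cases "x \<in> ?E \<or> x \<in> ?Z")
        case True
        have "real (card ?F) \<le> 2 * r" unfolding r_def by (rule card_fibre_le)
        moreover have "4 * real DD * ((\<Sum>p\<in>?P. if int p dvd d j x then r / real p else 0) + real W) \<ge> 0"
          using s0 by (intro mult_nonneg_nonneg) auto
        moreover have "(if x \<in> ?E then 2 * r else 0) + (if x \<in> ?Z then 2 * r else 0) \<ge> 2 * r"
        proof -
          have "(if P then 2 * r else 0) + (if R then 2 * r else 0) \<ge> 2 * r" if "P \<or> R" for P R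
            using that r by auto
          then show ?thesis using True .
        qed
        ultimately show ?thesis by linarith
      next
        case False
        with x have nE: "\<And>p::nat. prime p \<Longrightarrow> N \<le> real p \<Longrightarrow> \<exists>i\<in>S. \<not> int p dvd c i x" and nZ: "d j x \<noteq> 0"
          by auto
        let ?T = "{p::nat. prime p \<and> N \<le> real p \<and> int p dvd d j x}"
        let ?T1 = "{p \<in> ?P. int p dvd d j x}"
        let ?T2 = "{p::nat. prime p \<and> int p dvd d j x \<and> p > 2 ^ \<alpha> j}"
        have le: "p \<le> nat \<bar>d j x\<bar>" if "int p dvd d j x" for p
          using zdvd_imp_le[of "int p" "\<bar>d j x\<bar>"] that nZ by auto
        have finT: "finite ?T" "finite ?T2"
          by (rule finite_subset[of _ "{..nat \<bar>d j x\<bar>}"], use le in auto)+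
        have "\<bar>d j x\<bar> \<le> int (C4 * (2 ^ (\<alpha> j + 1)) ^ E)"
        proof (rule H4)
          show "\<forall>i\<in>S. \<bar>x i\<bar> \<le> int (2 ^ (\<alpha> j + 1))"
          proof
            fix i assume i: "i \<in> S"
            have "x i \<in> dyadic (\<alpha> i)" using x i by (auto simp: dyadic_box_def)
            then have "\<bar>x i\<bar> \<le> 2 ^ (\<alpha> i + 1)" by (simp add: dyadic_def)
            also have "\<dots> \<le> 2 ^ (\<alpha> j + 1)" using \<alpha> i by (intro power_increasing) auto
            finally show "\<bar>x i\<bar> \<le> int (2 ^ (\<alpha> j + 1))" by simp
          qed
        qed simp
        \<comment> \<open>Here the longest side enters: \<open>\<bar>d j x\<bar>\<close> is
          polynomially bounded in \<open>2 ^ (\<alpha> j + 1)\<close>.\<close>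
        then have W: "card ?T2 \<le> W" unfolding W_def by (rule card_large_prime_divisors_le[OF nZ])
        let ?G = "\<lambda>p i. {y \<in> dyadic (\<alpha> j). \<not> int p dvd c i x \<and> int p dvd poly (Q i x) y}"
        have G: "real (card (?G p i)) \<le> real (D i) * (2 * (r / real p + 1))" if "prime p" "i \<in> S" for p i
        proof (cases "int p dvd c i x")
          case True
          then show ?thesis using r by simp
        next
          case False
          then have "real (card {y \<in> dyadic (\<alpha> j). int p dvd poly (Q i x) y}) \<le> real (D i) * (2 * (r / real p + 1))"
            unfolding r_def c_def by (rule card_dyadic_roots[OF that(1) _ Q(1)[OF that(2)]])
          with False show ?thesis by simp
        qed
        have "?F \<subseteq> (\<Union>p\<in>?T. \<Union>i\<in>S. ?G p i)"
        proof
          fix y assume y: "y \<in> ?F"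
          then obtain p where p: "prime p" "N \<le> real p" "\<And>i. i \<in> insert j S \<Longrightarrow> int p dvd d i (x(j := y))" by blast
          have "p \<in> ?T" using p dd[of y] by (metis (no_types, lifting) insertI1 mem_Collect_eq)
          moreover obtain i where i: "i \<in> S" "\<not> int p dvd c i x" using nE[OF p(1,2)] by blast
          moreover have "int p dvd poly (Q i x) y" using p(3)[of i] i Q(2)[OF i(1)] QQ[OF i(1)] by simp
          ultimately show "y \<in> (\<Union>p\<in>?T. \<Union>i\<in>S. ?G p i)" using y by blast
        qed
        then have "card ?F \<le> card (\<Union>p\<in>?T. \<Union>i\<in>S. ?G p i)"
          using finT S(1) by (intro card_mono) auto
        also have "\<dots> \<le> (\<Sum>p\<in>?T. card (\<Union>i\<in>S. ?G p i))" by (rule card_UN_le[OF finT(1)])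
        also have "\<dots> \<le> (\<Sum>p\<in>?T. \<Sum>i\<in>S. card (?G p i))" by (intro sum_mono card_UN_le S(1))
        finally have "real (card ?F) \<le> (\<Sum>p\<in>?T. \<Sum>i\<in>S. real (card (?G p i)))"
          unfolding of_nat_sum[symmetric] of_nat_le_iff .
        also have "\<dots> \<le> (\<Sum>p\<in>?T. \<Sum>i\<in>S. real (D i) * (2 * (r / real p + 1)))"
          by (intro sum_mono G) auto
        also have "\<dots> = (\<Sum>p\<in>?T. real DD * (2 * (r / real p + 1)))"
          by (simp only: DD_def of_nat_sum sum_distrib_right)
        also have "\<dots> \<le> (\<Sum>p\<in>?T1 \<union> ?T2. real DD * (2 * (r / real p + 1)))"
          using finT finP r by (intro sum_mono2) auto
        also have "\<dots> = (\<Sum>p\<in>?T1. real DD * (2 * (r / real p + 1))) + (\<Sum>p\<in>?T2. real DD * (2 * (r / real p + 1)))"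
          using finT finP by (intro sum.union_disjoint) auto
        also have "\<dots> \<le> (\<Sum>p\<in>?T1. 4 * real DD * (r / real p)) + (\<Sum>p\<in>?T2. 4 * real DD)"
        proof (intro add_mono sum_mono)
          fix p assume p: "p \<in> ?T1"
          then have "real p \<le> real (2 ^ \<alpha> j)" by (simp only: of_nat_le_iff) simp
          \<comment> \<open>For small primes the summand 1 is absorbed into \<open>r / p\<close>, at
            the price of a factor 2.\<close>
          then have "1 \<le> r / real p" using pP[of p] p by (simp add: r_def)
          then have "real DD * (2 * (r / real p + 1)) \<le> real DD * (4 * (r / real p))" by (intro mult_left_mono) auto
          then show "real DD * (2 * (r / real p + 1)) \<le> 4 * real DD * (r / real p)" by simp
        next
          fix p assume p: "p \<in> ?T2"
          then have "real (2 ^ \<alpha> j) < real p" by (simp only: of_nat_less_iff) simp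
          then have "r < real p" by (simp add: r_def)
          then have "r / real p \<le> 1" using r by simp
          then have "real DD * (2 * (r / real p + 1)) \<le> real DD * 4" by (intro mult_left_mono) auto
          then show "real DD * (2 * (r / real p + 1)) \<le> 4 * real DD" by simp
        qed
        also have "\<dots> = 4 * real DD * ((\<Sum>p\<in>?T1. r / real p) + real (card ?T2))"
          by (simp add: sum_distrib_left distrib_left)
        also have "\<dots> \<le> 4 * real DD * ((\<Sum>p\<in>?T1. r / real p) + real W)"
          using W by (intro mult_left_mono add_mono) auto
        also have "(\<Sum>p\<in>?T1. r / real p) = (\<Sum>p\<in>?P. if int p dvd d j x then r / real p else 0)"
          by (rule sum.inter_filter[OF finP])
        finally have F: "real (card ?F) \<le> 4 * real DD * ((\<Sum>p\<in>?P. if int p dvd d j x then r / real p else 0) + real W)" .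
        have "X \<le> (if P then 2 * r else 0) + (if R then 2 * r else 0) + X" for P R X using r by auto
        with F show ?thesis by (rule order.trans)
      qed
    qed auto
    also have "\<dots> = 2 * r * real (card ?E) + 2 * r * real (card ?Z) +
        4 * real DD * ((\<Sum>x\<in>dyadic_box S \<alpha>. \<Sum>p\<in>?P. if int p dvd d j x then r / real p else 0) + real W * real (card (dyadic_box S \<alpha>)))"
    proof -
      have "(\<Sum>x\<in>dyadic_box S \<alpha>. (if x \<in> ?E then 2 * r else 0) + (if x \<in> ?Z then 2 * r else 0) + 4 * real DD * (h x + real W))
         = 2 * r * real (card ?E) + 2 * r * real (card ?Z) + 4 * real DD * ((\<Sum>x\<in>dyadic_box S \<alpha>. h x) + real W * real (card (dyadic_box S \<alpha>)))" for h
        using S(1) by (simp add: sum.distrib sum.If_cases Int_def sum_distrib_left[symmetric])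
      then show ?thesis .
    qed
    \<comment> \<open>Exchanging the sums turns the divisibility \<open>p dvd d j x\<close> into a
      second saving of \<open>1 / p + recip S \<alpha>\<close>.\<close>
    also have "(\<Sum>x\<in>dyadic_box S \<alpha>. \<Sum>p\<in>?P. if int p dvd d j x then r / real p else 0)
       = (\<Sum>p\<in>?P. r / real p * real (card {x \<in> dyadic_box S \<alpha>. int p dvd d j x}))"
    proof (subst sum.swap, rule sum.cong[OF refl])
      fix p
      show "(\<Sum>x\<in>dyadic_box S \<alpha>. if int p dvd d j x then r / real p else 0) = r / real p * real (card {x \<in> dyadic_box S \<alpha>. int p dvd d j x})"
        by (subst sum.inter_filter[symmetric]) (use S(1) in simp_all)
    qed
    also have "\<dots> \<le> (\<Sum>p\<in>?P. r / real p * (C2 * vol S \<alpha> * (1 / real p + recip S \<alpha>)))"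
    proof (rule sum_mono)
      fix p assume "p \<in> ?P"
      from pP[OF this] r show "r / real p * real (card {x \<in> dyadic_box S \<alpha>. int p dvd d j x})
         \<le> r / real p * (C2 * vol S \<alpha> * (1 / real p + recip S \<alpha>))"
        by (intro mult_left_mono H2 divide_nonneg_pos) linarith+
    qed
    also have "\<dots> = r * (C2 * vol S \<alpha>) * ((\<Sum>p\<in>?P. 1 / real p ^ 2) + (\<Sum>p\<in>?P. 1 / real p) * recip S \<alpha>)"
      by (simp add: sum_distrib_left sum_distrib_right sum.distrib distrib_left power2_eq_square mult_ac)
    also have "\<dots> \<le> r * (C2 * vol S \<alpha>) * (16 * NN + (6 * \<Lambda>) * recip S \<alpha>)"
    proof (intro mult_left_mono add_mono mult_right_mono)
      show "(\<Sum>p\<in>?P. 1 / real p ^ 2) \<le> 16 * NN"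
        using sum_inverse_square_primes_le[OF N(3), of "\<alpha> j"] by (simp add: NN_def)
      have "(\<Sum>p\<in>?P. 1 / real p) \<le> (\<Sum>p | prime p \<and> p \<le> 2 ^ \<alpha> j. 1 / real p)"
        by (rule sum_mono2) (auto intro: finite_subset[of _ "{..2 ^ \<alpha> j}"])
      also have "\<dots> \<le> 6 * (1 + ln (1 + real (\<alpha> j)))" by (rule sum_inverse_primes_le)
      also have "\<dots> \<le> 6 * \<Lambda>" using A by (simp add: \<Lambda>_def)
      finally show "(\<Sum>p\<in>?P. 1 / real p) \<le> 6 * \<Lambda>" .
    qed (use r C2 in auto)
    finally have main: "real (card ?A) \<le> 2 * r * real (card ?E) + 2 * r * real (card ?Z) +
        4 * real DD * (r * (C2 * vol S \<alpha>) * (16 * NN + (6 * \<Lambda>) * recip S \<alpha>) + real W * real (card (dyadic_box S \<alpha>)))"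
      by (simp add: mult_left_mono)
    also have "\<dots> \<le> 2 * r * (C1 * vol S \<alpha> * (NN + \<Lambda> * recip S \<alpha>)) + 2 * r * (C3 * vol S \<alpha> * recip S \<alpha>) +
        4 * real DD * (r * (C2 * vol S \<alpha>) * (16 * NN + (6 * \<Lambda>) * recip S \<alpha>) + real W * (2 ^ card S * vol S \<alpha>))"
    proof (intro add_mono mult_left_mono H3 card_dyadic_box_le S(1) order.refl)
      show "real (card ?E) \<le> C1 * vol S \<alpha> * (NN + \<Lambda> * recip S \<alpha>)"
        using H1[of \<alpha>] N(1) A unfolding sieve_bound_def NN_def \<Lambda>_def by blast
    qed (use r C2 \<Lambda> in \<open>auto intro!: mult_nonneg_nonneg\<close>)
    also have "\<dots> = (vol S \<alpha> * r) * (2 * C1 * (NN + \<Lambda> * recip S \<alpha>) + 2 * C3 * recip S \<alpha> +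
        64 * real DD * C2 * NN + 24 * real DD * C2 * (\<Lambda> * recip S \<alpha>) + 4 * real DD * real W * 2 ^ card S * (1 / r))"
      using r by (simp add: field_simps)
    also have "\<dots> \<le> (vol S \<alpha> * r) * (2 * C1 * (NN + \<Lambda> * (recip S \<alpha> + 1 / r)) + 2 * C3 * (NN + \<Lambda> * (recip S \<alpha> + 1 / r)) +
        64 * real DD * C2 * (NN + \<Lambda> * (recip S \<alpha> + 1 / r)) + 24 * real DD * C2 * (NN + \<Lambda> * (recip S \<alpha> + 1 / r))
         + 4 * real DD * real W * 2 ^ card S * (NN + \<Lambda> * (recip S \<alpha> + 1 / r)))"
    proof -
      let ?X = "NN + \<Lambda> * (recip S \<alpha> + 1 / r)"
      have m: "\<Lambda> * recip S \<alpha> \<le> \<Lambda> * (recip S \<alpha> + 1 / r)" "\<Lambda> * (1 / r) \<le> \<Lambda> * (recip S \<alpha> + 1 / r)"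
        using r \<Lambda> by (intro mult_left_mono; simp)+
      have m': "1 * recip S \<alpha> \<le> \<Lambda> * recip S \<alpha>" "1 * (1 / r) \<le> \<Lambda> * (1 / r)"
        using r \<Lambda> by (intro mult_right_mono; simp)+
      have nn: "\<Lambda> * recip S \<alpha> \<ge> 0" "\<Lambda> * (1 / r) \<ge> 0" using r \<Lambda> by auto
      have "NN + \<Lambda> * recip S \<alpha> \<le> ?X" "recip S \<alpha> \<le> ?X" "NN \<le> ?X" "\<Lambda> * recip S \<alpha> \<le> ?X" "1 / r \<le> ?X"
        using m m' NN nn by linarith+
      then show ?thesis using C1 C2 C3 r \<Lambda> by (intro mult_left_mono add_mono) auto
    qed
    also have "\<dots> = C * (vol S \<alpha> * r) * (NN + \<Lambda> * (recip S \<alpha> + 1 / r))"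
      unfolding C_def by (simp only: distrib_left distrib_right mult_ac)
    also have "\<dots> = C * vol (insert j S) \<alpha> * (NN + \<Lambda> * recip (insert j S) \<alpha>)"
      using S by (simp add: vol_insert recip_insert r_def)
    finally show "real (card ?A) \<le> C * vol (insert j S) \<alpha> * (1 / (N * ln N) + (1 + ln (1 + real A)) * recip (insert j S) \<alpha>)"
      unfolding NN_def \<Lambda>_def .
  qed
  moreover have "C \<ge> 0" using C1 C2 C3 by (simp add: C_def)
  ultimately show ?thesis by blast
qed

text \<open>Which side is longest depends on the box, so the step is applied for every
  \<open>j\<close> and the finitely many constants are added. With one variable left,
  \<open>d j\<close> is a nonzero constant and large primes do not divide it.\<close>

theorem sieve_bound_exists:
  assumes "finite S" "S \<noteq> {}"
    and "\<And>i. i \<in> S \<Longrightarrow> d i \<in> polyfun (S - {i}) \<and> (\<exists>x. d i x \<noteq> 0)"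
  shows "\<exists>C\<ge>0. \<exists>P0. \<forall>\<alpha>. sieve_bound S d C P0 \<alpha>"
  using assms
proof (induction "card S" arbitrary: S d rule: less_induct)
  case (less S d)
  have "\<exists>C\<ge>0. \<exists>P0. \<forall>\<alpha>. (\<forall>s\<in>S. \<alpha> s \<le> \<alpha> j) \<longrightarrow> sieve_bound S d C P0 \<alpha>" if j: "j \<in> S" for j
  proof (cases "S = {j}")
    case True
    have dj: "d j \<in> polyfun {}" "\<exists>x. d j x \<noteq> 0" using less.prems(3)[OF j] True by auto
    then obtain c where c: "d j = (\<lambda>x. c)" "c \<noteq> 0" using polyfun_empty by metis
    have "sieve_bound S d 0 (\<bar>real_of_int c\<bar> + 1) \<alpha>" for \<alpha>
      unfolding sieve_bound_def
    proof (intro allI impI)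
      fix N :: real and A assume N: "N \<ge> \<bar>real_of_int c\<bar> + 1"
      have "\<not> int p dvd c" if "N \<le> real p" for p
      proof
        assume "int p dvd c"
        then have "int p \<le> \<bar>c\<bar>" using zdvd_imp_le[of "int p" "\<bar>c\<bar>"] c(2) by auto
        then show False using that N by linarith
      qed
      then have "{x \<in> dyadic_box S \<alpha>. \<exists>p::nat. prime p \<and> N \<le> real p \<and> (\<forall>i\<in>S. int p dvd d i x)} = {}"
        using c(1) True by auto
      then show "real (card {x \<in> dyadic_box S \<alpha>. \<exists>p::nat. prime p \<and> N \<le> real p \<and> (\<forall>i\<in>S. int p dvd d i x)})
        \<le> 0 * vol S \<alpha> * (1 / (N * ln N) + (1 + ln (1 + real A)) * recip S \<alpha>)"
        by (simp only: card.empty)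
    qed
    then show ?thesis by blast
  next
    case False
    define S' where "S' = S - {j}"
    have S': "S = insert j S'" "finite S'" "j \<notin> S'" "S' \<noteq> {}" using False j less.prems(1) by (auto simp: S'_def)
    have "card S' < card S" using S' by simp
    have "\<exists>C\<ge>0. \<exists>P0. \<forall>\<alpha>. (\<forall>s\<in>S'. \<alpha> s \<le> \<alpha> j) \<longrightarrow> sieve_bound (insert j S') d C P0 \<alpha>"
    proof (rule sieve_bound_step[OF S'(2-4)])
      show "d i \<in> polyfun (insert j S' - {i}) \<and> (\<exists>x. d i x \<noteq> 0)" if "i \<in> insert j S'" for i
        using less.prems(3)[of i] that S'(1) by simp
      show "\<exists>C\<ge>0. \<exists>P0. \<forall>\<alpha>. sieve_bound S' c C P0 \<alpha>"
        if "\<And>i. i \<in> S' \<Longrightarrow> c i \<in> polyfun (S' - {i}) \<and> (\<exists>x. c i x \<noteq> 0)" for c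
        using less.hyps[OF \<open>card S' < card S\<close> S'(2,4)] that by blast
    qed
    then show ?thesis using S'(1) by auto
  qed
  then obtain C P0 where CP: "\<And>j. j \<in> S \<Longrightarrow> C j \<ge> 0"
    "\<And>j \<alpha>. j \<in> S \<Longrightarrow> (\<forall>s\<in>S. \<alpha> s \<le> \<alpha> j) \<Longrightarrow> sieve_bound S d (C j) (P0 j) \<alpha>"
    by metis
  \<comment> \<open>The 2 keeps the threshold above 1, where \<open>1 / (N * ln N)\<close> is
    nonnegative.\<close>
  let ?C = "\<Sum>j\<in>S. C j" and ?P = "2 + (\<Sum>j\<in>S. \<bar>P0 j\<bar>)"
  have "sieve_bound S d ?C ?P \<alpha>" for \<alpha>
  proof -
    have "Max (\<alpha> ` S) \<in> \<alpha> ` S" using less.prems by (intro Max_in) auto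
    then obtain j where j: "j \<in> S" "\<alpha> j = Max (\<alpha> ` S)" by auto
    have "\<forall>s\<in>S. \<alpha> s \<le> \<alpha> j" using j less.prems by auto
    then show ?thesis
    proof (rule sieve_bound_mono[OF CP(2)[OF j(1)]])
      show "C j \<le> ?C" using CP(1) j less.prems by (intro member_le_sum) auto
      have "\<bar>P0 j\<bar> \<le> (\<Sum>j\<in>S. \<bar>P0 j\<bar>)" using j less.prems by (intro member_le_sum) auto
      then show "P0 j \<le> ?P" by linarith
      have "(\<Sum>j\<in>S. \<bar>P0 j\<bar>) \<ge> 0" by (intro sum_nonneg) auto
      then show "?P > 1" by linarith
    qed
  qed
  moreover have "?C \<ge> 0" using CP(1) by (intro sum_nonneg) auto
  ultimately show ?case by blast
qed

section \<open>Exponents of boxes of bounded height\<close>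

lemma ip_sum_right: "ip n m (\<lambda>j. \<Sum>\<rho>\<in>S. c \<rho> * w \<rho> j) = (\<Sum>\<rho>\<in>S. c \<rho> * ip n m (w \<rho>))"
  unfolding ip_def sum_distrib_left by (subst sum.swap) (simp add: mult_ac)

lemma ip_cong: "(\<And>j. j < n \<Longrightarrow> u j = u' j) \<Longrightarrow> ip n m u = ip n m u'"
  unfolding ip_def by (intro sum.cong) auto

lemma ip_uminus_right: "ip n m (\<lambda>j. - u j) = - ip n m u"
  by (simp add: ip_def sum_negf)

lemma sum_delta_mult:
  fixes f :: "'a \<Rightarrow> int"
  assumes "finite S" "a \<in> S"
  shows "(\<Sum>x\<in>S. (if x = a then 1 else 0) * f x) = f a"
  using assms by (subst sum.remove[of _ a]) (auto intro!: sum.neutral)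

section \<open>Lattice geometry of a complete regular fan\<close>

locale regular_fan =
  fixes n k :: nat and v :: "nat \<Rightarrow> nat \<Rightarrow> int" and \<Sigma> :: "nat set set"
  assumes fan: "complete_regular_fan n k v \<Sigma>"
begin

lemma cone_subset: "\<sigma> \<in> \<Sigma> \<Longrightarrow> \<sigma> \<subseteq> {..<k}"
  and card_cone: "\<sigma> \<in> \<Sigma> \<Longrightarrow> card \<sigma> = n"
  and fan_nonempty: "\<Sigma> \<noteq> {}"
  and ray_in_cone: "\<rho> < k \<Longrightarrow> \<exists>\<sigma>\<in>\<Sigma>. \<rho> \<in> \<sigma>"
  using fan by (auto simp: complete_regular_fan_def)

lemma finite_cone: "\<sigma> \<in> \<Sigma> \<Longrightarrow> finite \<sigma>"
  using cone_subset finite_subset by blast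

lemma finite_fan: "finite \<Sigma>"
  by (rule finite_subset[of _ "Pow {..<k}"]) (use cone_subset in auto)

lemma cone_spans: "\<sigma> \<in> \<Sigma> \<Longrightarrow> \<exists>c. \<forall>j<n. u j = (\<Sum>\<rho>\<in>\<sigma>. c \<rho> * v \<rho> j)"
  using fan by (simp add: complete_regular_fan_def)

lemma cone_indep: "\<sigma> \<in> \<Sigma> \<Longrightarrow> (\<And>j. j < n \<Longrightarrow> (\<Sum>\<rho>\<in>\<sigma>. c \<rho> * v \<rho> j) = 0) \<Longrightarrow> \<rho> \<in> \<sigma> \<Longrightarrow> c \<rho> = 0"
  using fan by (simp add: complete_regular_fan_def)

lemma fan_complete:
  "(\<And>j. j \<ge> n \<Longrightarrow> u j = 0) \<Longrightarrow> \<exists>\<sigma>\<in>\<Sigma>. u \<in> rcone n v \<sigma>"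
  using fan by (simp add: complete_regular_fan_def)

text \<open>Expressing the unit vectors in the basis \<open>\<sigma>\<close> gives a one-sided
  inverse of the matrix of rays; linear independence makes it two-sided, and its columns are the
  dual basis.\<close>

lemma dual_basis_exists:
  assumes \<sigma>: "\<sigma> \<in> \<Sigma>"
  shows "\<exists>w. \<forall>\<rho>\<in>\<sigma>. \<forall>\<rho>'\<in>\<sigma>. ip n (w \<rho>) (v \<rho>') = (if \<rho> = \<rho>' then 1 else 0)"
proof -
  have "\<forall>i. \<exists>c. \<forall>j<n. (if j = i then 1 else 0) = (\<Sum>\<rho>\<in>\<sigma>. c \<rho> * v \<rho> j)"
    by (intro allI cone_spans[OF \<sigma>])
  then obtain C where C: "\<And>i j. j < n \<Longrightarrow> (if j = i then 1 else 0) = (\<Sum>\<rho>\<in>\<sigma>. C i \<rho> * v \<rho> j)"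
    by metis
  have "ip n (\<lambda>j. C j \<rho>) (v \<rho>') = (if \<rho> = \<rho>' then 1 else 0)" if \<rho>: "\<rho> \<in> \<sigma>" "\<rho>' \<in> \<sigma>" for \<rho> \<rho>'
  proof -
    have "ip n (\<lambda>j. C j \<rho>) (v \<rho>') - (if \<rho> = \<rho>' then 1 else 0) = 0"
    proof (rule cone_indep[OF \<sigma> _ \<rho>(1), where c = "\<lambda>\<rho>. ip n (\<lambda>j. C j \<rho>) (v \<rho>') - (if \<rho> = \<rho>' then 1 else 0)"])
      fix j assume j: "j < n"
      have "(\<Sum>\<rho>\<in>\<sigma>. ip n (\<lambda>i. C i \<rho>) (v \<rho>') * v \<rho> j) = (\<Sum>i<n. v \<rho>' i * (\<Sum>\<rho>\<in>\<sigma>. C i \<rho> * v \<rho> j))"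
        unfolding ip_def sum_distrib_left sum_distrib_right by (subst sum.swap) (simp add: mult_ac)
      also have "\<dots> = (\<Sum>i<n. v \<rho>' i * (if j = i then 1 else 0))" using C[OF j] by simp
      also have "\<dots> = v \<rho>' j" using j by (simp add: if_distrib cong: if_cong)
      finally have 1: "(\<Sum>\<rho>\<in>\<sigma>. ip n (\<lambda>i. C i \<rho>) (v \<rho>') * v \<rho> j) = v \<rho>' j" .
      have 2: "(\<Sum>\<rho>\<in>\<sigma>. (if \<rho> = \<rho>' then 1 else 0) * v \<rho> j) = v \<rho>' j"
        by (rule sum_delta_mult[OF finite_cone[OF \<sigma>] \<rho>(2)])
      show "(\<Sum>\<rho>\<in>\<sigma>. (ip n (\<lambda>j. C j \<rho>) (v \<rho>') - (if \<rho> = \<rho>' then 1 else 0)) * v \<rho> j) = 0"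
        unfolding left_diff_distrib sum_subtractf 1 2 by simp
    qed
    then show ?thesis by simp
  qed
  then show ?thesis by (intro exI[of _ "\<lambda>\<rho> j. C j \<rho>"]) auto
qed

text \<open>Completeness gives nonnegative real coefficients, regularity gives integral ones, and
  pairing with the dual basis shows that they coincide.\<close>

lemma integral_cone_decomposition:
  fixes u :: "nat \<Rightarrow> int"
  shows "\<exists>\<sigma>\<in>\<Sigma>. \<exists>c::nat \<Rightarrow> nat. \<forall>j<n. u j = (\<Sum>\<rho>\<in>\<sigma>. int (c \<rho>) * v \<rho> j)"
proof -
  obtain \<sigma> where \<sigma>: "\<sigma> \<in> \<Sigma>" and "(\<lambda>j. if j < n then real_of_int (u j) else 0) \<in> rcone n v \<sigma>"
    using fan_complete[of "\<lambda>j. if j < n then real_of_int (u j) else 0"] by auto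
  then obtain c :: "nat \<Rightarrow> real" where c: "\<And>\<rho>. \<rho> \<in> \<sigma> \<Longrightarrow> c \<rho> \<ge> 0"
    "\<And>j. j < n \<Longrightarrow> real_of_int (u j) = (\<Sum>\<rho>\<in>\<sigma>. c \<rho> * real_of_int (v \<rho> j))"
    unfolding rcone_def by auto
  obtain d where d: "\<And>j. j < n \<Longrightarrow> u j = (\<Sum>\<rho>\<in>\<sigma>. d \<rho> * v \<rho> j)"
    using cone_spans[OF \<sigma>, of u] by blast
  obtain w where w: "\<And>\<rho> \<rho>'. \<rho> \<in> \<sigma> \<Longrightarrow> \<rho>' \<in> \<sigma> \<Longrightarrow> ip n (w \<rho>) (v \<rho>') = (if \<rho> = \<rho>' then 1 else 0)"
    using dual_basis_exists[OF \<sigma>] by blast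
  have "d \<rho> \<ge> 0" if \<rho>: "\<rho> \<in> \<sigma>" for \<rho>
  proof -
    have "ip n (w \<rho>) u = (\<Sum>\<rho>'\<in>\<sigma>. d \<rho>' * ip n (w \<rho>) (v \<rho>'))"
      by (subst ip_sum_right[symmetric]) (intro ip_cong d)
    also have "\<dots> = (\<Sum>\<rho>'\<in>\<sigma>. d \<rho>' * (if \<rho> = \<rho>' then 1 else 0))"
      using w[OF \<rho>] by simp
    also have "\<dots> = d \<rho>" using \<rho> finite_cone[OF \<sigma>] by (simp add: if_distrib cong: if_cong)
    finally have 1: "ip n (w \<rho>) u = d \<rho>" .
    have "real_of_int (ip n (w \<rho>) u) = (\<Sum>j<n. real_of_int (w \<rho> j) * (\<Sum>\<rho>'\<in>\<sigma>. c \<rho>' * real_of_int (v \<rho>' j)))"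
      unfolding ip_def of_int_sum of_int_mult by (intro sum.cong) (auto simp: c(2))
    also have "\<dots> = (\<Sum>\<rho>'\<in>\<sigma>. c \<rho>' * real_of_int (ip n (w \<rho>) (v \<rho>')))"
      unfolding ip_def sum_distrib_left of_int_sum of_int_mult by (subst sum.swap) (simp add: mult_ac)
    also have "\<dots> = (\<Sum>\<rho>'\<in>\<sigma>. c \<rho>' * (if \<rho> = \<rho>' then 1 else 0))"
      by (intro sum.cong) (auto simp: w[OF \<rho>])
    also have "\<dots> = c \<rho>" using \<rho> finite_cone[OF \<sigma>] by (simp add: if_distrib cong: if_cong)
    finally have "real_of_int (d \<rho>) = c \<rho>" using 1 by simp
    with c(1)[OF \<rho>] show ?thesis by linarith
  qed
  then have "\<forall>j<n. u j = (\<Sum>\<rho>\<in>\<sigma>. int (nat (d \<rho>)) * v \<rho> j)" using d by simp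
  with \<sigma> show ?thesis by (intro bexI[of _ \<sigma>] exI[of _ "\<lambda>\<rho>. nat (d \<rho>)"]) auto
qed

text \<open>Take a cone containing \<open>- v \<rho>\<close>. If \<open>\<rho>\<close> belonged to
  it, 0 would be a combination of its rays with a positive coefficient at
  \<open>\<rho>\<close>.\<close>

lemma cone_avoiding_ray:
  assumes "\<rho> < k"
  shows "\<exists>\<sigma>\<in>\<Sigma>. \<rho> \<notin> \<sigma>"
proof -
  obtain \<sigma> and c :: "nat \<Rightarrow> nat" where \<sigma>: "\<sigma> \<in> \<Sigma>" and c: "\<And>j. j < n \<Longrightarrow> - v \<rho> j = (\<Sum>\<rho>\<in>\<sigma>. int (c \<rho>) * v \<rho> j)"
    using integral_cone_decomposition[of "\<lambda>j. - v \<rho> j"] by blast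
  have "\<rho> \<notin> \<sigma>"
  proof
    assume \<rho>: "\<rho> \<in> \<sigma>"
    have "int (c \<rho>) + (if \<rho> = \<rho> then 1 else 0) = 0"
    proof (rule cone_indep[OF \<sigma> _ \<rho>, where c = "\<lambda>\<rho>'. int (c \<rho>') + (if \<rho>' = \<rho> then 1 else 0)"])
      fix j assume "j < n"
      then show "(\<Sum>\<rho>'\<in>\<sigma>. (int (c \<rho>') + (if \<rho>' = \<rho> then 1 else 0)) * v \<rho>' j) = 0"
        using sum_delta_mult[OF finite_cone[OF \<sigma>] \<rho>, of "\<lambda>\<rho>. v \<rho> j"] c[of j]
        by (simp only: distrib_right sum.distrib) simp
    qed
    then show False by simp
  qed
  with \<sigma> show ?thesis by blast
qed

end

section \<open>The polytope of box exponents\<close>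

locale gg_fan = regular_fan +
  assumes gg: "anticanonical_gg n k v \<Sigma>"
begin

text \<open>The vertex of the anticanonical polytope that belongs to
  \<open>\<sigma>\<close>.\<close>

definition vertex :: "nat set \<Rightarrow> nat \<Rightarrow> int" where
  "vertex \<sigma> = (SOME m. (\<forall>\<rho>\<in>\<sigma>. ip n m (v \<rho>) = -1) \<and> (\<forall>\<rho><k. ip n m (v \<rho>) \<ge> -1))"

lemma vertex:
  assumes "\<sigma> \<in> \<Sigma>"
  shows "\<rho> \<in> \<sigma> \<Longrightarrow> ip n (vertex \<sigma>) (v \<rho>) = -1" "\<rho> < k \<Longrightarrow> ip n (vertex \<sigma>) (v \<rho>) \<ge> -1"
proof -
  have "\<exists>m. (\<forall>\<rho>\<in>\<sigma>. ip n m (v \<rho>) = -1) \<and> (\<forall>\<rho><k. ip n m (v \<rho>) \<ge> -1)"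
    using gg assms unfolding anticanonical_gg_def by blast
  from someI_ex[OF this] show "\<rho> \<in> \<sigma> \<Longrightarrow> ip n (vertex \<sigma>) (v \<rho>) = -1" "\<rho> < k \<Longrightarrow> ip n (vertex \<sigma>) (v \<rho>) \<ge> -1"
    unfolding vertex_def by auto
qed

text \<open>The exponents of the Cox monomial of the anticanonical section attached to this vertex.
  It involves no ray of \<open>\<sigma>\<close>, so it has no zeros on the chart of
  \<open>\<sigma>\<close>.\<close>

definition expo :: "nat set \<Rightarrow> nat \<Rightarrow> nat" where
  "expo \<sigma> \<rho> = nat (ip n (vertex \<sigma>) (v \<rho>) + 1)"

lemma int_expo: "\<sigma> \<in> \<Sigma> \<Longrightarrow> \<rho> < k \<Longrightarrow> int (expo \<sigma> \<rho>) = ip n (vertex \<sigma>) (v \<rho>) + 1"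
  using vertex(2)[of \<sigma> \<rho>] by (simp add: expo_def)

lemma expo_cone: "\<sigma> \<in> \<Sigma> \<Longrightarrow> \<rho> \<in> \<sigma> \<Longrightarrow> expo \<sigma> \<rho> = 0"
  using vertex(1)[of \<sigma> \<rho>] by (simp add: expo_def)

text \<open>Otherwise the vertex pairs to -1 with every ray, hence nonpositively with every lattice
  vector, among them the negative of a ray.\<close>

lemma expo_pos_exists:
  assumes "n \<ge> 1" "\<sigma> \<in> \<Sigma>"
  shows "\<exists>\<rho><k. expo \<sigma> \<rho> \<ge> 1"
proof (rule ccontr)
  assume "\<not> ?thesis"
  then have "expo \<sigma> \<rho> = 0" if "\<rho> < k" for \<rho> using that by auto
  with int_expo[OF assms(2)] have e: "ip n (vertex \<sigma>) (v \<rho>) = -1" if "\<rho> < k" for \<rho> using that by force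
  have "\<sigma> \<noteq> {}" using card_cone[OF assms(2)] assms(1) by auto
  then obtain \<rho>1 where \<rho>1: "\<rho>1 \<in> \<sigma>" by blast
  obtain \<tau> and c :: "nat \<Rightarrow> nat" where \<tau>: "\<tau> \<in> \<Sigma>" and c: "\<And>j. j < n \<Longrightarrow> - v \<rho>1 j = (\<Sum>\<rho>\<in>\<tau>. int (c \<rho>) * v \<rho> j)"
    using integral_cone_decomposition[of "\<lambda>j. - v \<rho>1 j"] by blast
  have "- ip n (vertex \<sigma>) (v \<rho>1) = ip n (vertex \<sigma>) (\<lambda>j. - v \<rho>1 j)" by (simp add: ip_uminus_right)
  also have "\<dots> = (\<Sum>\<rho>\<in>\<tau>. int (c \<rho>) * ip n (vertex \<sigma>) (v \<rho>))"
    by (subst ip_sum_right[symmetric]) (intro ip_cong c)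
  also have "\<dots> = - (\<Sum>\<rho>\<in>\<tau>. int (c \<rho>))"
    unfolding sum_negf[symmetric] using e cone_subset[OF \<tau>] by (intro sum.cong) auto
  also have "\<dots> \<le> 0" by (simp add: sum_nonneg)
  finally show False using e \<rho>1 cone_subset[OF assms(2)] by auto
qed

text \<open>The height condition in base 2 logarithms, imposed for the trivial character (first
  inequality) and for the vertices only.\<close>

definition exponents :: "nat \<Rightarrow> (nat \<Rightarrow> nat) set" where
  "exponents L = {\<alpha> \<in> {..<k} \<rightarrow>\<^sub>E UNIV. (\<Sum>\<rho><k. \<alpha> \<rho>) \<le> L \<and> (\<forall>\<sigma>\<in>\<Sigma>. (\<Sum>\<rho><k. expo \<sigma> \<rho> * \<alpha> \<rho>) \<le> L)}"

text \<open>The map from exponent vectors to \<open>N\<close>. By \<open>expo_sum\<close>, pairing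
  it with a vertex measures how far that vertex monomial differs from the product of all
  coordinates.\<close>

definition weight :: "(nat \<Rightarrow> nat) \<Rightarrow> nat \<Rightarrow> int" where
  "weight \<alpha> j = (\<Sum>\<rho><k. int (\<alpha> \<rho>) * v \<rho> j)"

lemma exponents_le: "\<alpha> \<in> exponents L \<Longrightarrow> \<rho> < k \<Longrightarrow> \<alpha> \<rho> \<le> L"
proof -
  assume "\<alpha> \<in> exponents L" "\<rho> < k"
  then have "(\<Sum>\<rho><k. \<alpha> \<rho>) \<le> L" by (simp add: exponents_def)
  moreover have "\<alpha> \<rho> \<le> (\<Sum>\<rho><k. \<alpha> \<rho>)" using \<open>\<rho> < k\<close> by (intro member_le_sum) auto
  ultimately show ?thesis by linarith
qed

lemma exponents_subset: "exponents L \<subseteq> {..<k} \<rightarrow>\<^sub>E {..L}"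
  using exponents_le[of _ L] by (force simp: exponents_def PiE_iff)

lemma finite_exponents: "finite (exponents L)"
  by (rule finite_subset[OF exponents_subset]) (intro finite_PiE, auto)

lemma expo_sum:
  assumes "\<sigma> \<in> \<Sigma>"
  shows "int (\<Sum>\<rho><k. expo \<sigma> \<rho> * \<alpha> \<rho>) = ip n (vertex \<sigma>) (weight \<alpha>) + int (\<Sum>\<rho><k. \<alpha> \<rho>)"
proof -
  have "int (\<Sum>\<rho><k. expo \<sigma> \<rho> * \<alpha> \<rho>) = (\<Sum>\<rho><k. (ip n (vertex \<sigma>) (v \<rho>) + 1) * int (\<alpha> \<rho>))"
    unfolding of_nat_sum of_nat_mult by (intro sum.cong) (auto simp: int_expo[OF assms])
  also have "\<dots> = (\<Sum>\<rho><k. int (\<alpha> \<rho>) * ip n (vertex \<sigma>) (v \<rho>)) + int (\<Sum>\<rho><k. \<alpha> \<rho>)"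
    by (simp add: distrib_right distrib_left sum.distrib mult.commute)
  also have "(\<Sum>\<rho><k. int (\<alpha> \<rho>) * ip n (vertex \<sigma>) (v \<rho>)) = ip n (vertex \<sigma>) (weight \<alpha>)"
    unfolding weight_def by (rule ip_sum_right[symmetric])
  finally show ?thesis .
qed

text \<open>On a cone \<open>\<sigma>\<close> containing minus the weight, the pairing of its vertex
  with the weight is exactly the sum of the \<open>c \<rho>\<close>. The height condition at this
  vertex therefore leaves that much slack below \<open>L\<close>; the slack vanishes only for weight
  0.\<close>

lemma exponents_decomposition:
  assumes "\<alpha> \<in> exponents L"
  shows "\<exists>\<sigma>\<in>\<Sigma>. \<exists>c\<in>\<sigma> \<rightarrow>\<^sub>E UNIV. (\<forall>j<n. weight \<alpha> j = - (\<Sum>\<rho>\<in>\<sigma>. int (c \<rho>) * v \<rho> j)) \<and>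
    (\<Sum>\<rho><k. \<alpha> \<rho>) + (\<Sum>\<rho>\<in>\<sigma>. c \<rho>) \<le> L"
proof -
  obtain \<sigma> and c :: "nat \<Rightarrow> nat" where \<sigma>: "\<sigma> \<in> \<Sigma>" and c: "\<And>j. j < n \<Longrightarrow> - weight \<alpha> j = (\<Sum>\<rho>\<in>\<sigma>. int (c \<rho>) * v \<rho> j)"
    using integral_cone_decomposition[of "\<lambda>j. - weight \<alpha> j"] by blast
  have "- ip n (vertex \<sigma>) (weight \<alpha>) = ip n (vertex \<sigma>) (\<lambda>j. - weight \<alpha> j)" by (simp add: ip_uminus_right)
  also have "\<dots> = (\<Sum>\<rho>\<in>\<sigma>. int (c \<rho>) * ip n (vertex \<sigma>) (v \<rho>))"
    by (subst ip_sum_right[symmetric]) (intro ip_cong c)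
  also have "\<dots> = - int (\<Sum>\<rho>\<in>\<sigma>. c \<rho>)"
    unfolding of_nat_sum sum_negf[symmetric] using vertex(1)[OF \<sigma>] by (intro sum.cong) auto
  finally have "ip n (vertex \<sigma>) (weight \<alpha>) = int (\<Sum>\<rho>\<in>\<sigma>. c \<rho>)" by simp
  with expo_sum[OF \<sigma>, of \<alpha>] have "(\<Sum>\<rho><k. expo \<sigma> \<rho> * \<alpha> \<rho>) = (\<Sum>\<rho><k. \<alpha> \<rho>) + (\<Sum>\<rho>\<in>\<sigma>. c \<rho>)" by linarith
  moreover have "(\<Sum>\<rho><k. expo \<sigma> \<rho> * \<alpha> \<rho>) \<le> L" using assms \<sigma> by (simp add: exponents_def)
  ultimately have "(\<Sum>\<rho><k. \<alpha> \<rho>) + (\<Sum>\<rho>\<in>\<sigma>. restrict c \<sigma> \<rho>) \<le> L" by simp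
  moreover have "weight \<alpha> j = - (\<Sum>\<rho>\<in>\<sigma>. int (restrict c \<sigma> \<rho>) * v \<rho> j)" if "j < n" for j
    using c[OF that] by (simp cong: sum.cong)
  ultimately show ?thesis using \<sigma> by (intro bexI[of _ \<sigma>] bexI[of _ "restrict c \<sigma>"]) auto
qed

text \<open>Weight and total determine the vertex condition of \<open>\<sigma>\<close>, in which
  \<open>\<rho>0\<close> is the only unknown; then the coordinates in \<open>\<sigma>\<close> follow
  from linear independence. Thus only \<open>k - n - 1\<close> coordinates remain free.\<close>

lemma exponents_determined:
  assumes \<sigma>: "\<sigma> \<in> \<Sigma>" and \<rho>0: "\<rho>0 < k" "expo \<sigma> \<rho>0 \<ge> 1"
    and w: "\<And>j. j < n \<Longrightarrow> weight \<alpha> j = weight \<beta> j"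
    and s: "(\<Sum>\<rho><k. \<alpha> \<rho>) = (\<Sum>\<rho><k. \<beta> \<rho>)"
    and K: "\<And>\<rho>. \<rho> \<in> {..<k} - insert \<rho>0 \<sigma> \<Longrightarrow> \<alpha> \<rho> = \<beta> \<rho>"
    and \<rho>: "\<rho> < k"
  shows "\<alpha> \<rho> = \<beta> \<rho>"
proof -
  have n\<sigma>: "\<rho>0 \<notin> \<sigma>" using expo_cone[OF \<sigma>] \<rho>0 by fastforce
  have "ip n (vertex \<sigma>) (weight \<alpha>) = ip n (vertex \<sigma>) (weight \<beta>)" by (intro ip_cong w)
  with expo_sum[OF \<sigma>, of \<alpha>] expo_sum[OF \<sigma>, of \<beta>] s
  have e: "(\<Sum>\<rho><k. expo \<sigma> \<rho> * \<alpha> \<rho>) = (\<Sum>\<rho><k. expo \<sigma> \<rho> * \<beta> \<rho>)" by linarith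
  have split: "(\<Sum>\<rho><k. f \<rho>) = f \<rho>0 + (\<Sum>\<rho>\<in>{..<k} - {\<rho>0}. f \<rho>)" for f :: "nat \<Rightarrow> nat"
    using \<rho>0(1) by (intro sum.remove) auto
  have "(\<Sum>\<rho>\<in>{..<k} - {\<rho>0}. expo \<sigma> \<rho> * \<alpha> \<rho>) = (\<Sum>\<rho>\<in>{..<k} - {\<rho>0}. expo \<sigma> \<rho> * \<beta> \<rho>)"
  proof (rule sum.cong[OF refl])
    fix \<rho> assume "\<rho> \<in> {..<k} - {\<rho>0}"
    then show "expo \<sigma> \<rho> * \<alpha> \<rho> = expo \<sigma> \<rho> * \<beta> \<rho>"
      using expo_cone[OF \<sigma>, of \<rho>] K[of \<rho>] by (cases "\<rho> \<in> \<sigma>") auto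
  qed
  with e have "expo \<sigma> \<rho>0 * \<alpha> \<rho>0 = expo \<sigma> \<rho>0 * \<beta> \<rho>0" unfolding split by linarith
  with \<rho>0 have \<alpha>0: "\<alpha> \<rho>0 = \<beta> \<rho>0" by simp
  have out: "\<alpha> \<rho> = \<beta> \<rho>" if "\<rho> < k" "\<rho> \<notin> \<sigma>" for \<rho>
    using K[of \<rho>] \<alpha>0 that by (cases "\<rho> = \<rho>0") auto
  show ?thesis
  proof (cases "\<rho> \<in> \<sigma>")
    case True
    have "int (\<alpha> \<rho>) - int (\<beta> \<rho>) = 0"
    proof (rule cone_indep[OF \<sigma> _ True, where c = "\<lambda>\<rho>. int (\<alpha> \<rho>) - int (\<beta> \<rho>)"])
      fix j assume "j < n"
      have "(\<Sum>\<rho>\<in>\<sigma>. (int (\<alpha> \<rho>) - int (\<beta> \<rho>)) * v \<rho> j) = (\<Sum>\<rho><k. (int (\<alpha> \<rho>) - int (\<beta> \<rho>)) * v \<rho> j)"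
        using cone_subset[OF \<sigma>] out by (intro sum.mono_neutral_left) auto
      also have "\<dots> = weight \<alpha> j - weight \<beta> j" by (simp add: weight_def left_diff_distrib sum_subtractf)
      finally show "(\<Sum>\<rho>\<in>\<sigma>. (int (\<alpha> \<rho>) - int (\<beta> \<rho>)) * v \<rho> j) = 0" using w[OF \<open>j < n\<close>] by simp
    qed
    then show ?thesis by simp
  qed (use out \<rho> in auto)
qed

end

lemma sum_half_powers_le: "(\<Sum>a\<le>L. (1 / 2::real) ^ a) \<le> 2"
proof -
  have "(\<Sum>a\<le>L. (1 / 2::real) ^ a) = 2 - (1 / 2) ^ L" by (induction L) auto
  then show ?thesis by simp
qed

lemma sum_two_powers_le: "(\<Sum>s | s + c \<le> L. (2::real) ^ s) \<le> 2 * 2 ^ L * (1 / 2) ^ c"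
proof (cases "c \<le> L")
  case True
  then have "{s. s + c \<le> L} = {..L - c}" by auto
  moreover have "(\<Sum>s\<le>M. (2::real) ^ s) \<le> 2 * 2 ^ M" for M by (induction M) auto
  ultimately have "(\<Sum>s | s + c \<le> L. (2::real) ^ s) \<le> 2 * 2 ^ (L - c)" by simp
  also have "\<dots> = 2 * 2 ^ L * (1 / 2) ^ c" using True by (simp add: power_diff power_divide)
  finally show ?thesis .
next
  case False
  then have "{s. s + c \<le> L} = {}" by auto
  then show ?thesis by (simp only: sum.empty) simp
qed

context gg_fan
begin

text \<open>Encode \<open>\<alpha>\<close> injectively by cone, coefficients \<open>c\<close>, total
  \<open>s\<close> and the restriction to \<open>K\<close>. Summing \<open>2 ^ s\<close> over
  \<open>s \<le> L - \<Sum>c\<close> gives \<open>2 ^ L\<close> with geometric decay in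
  \<open>c\<close>; each free coordinate gives \<open>L + 1\<close>, or only 2 if it lies in
  \<open>Q\<close>.\<close>

lemma exponents_sum_le:
  assumes \<sigma>1: "\<sigma>1 \<in> \<Sigma>" and \<rho>0: "\<rho>0 < k" "expo \<sigma>1 \<rho>0 \<ge> 1"
    and K: "K = {..<k} - insert \<rho>0 \<sigma>1" and Q: "Q \<subseteq> K"
  shows "(\<Sum>\<alpha>\<in>exponents L. 2 ^ (\<Sum>\<rho><k. \<alpha> \<rho>) * (\<Prod>\<rho>\<in>Q. (1 / 2::real) ^ \<alpha> \<rho>))
     \<le> (real (card \<Sigma>) * 2 * 2 ^ n * 2 ^ card Q) * 2 ^ L * (real L + 1) ^ card (K - Q)"
proof -
  have finK: "finite K" "finite Q" using K Q finite_subset by auto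
  define P where "P = (\<lambda>\<alpha> \<sigma> c. \<sigma> \<in> \<Sigma> \<and> c \<in> \<sigma> \<rightarrow>\<^sub>E UNIV \<and> (\<forall>j<n. weight \<alpha> j = - (\<Sum>\<rho>\<in>\<sigma>. int (c \<rho>) * v \<rho> j)) \<and>
    (\<Sum>\<rho><k. \<alpha> \<rho>) + (\<Sum>\<rho>\<in>\<sigma>. c \<rho>) \<le> L)"
  have "\<forall>\<alpha>\<in>exponents L. \<exists>\<sigma> c. P \<alpha> \<sigma> c"
    using exponents_decomposition unfolding P_def by blast
  then obtain fs fc where P: "\<And>\<alpha>. \<alpha> \<in> exponents L \<Longrightarrow> P \<alpha> (fs \<alpha>) (fc \<alpha>)"
    by metis
  have f:
    "\<And>\<alpha>. \<alpha> \<in> exponents L \<Longrightarrow> fs \<alpha> \<in> \<Sigma>"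
    "\<And>\<alpha>. \<alpha> \<in> exponents L \<Longrightarrow> fc \<alpha> \<in> fs \<alpha> \<rightarrow>\<^sub>E UNIV"
    "\<And>\<alpha> j. \<alpha> \<in> exponents L \<Longrightarrow> j < n \<Longrightarrow> weight \<alpha> j = - (\<Sum>\<rho>\<in>fs \<alpha>. int (fc \<alpha> \<rho>) * v \<rho> j)"
    "\<And>\<alpha>. \<alpha> \<in> exponents L \<Longrightarrow> (\<Sum>\<rho><k. \<alpha> \<rho>) + (\<Sum>\<rho>\<in>fs \<alpha>. fc \<alpha> \<rho>) \<le> L"
    using P by (auto simp: P_def)
  define h where "h = (\<lambda>\<alpha>. (fs \<alpha>, fc \<alpha>, (\<Sum>\<rho><k. \<alpha> \<rho>), restrict \<alpha> K))"
  define W where "W = (\<lambda>\<beta>::nat \<Rightarrow> nat. \<Prod>\<rho>\<in>K. if \<rho> \<in> Q then (1 / 2::real) ^ \<beta> \<rho> else 1)"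
  \<comment> \<open>Larger than the image of \<open>h\<close>: dropping the relations between
    \<open>c\<close>, \<open>s\<close> and the restriction makes the sum factorise.\<close>
  define Y where "Y = (SIGMA \<sigma>:\<Sigma>. SIGMA c:\<sigma> \<rightarrow>\<^sub>E {..L}. SIGMA s:{s. s + (\<Sum>\<rho>\<in>\<sigma>. c \<rho>) \<le> L}. K \<rightarrow>\<^sub>E {..L})"
  have fins: "finite {s. s + c \<le> L}" for c by (rule finite_subset[of _ "{..L}"]) auto
  have finc: "finite (\<sigma> \<rightarrow>\<^sub>E {..L})" if "\<sigma> \<in> \<Sigma>" for \<sigma> using finite_cone[OF that] by (intro finite_PiE) auto
  have finb: "finite (K \<rightarrow>\<^sub>E {..L})" using finK by (intro finite_PiE) auto
  have finY: "finite Y" unfolding Y_def using finite_fan finc fins finb by (intro finite_SigmaI) auto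
  have inj: "inj_on h (exponents L)"
  proof (rule inj_onI)
    fix \<alpha> \<beta> assume \<alpha>: "\<alpha> \<in> exponents L" and \<beta>: "\<beta> \<in> exponents L" and e: "h \<alpha> = h \<beta>"
    have "\<alpha> \<rho> = \<beta> \<rho>" if "\<rho> < k" for \<rho>
    proof (rule exponents_determined[OF \<sigma>1 \<rho>0 _ _ _ that])
      show "weight \<alpha> j = weight \<beta> j" if "j < n" for j using f(3)[OF \<alpha> that] f(3)[OF \<beta> that] e by (simp add: h_def)
      show "(\<Sum>\<rho><k. \<alpha> \<rho>) = (\<Sum>\<rho><k. \<beta> \<rho>)" using e by (simp add: h_def)
      have r: "restrict \<alpha> K = restrict \<beta> K" using e by (simp add: h_def)
      show "\<alpha> \<rho> = \<beta> \<rho>" if "\<rho> \<in> {..<k} - insert \<rho>0 \<sigma>1" for \<rho>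
        using fun_cong[OF r, of \<rho>] that K by simp
    qed
    moreover have "\<alpha> \<in> extensional {..<k}" "\<beta> \<in> extensional {..<k}" using \<alpha> \<beta> by (auto simp: exponents_def PiE_def)
    ultimately show "\<alpha> = \<beta>" by (intro extensionalityI[of \<alpha> "{..<k}" \<beta>]) auto
  qed
  have sub: "h ` exponents L \<subseteq> Y"
  proof
    fix y assume "y \<in> h ` exponents L"
    then obtain \<alpha> where \<alpha>: "\<alpha> \<in> exponents L" "y = h \<alpha>" by blast
    have "fc \<alpha> \<rho> \<le> L" if "\<rho> \<in> fs \<alpha>" for \<rho>
    proof -
      have "fc \<alpha> \<rho> \<le> (\<Sum>\<rho>\<in>fs \<alpha>. fc \<alpha> \<rho>)"
        using that finite_cone[OF f(1)[OF \<alpha>(1)]] by (intro member_le_sum) auto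
      with f(4)[OF \<alpha>(1)] show ?thesis by linarith
    qed
    moreover have "restrict \<alpha> K \<in> K \<rightarrow>\<^sub>E {..L}" using exponents_le[OF \<alpha>(1)] K by auto
    ultimately show "y \<in> Y" using f(1,2,4)[OF \<alpha>(1)] \<alpha>(2) by (auto simp: Y_def h_def PiE_iff)
  qed
  have "(\<Sum>\<alpha>\<in>exponents L. 2 ^ (\<Sum>\<rho><k. \<alpha> \<rho>) * (\<Prod>\<rho>\<in>Q. (1 / 2::real) ^ \<alpha> \<rho>))
      = (\<Sum>\<alpha>\<in>exponents L. (\<lambda>(\<sigma>, c, s, \<beta>). 2 ^ s * W \<beta>) (h \<alpha>))"
  proof (rule sum.cong[OF refl])
    fix \<alpha>
    have "W (restrict \<alpha> K) = (\<Prod>\<rho>\<in>K. if \<rho> \<in> Q then (1 / 2) ^ \<alpha> \<rho> else 1)"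
      unfolding W_def by (intro prod.cong) auto
    also have "\<dots> = (\<Prod>\<rho>\<in>Q. (1 / 2) ^ \<alpha> \<rho>)"
    proof (subst prod.inter_filter[OF finK(1), symmetric])
      show "(\<Prod>\<rho>\<in>{\<rho> \<in> K. \<rho> \<in> Q}. (1 / 2) ^ \<alpha> \<rho>) = (\<Prod>\<rho>\<in>Q. (1 / 2::real) ^ \<alpha> \<rho>)"
        by (rule arg_cong[where f = "prod _"]) (use Q in blast)
    qed
    finally show "2 ^ (\<Sum>\<rho><k. \<alpha> \<rho>) * (\<Prod>\<rho>\<in>Q. (1 / 2::real) ^ \<alpha> \<rho>) = (\<lambda>(\<sigma>, c, s, \<beta>). 2 ^ s * W \<beta>) (h \<alpha>)"
      by (simp add: h_def)
  qed
  also have "\<dots> = (\<Sum>y\<in>h ` exponents L. (\<lambda>(\<sigma>, c, s, \<beta>). 2 ^ s * W \<beta>) y)"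
    using inj by (simp add: sum.reindex)
  also have "\<dots> \<le> (\<Sum>y\<in>Y. (\<lambda>(\<sigma>, c, s, \<beta>). 2 ^ s * W \<beta>) y)"
    using finY sub by (intro sum_mono2) (auto simp: W_def intro!: prod_nonneg mult_nonneg_nonneg)
  also have "\<dots> = (\<Sum>\<sigma>\<in>\<Sigma>. \<Sum>c\<in>\<sigma> \<rightarrow>\<^sub>E {..L}. \<Sum>s | s + (\<Sum>\<rho>\<in>\<sigma>. c \<rho>) \<le> L. \<Sum>\<beta>\<in>K \<rightarrow>\<^sub>E {..L}. 2 ^ s * W \<beta>)"
  proof -
    have 1: "(\<Sum>s | s + C \<le> L. \<Sum>\<beta>\<in>K \<rightarrow>\<^sub>E {..L}. 2 ^ s * W \<beta>) = (\<Sum>(s, \<beta>)\<in>{s. s + C \<le> L} \<times> (K \<rightarrow>\<^sub>E {..L}). 2 ^ s * W \<beta>)" for C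
      using fins finb by (intro sum.Sigma) auto
    have 2: "(\<Sum>c\<in>\<sigma> \<rightarrow>\<^sub>E {..L}. \<Sum>(s, \<beta>)\<in>{s. s + (\<Sum>\<rho>\<in>\<sigma>. c \<rho>) \<le> L} \<times> (K \<rightarrow>\<^sub>E {..L}). 2 ^ s * W \<beta>)
      = (\<Sum>(c, s, \<beta>)\<in>(SIGMA c:\<sigma> \<rightarrow>\<^sub>E {..L}. {s. s + (\<Sum>\<rho>\<in>\<sigma>. c \<rho>) \<le> L} \<times> (K \<rightarrow>\<^sub>E {..L})). 2 ^ s * W \<beta>)" if "\<sigma> \<in> \<Sigma>" for \<sigma>
      using fins finb finc[OF that] by (subst sum.Sigma) auto
    have 3: "(\<Sum>\<sigma>\<in>\<Sigma>. \<Sum>(c, s, \<beta>)\<in>(SIGMA c:\<sigma> \<rightarrow>\<^sub>E {..L}. {s. s + (\<Sum>\<rho>\<in>\<sigma>. c \<rho>) \<le> L} \<times> (K \<rightarrow>\<^sub>E {..L})). 2 ^ s * W \<beta>)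
      = (\<Sum>(\<sigma>, c, s, \<beta>)\<in>Y. 2 ^ s * W \<beta>)"
      unfolding Y_def using fins finb finc finite_fan by (subst sum.Sigma) auto
    show ?thesis unfolding 3[symmetric] 1 by (intro sum.cong refl 2[symmetric])
  qed
  also have "\<dots> \<le> (\<Sum>\<sigma>\<in>\<Sigma>. 2 * 2 ^ L * 2 ^ n * (2 ^ card Q * (real L + 1) ^ card (K - Q)))"
  proof (rule sum_mono)
    fix \<sigma> assume \<sigma>: "\<sigma> \<in> \<Sigma>"
    have "(\<Sum>\<beta>\<in>K \<rightarrow>\<^sub>E {..L}. W \<beta>) = (\<Prod>\<rho>\<in>K. \<Sum>a\<le>L. if \<rho> \<in> Q then (1 / 2::real) ^ a else 1)"
      unfolding W_def using finK by (intro prod_sum_PiE[symmetric]) auto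
    also have "\<dots> \<le> (\<Prod>\<rho>\<in>K. if \<rho> \<in> Q then 2 else real L + 1)"
      using sum_half_powers_le[of L] by (intro prod_mono) (auto intro!: sum_nonneg)
    also have "\<dots> = (\<Prod>\<rho>\<in>Q. 2) * (\<Prod>\<rho>\<in>K - Q. real L + 1)"
      using finK Q by (subst prod.If_cases) (auto simp: Int_absorb1 Diff_eq)
    also have "\<dots> = 2 ^ card Q * (real L + 1) ^ card (K - Q)" by simp
    finally have W: "(\<Sum>\<beta>\<in>K \<rightarrow>\<^sub>E {..L}. W \<beta>) \<le> 2 ^ card Q * (real L + 1) ^ card (K - Q)" .
    have W0: "(\<Sum>\<beta>\<in>K \<rightarrow>\<^sub>E {..L}. W \<beta>) \<ge> 0" by (auto simp: W_def intro!: sum_nonneg prod_nonneg)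
    have "(\<Sum>c\<in>\<sigma> \<rightarrow>\<^sub>E {..L}. (1 / 2::real) ^ (\<Sum>\<rho>\<in>\<sigma>. c \<rho>)) = (\<Prod>\<rho>\<in>\<sigma>. \<Sum>a\<le>L. (1 / 2) ^ a)"
      unfolding power_sum using finite_cone[OF \<sigma>] by (intro prod_sum_PiE[symmetric]) auto
    also have "\<dots> \<le> (\<Prod>\<rho>\<in>\<sigma>. 2)"
      using sum_half_powers_le[of L] by (intro prod_mono) (auto intro!: sum_nonneg)
    also have "\<dots> = 2 ^ n" using card_cone[OF \<sigma>] by simp
    finally have c: "(\<Sum>c\<in>\<sigma> \<rightarrow>\<^sub>E {..L}. (1 / 2::real) ^ (\<Sum>\<rho>\<in>\<sigma>. c \<rho>)) \<le> 2 ^ n" .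
    have "(\<Sum>c\<in>\<sigma> \<rightarrow>\<^sub>E {..L}. \<Sum>s | s + (\<Sum>\<rho>\<in>\<sigma>. c \<rho>) \<le> L. \<Sum>\<beta>\<in>K \<rightarrow>\<^sub>E {..L}. 2 ^ s * W \<beta>)
       = (\<Sum>c\<in>\<sigma> \<rightarrow>\<^sub>E {..L}. (\<Sum>s | s + (\<Sum>\<rho>\<in>\<sigma>. c \<rho>) \<le> L. 2 ^ s) * (\<Sum>\<beta>\<in>K \<rightarrow>\<^sub>E {..L}. W \<beta>))"
      by (simp only: sum_product)
    also have "\<dots> \<le> (\<Sum>c\<in>\<sigma> \<rightarrow>\<^sub>E {..L}. (2 * 2 ^ L * (1 / 2) ^ (\<Sum>\<rho>\<in>\<sigma>. c \<rho>)) * (2 ^ card Q * (real L + 1) ^ card (K - Q)))"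
      using W W0 by (intro sum_mono mult_mono sum_two_powers_le) auto
    also have "\<dots> = 2 * 2 ^ L * (\<Sum>c\<in>\<sigma> \<rightarrow>\<^sub>E {..L}. (1 / 2::real) ^ (\<Sum>\<rho>\<in>\<sigma>. c \<rho>)) * (2 ^ card Q * (real L + 1) ^ card (K - Q))"
      by (simp only: sum_distrib_left sum_distrib_right)
    also have "\<dots> \<le> 2 * 2 ^ L * 2 ^ n * (2 ^ card Q * (real L + 1) ^ card (K - Q))"
      by (intro mult_right_mono mult_left_mono c) auto
    finally show "(\<Sum>c\<in>\<sigma> \<rightarrow>\<^sub>E {..L}. \<Sum>s | s + (\<Sum>\<rho>\<in>\<sigma>. c \<rho>) \<le> L. \<Sum>\<beta>\<in>K \<rightarrow>\<^sub>E {..L}. 2 ^ s * W \<beta>)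
       \<le> 2 * 2 ^ L * 2 ^ n * (2 ^ card Q * (real L + 1) ^ card (K - Q))" .
  qed
  also have "\<dots> = (real (card \<Sigma>) * 2 * 2 ^ n * 2 ^ card Q) * 2 ^ L * (real L + 1) ^ card (K - Q)" by simp
  finally show ?thesis .
qed

text \<open>The case of empty \<open>Q\<close>. The number of free coordinates is the rank
  \<open>k - n\<close> of the Picard group minus one.\<close>

lemma sum_two_power_exponents_le:
  assumes "n \<ge> 1"
  shows "\<exists>C\<ge>0. \<forall>L. (\<Sum>\<alpha>\<in>exponents L. (2::real) ^ (\<Sum>\<rho><k. \<alpha> \<rho>)) \<le> C * 2 ^ L * (real L + 1) ^ (k - n - 1)"
proof -
  obtain \<sigma>1 where \<sigma>1: "\<sigma>1 \<in> \<Sigma>" using fan_nonempty by blast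
  obtain \<rho>0 where \<rho>0: "\<rho>0 < k" "expo \<sigma>1 \<rho>0 \<ge> 1" using expo_pos_exists[OF assms \<sigma>1] by blast
  have "\<rho>0 \<notin> \<sigma>1" using expo_cone[OF \<sigma>1] \<rho>0 by fastforce
  then have "card ({..<k} - insert \<rho>0 \<sigma>1) = k - n - 1"
    using \<rho>0 cone_subset[OF \<sigma>1] finite_cone[OF \<sigma>1] card_cone[OF \<sigma>1]
    by (subst card_Diff_subset) auto
  then show ?thesis
    using exponents_sum_le[OF \<sigma>1 \<rho>0 refl, of "{}"] by (intro exI[of _ "real (card \<Sigma>) * 2 * 2 ^ n"]) auto
qed

text \<open>Here the vertex monomial is a power of the coordinate \<open>\<rho>\<close> alone, so
  its pairing with any ray is at most \<open>expo \<sigma> \<rho> - 1\<close>. Combined with the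
  slack, a total close to \<open>L\<close> forces \<open>\<alpha> \<rho>\<close> to be at least
  about \<open>L / expo \<sigma> \<rho>\<close>.\<close>

lemma exceptional_weight_le:
  assumes \<sigma>: "\<sigma> \<in> \<Sigma>" and \<rho>: "\<rho> < k" and e: "expo \<sigma> \<rho> \<ge> 1"
    and z: "\<And>\<rho>'. \<rho>' < k \<Longrightarrow> \<rho>' \<noteq> \<rho> \<Longrightarrow> expo \<sigma> \<rho>' = 0"
    and \<alpha>: "\<alpha> \<in> exponents L"
  shows "expo \<sigma> \<rho> * (\<Sum>\<rho><k. \<alpha> \<rho>) \<le> (expo \<sigma> \<rho> - 1) * L + expo \<sigma> \<rho> * \<alpha> \<rho>"
proof -
  obtain \<tau> c where \<tau>: "\<tau> \<in> \<Sigma>" and c: "\<And>j. j < n \<Longrightarrow> weight \<alpha> j = - (\<Sum>\<rho>\<in>\<tau>. int (c \<rho>) * v \<rho> j)"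
    and L: "(\<Sum>\<rho><k. \<alpha> \<rho>) + (\<Sum>\<rho>\<in>\<tau>. c \<rho>) \<le> L"
    using exponents_decomposition[OF \<alpha>] by blast
  define s where "s = int (\<Sum>\<rho><k. \<alpha> \<rho>)"
  define C where "C = int (\<Sum>\<rho>\<in>\<tau>. c \<rho>)"
  define E where "E = int (expo \<sigma> \<rho>)"
  have "(\<Sum>\<rho>'<k. expo \<sigma> \<rho>' * \<alpha> \<rho>') = (\<Sum>\<rho>'\<in>{\<rho>}. expo \<sigma> \<rho>' * \<alpha> \<rho>')"
    using \<rho> z by (intro sum.mono_neutral_right) auto
  then have 1: "E * int (\<alpha> \<rho>) = ip n (vertex \<sigma>) (weight \<alpha>) + s"
    using expo_sum[OF \<sigma>, of \<alpha>] by (simp add: E_def s_def)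
  have "ip n (vertex \<sigma>) (weight \<alpha>) = ip n (vertex \<sigma>) (\<lambda>j. - (\<Sum>\<rho>\<in>\<tau>. int (c \<rho>) * v \<rho> j))"
    by (intro ip_cong c)
  also have "\<dots> = - (\<Sum>\<rho>'\<in>\<tau>. int (c \<rho>') * ip n (vertex \<sigma>) (v \<rho>'))"
    by (simp add: ip_uminus_right ip_sum_right)
  also have "\<dots> \<ge> - (\<Sum>\<rho>'\<in>\<tau>. int (c \<rho>') * (E - 1))"
  proof -
    have "ip n (vertex \<sigma>) (v \<rho>') \<le> E - 1" if "\<rho>' \<in> \<tau>" for \<rho>'
      using int_expo[OF \<sigma>, of \<rho>'] z[of \<rho>'] cone_subset[OF \<tau>] that e by (cases "\<rho>' = \<rho>") (auto simp: E_def)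
    then show ?thesis by (simp add: sum_mono mult_left_mono)
  qed
  also have "(\<Sum>\<rho>'\<in>\<tau>. int (c \<rho>') * (E - 1)) = C * (E - 1)" by (simp add: C_def sum_distrib_right)
  finally have "E * int (\<alpha> \<rho>) \<ge> s - (E - 1) * C" using 1 by (simp add: mult.commute)
  moreover have "(E - 1) * (s + C) \<le> (E - 1) * int L"
  proof (rule mult_left_mono)
    show "s + C \<le> int L" using L unfolding s_def C_def of_nat_add[symmetric] of_nat_le_iff .
  qed (use e in \<open>simp add: E_def\<close>)
  ultimately have "E * s \<le> (E - 1) * int L + E * int (\<alpha> \<rho>)" by (simp add: algebra_simps)
  then have "int (expo \<sigma> \<rho> * (\<Sum>\<rho><k. \<alpha> \<rho>)) \<le> int ((expo \<sigma> \<rho> - 1) * L + expo \<sigma> \<rho> * \<alpha> \<rho>)"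
    using e by (simp add: E_def s_def of_nat_diff)
  then show ?thesis by (simp only: of_nat_le_iff)
qed

end

lemma poly_le_exp:
  fixes x :: real
  assumes "x > 1"
  shows "\<exists>C\<ge>0. \<forall>L::nat. (real L + 1) ^ m \<le> C * x ^ L"
proof -
  have "(\<lambda>L::nat. (real L + 1) ^ m / x ^ L) \<longlonglongrightarrow> 0" using assms by real_asymp
  then have "Bseq (\<lambda>L::nat. (real L + 1) ^ m / x ^ L)" by (intro convergent_imp_Bseq convergentI)
  then obtain C where C: "C > 0" "\<And>L. norm ((real L + 1) ^ m / x ^ L) \<le> C" by (auto elim: BseqE)
  have "(real L + 1) ^ m \<le> C * x ^ L" for L
    using C(2)[of L] assms by (simp add: divide_le_eq)
  with C(1) show ?thesis by (intro exI[of _ C]) auto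
qed

context gg_fan
begin

text \<open>Choose \<open>\<sigma>\<close> avoiding \<open>\<rho>\<close>. If some other ray has
  positive \<open>expo\<close>, then \<open>\<rho>\<close> can be one of the free coordinates, and
  its factor \<open>L + 1\<close> becomes a geometric series. Otherwise
  \<open>exceptional_weight_le\<close> gives an exponential saving.\<close>

lemma sum_two_power_exponents_coord_le:
  assumes n: "n \<ge> 1" and \<rho>: "\<rho> < k"
  shows "\<exists>C\<ge>0. \<forall>L. (\<Sum>\<alpha>\<in>exponents L. (2::real) ^ (\<Sum>\<rho><k. \<alpha> \<rho>) / 2 ^ \<alpha> \<rho>)
     \<le> C * 2 ^ L * (real L + 1) ^ (k - n - 1) / (real L + 1)"
proof -
  obtain \<sigma> where \<sigma>: "\<sigma> \<in> \<Sigma>" "\<rho> \<notin> \<sigma>" using cone_avoiding_ray[OF \<rho>] by blast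
  show ?thesis
  proof (cases "\<exists>\<rho>0<k. \<rho>0 \<noteq> \<rho> \<and> expo \<sigma> \<rho>0 \<ge> 1")
    case True
    then obtain \<rho>0 where \<rho>0: "\<rho>0 < k" "\<rho>0 \<noteq> \<rho>" "expo \<sigma> \<rho>0 \<ge> 1" by blast
    let ?K = "{..<k} - insert \<rho>0 \<sigma>"
    have "\<rho>0 \<notin> \<sigma>" using expo_cone[OF \<sigma>(1)] \<rho>0 by fastforce
    then have cK: "card ?K = k - n - 1"
      using \<rho>0 cone_subset[OF \<sigma>(1)] finite_cone[OF \<sigma>(1)] card_cone[OF \<sigma>(1)]
      by (subst card_Diff_subset) auto
    have \<rho>K: "\<rho> \<in> ?K" using \<rho> \<sigma> \<rho>0 by auto
    then have cK': "Suc (card (?K - {\<rho>})) = k - n - 1" using card_Suc_Diff1[of ?K \<rho>] cK by (metis finite_Diff finite_lessThan)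
    let ?C = "real (card \<Sigma>) * 2 * 2 ^ n * 2"
    have "(\<Sum>\<alpha>\<in>exponents L. (2::real) ^ (\<Sum>\<rho><k. \<alpha> \<rho>) / 2 ^ \<alpha> \<rho>) \<le> ?C * 2 ^ L * (real L + 1) ^ (k - n - 1) / (real L + 1)" for L
    proof -
      have "(\<Sum>\<alpha>\<in>exponents L. (2::real) ^ (\<Sum>\<rho><k. \<alpha> \<rho>) / 2 ^ \<alpha> \<rho>) = (\<Sum>\<alpha>\<in>exponents L. 2 ^ (\<Sum>\<rho><k. \<alpha> \<rho>) * (\<Prod>\<rho>\<in>{\<rho>}. (1 / 2::real) ^ \<alpha> \<rho>))"
        by (simp add: power_divide)
      also have "\<dots> \<le> (real (card \<Sigma>) * 2 * 2 ^ n * 2 ^ card {\<rho>}) * 2 ^ L * (real L + 1) ^ card (?K - {\<rho>})"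
        using \<rho>K by (intro exponents_sum_le[OF \<sigma>(1) \<rho>0(1,3) refl]) blast
      also have "\<dots> = ?C * 2 ^ L * (real L + 1) ^ (k - n - 1) / (real L + 1)"
        unfolding cK'[symmetric] by simp
      finally show ?thesis .
    qed
    then show ?thesis by (intro exI[of _ ?C]) auto
  next
    case False
    then have z: "\<And>\<rho>'. \<rho>' < k \<Longrightarrow> \<rho>' \<noteq> \<rho> \<Longrightarrow> expo \<sigma> \<rho>' = 0" by fastforce
    define e where "e = expo \<sigma> \<rho>"
    have e: "e \<ge> 1" unfolding e_def using expo_pos_exists[OF n \<sigma>(1)] z by fastforce
    define x :: real where "x = 2 powr (1 / real e)"
    have x: "x > 1" unfolding x_def using e by (intro gr_one_powr) auto
    \<comment> \<open>The gain \<open>x ^ L\<close> equals \<open>2 powr (L / e)\<close>. It must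
      beat the at most \<open>(L + 1) ^ k\<close> exponents and one further factor
      \<open>L + 1\<close>.\<close>
    obtain C where C: "C \<ge> 0" "\<And>L::nat. (real L + 1) ^ (k + 1) \<le> C * x ^ L" using poly_le_exp[OF x] by blast
    have "(\<Sum>\<alpha>\<in>exponents L. (2::real) ^ (\<Sum>\<rho><k. \<alpha> \<rho>) / 2 ^ \<alpha> \<rho>) \<le> C * 2 ^ L * (real L + 1) ^ (k - n - 1) / (real L + 1)" for L
    proof -
      have xL: "x ^ L = 2 powr (real L / real e)" unfolding x_def by (simp add: powr_realpow[symmetric] powr_powr)
      have t: "(2::real) ^ (\<Sum>\<rho><k. \<alpha> \<rho>) / 2 ^ \<alpha> \<rho> \<le> 2 ^ L / x ^ L" if \<alpha>: "\<alpha> \<in> exponents L" for \<alpha>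
      proof -
        let ?s = "\<Sum>\<rho><k. \<alpha> \<rho>"
        have "e * ?s \<le> (e - 1) * L + e * \<alpha> \<rho>"
          using e unfolding e_def by (intro exceptional_weight_le[OF \<sigma>(1) \<rho> _ z \<alpha>])
        then have "real (e * ?s) \<le> real ((e - 1) * L + e * \<alpha> \<rho>)" by (simp only: of_nat_le_iff)
        then have "real e * real ?s \<le> (real e - 1) * real L + real e * real (\<alpha> \<rho>)"
          using e by (simp only: of_nat_add of_nat_mult of_nat_diff) simp
        moreover have "real e * (real L / real e) = real L" using e by simp
        ultimately have "real e * (real ?s - real (\<alpha> \<rho>)) \<le> real e * (real L - real L / real e)"
          by (simp only: right_diff_distrib left_diff_distrib)
        then have "real ?s - real (\<alpha> \<rho>) \<le> real L - real L / real e" using e by (subst (asm) mult_le_cancel_left_pos) auto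
        then have "2 powr (real ?s - real (\<alpha> \<rho>)) \<le> 2 powr (real L - real L / real e)" by (intro powr_mono) auto
        then show ?thesis unfolding xL powr_diff by (simp only: powr_realpow)
      qed
      have "card (exponents L) \<le> card ({..<k} \<rightarrow>\<^sub>E {..L})"
        by (intro card_mono exponents_subset finite_PiE) auto
      also have "\<dots> = (L + 1) ^ k" by (simp add: card_PiE)
      finally have "real (card (exponents L)) \<le> real ((L + 1) ^ k)" by (simp only: of_nat_le_iff)
      then have cardP: "real (card (exponents L)) \<le> (real L + 1) ^ k" by (simp add: add.commute)
      have xp: "x ^ L > 0" using x by simp
      have "(\<Sum>\<alpha>\<in>exponents L. (2::real) ^ (\<Sum>\<rho><k. \<alpha> \<rho>) / 2 ^ \<alpha> \<rho>) \<le> (\<Sum>\<alpha>\<in>exponents L. 2 ^ L / x ^ L)"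
        by (intro sum_mono t)
      also have "\<dots> \<le> (real L + 1) ^ k * (2 ^ L / x ^ L)"
        using cardP xp by (simp only: sum_constant) (intro mult_right_mono, auto)
      also have "\<dots> = ((real L + 1) ^ (k + 1) / x ^ L) * 2 ^ L / (real L + 1)" by simp
      also have "\<dots> \<le> C * 2 ^ L / (real L + 1)"
        using C(2)[of L] xp by (intro divide_right_mono mult_right_mono) (auto simp: divide_le_eq)
      also have "\<dots> \<le> C * 2 ^ L * (real L + 1) ^ (k - n - 1) / (real L + 1)"
      proof -
        have "(1::real) \<le> (real L + 1) ^ (k - n - 1)" by simp
        then have "C * 2 ^ L * 1 \<le> C * 2 ^ L * (real L + 1) ^ (k - n - 1)" using C(1) by (intro mult_left_mono) auto
        then show ?thesis by (intro divide_right_mono) auto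
      qed
      finally show ?thesis .
    qed
    with C(1) show ?thesis by blast
  qed
qed

end

section \<open>Heights and Cox lifts\<close>

lemma power_int_prod:
  fixes f :: "'a \<Rightarrow> 'b::field"
  assumes "finite S"
  shows "(\<Prod>a\<in>S. f a) powi m = (\<Prod>a\<in>S. f a powi m)"
  using assms by (induction S rule: finite_induct) (auto simp: power_int_mult_distrib)

lemma power_int_sum:
  fixes x :: "'b::field"
  assumes "finite S" "x \<noteq> 0"
  shows "x powi (\<Sum>a\<in>S. f a) = (\<Prod>a\<in>S. x powi f a)"
  using assms by (induction S rule: finite_induct) (auto simp: power_int_add)

text \<open>Writing \<open>c' / c\<close> as \<open>p / q\<close> gives
  \<open>q * z' a = p * z a\<close>; comparing greatest common divisors yields \<open>p = q\<close>.
  This makes the description in \<open>proj_height\<close> definite.\<close>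

lemma primitive_scaling_unique:
  fixes z z' :: "'a \<Rightarrow> int" and c c' :: rat
  assumes c: "c > 0" "c' > 0"
    and z: "\<And>a. a \<in> A \<Longrightarrow> c * y a = of_int (z a)" and z': "\<And>a. a \<in> A \<Longrightarrow> c' * y a = of_int (z' a)"
    and g: "Gcd (z ` A) = 1" "Gcd (z' ` A) = 1"
  shows "c = c'"
proof -
  obtain p q where pq: "c' / c = of_int p / of_int q" "q > 0"
    by (metis quotient_of_denom_pos quotient_of_div surj_pair)
  have "c' / c > 0" using c by simp
  then have p: "p > 0" using pq by (simp add: zero_less_divide_iff)
  have "q * z' a = p * z a" if "a \<in> A" for a
  proof -
    have "of_int (z' a) * c = of_int (z a) * c'"
      using z[OF that] z'[OF that] by (metis mult.commute mult.left_commute)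
    moreover have "c' * of_int q = of_int p * c" using pq c by (simp add: field_simps)
    ultimately have "(of_int (q * z' a) :: rat) * c = of_int (p * z a) * c"
      by (simp only: of_int_mult) (metis mult.commute mult.left_commute)
    then have "(of_int (q * z' a) :: rat) = of_int (p * z a)" using c by simp
    then show ?thesis by (simp only: of_int_eq_iff)
  qed
  then have "(*) q ` (z' ` A) = (*) p ` (z ` A)" by (auto simp: image_image)
  then have "Gcd ((*) q ` (z' ` A)) = Gcd ((*) p ` (z ` A))" by simp
  then have "q = p" unfolding Gcd_mult g using pq p by simp
  with pq have "c' / c = 1" by simp
  with c show ?thesis by simp
qed

lemma proj_height_eq:
  fixes z :: "'a \<Rightarrow> int" and c :: rat
  assumes c: "c > 0" and z: "\<And>a. a \<in> A \<Longrightarrow> c * y a = of_int (z a)" and g: "Gcd (z ` A) = 1"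
  shows "proj_height A y = real_of_rat (Max ((\<lambda>a. \<bar>c * y a\<bar>) ` A))"
  unfolding proj_height_def
proof (rule the_equality)
  have fl: "(\<lambda>a. \<lfloor>c * y a\<rfloor>) ` A = z ` A" by (intro image_cong refl) (simp add: z)
  show "\<exists>d>0. (\<forall>a\<in>A. d * y a \<in> \<int>) \<and> Gcd ((\<lambda>a. \<lfloor>d * y a\<rfloor>) ` A) = 1 \<and>
     real_of_rat (Max ((\<lambda>a. \<bar>c * y a\<bar>) ` A)) = real_of_rat (Max ((\<lambda>a. \<bar>d * y a\<bar>) ` A))"
    using c g by (intro exI[of _ c]) (simp add: z fl del: of_rat_eq_iff)
next
  fix h assume "\<exists>d>0. (\<forall>a\<in>A. d * y a \<in> \<int>) \<and> Gcd ((\<lambda>a. \<lfloor>d * y a\<rfloor>) ` A) = 1 \<and>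
     h = real_of_rat (Max ((\<lambda>a. \<bar>d * y a\<bar>) ` A))"
  then obtain d where d: "d > 0" "\<And>a. a \<in> A \<Longrightarrow> d * y a \<in> \<int>" "Gcd ((\<lambda>a. \<lfloor>d * y a\<rfloor>) ` A) = 1"
    "h = real_of_rat (Max ((\<lambda>a. \<bar>d * y a\<bar>) ` A))" by blast
  have "d * y a = of_int \<lfloor>d * y a\<rfloor>" if "a \<in> A" for a
    using d(2)[OF that] by (metis Ints_cases floor_of_int)
  from primitive_scaling_unique[OF d(1) c this z d(3) g] have "d = c" by blast
  with d(4) show "h = real_of_rat (Max ((\<lambda>a. \<bar>c * y a\<bar>) ` A))" by simp
qed

lemma prime_dvd_Gcd_exists:
  fixes A :: "int set"
  assumes "Gcd A \<noteq> 1"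
  shows "\<exists>p::nat. prime p \<and> int p dvd Gcd A"
proof -
  define g where "g = Gcd A"
  have g: "g \<noteq> 1" "normalize g = g" using assms by (simp_all add: g_def)
  then have nu: "\<not> is_unit g" using is_unit_normalize[of g] by metis
  have "\<exists>p::nat. prime p \<and> int p dvd g"
  proof (cases "g = 0")
    case True
    then show ?thesis by (intro exI[of _ 2]) auto
  next
    case False
    then obtain q where q: "prime q" "q dvd g" using nu prime_divisor_exists[of g] by blast
    then show ?thesis by (intro exI[of _ "nat q"]) (auto simp: prime_ge_0_int)
  qed
  then show ?thesis by (simp add: g_def)
qed

context regular_fan
begin

text \<open>By completeness both signs of each unit vector are nonnegative combinations of rays,
  which bounds every coordinate of a character from both sides. The maximum in the height needs this
  finiteness.\<close>

lemma finite_antican_chars: "finite (antican_chars n k v)"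
proof -
  have "\<exists>M. \<forall>m\<in>antican_chars n k v. ip n m u \<ge> - int M" for u
  proof -
    obtain \<sigma> and c :: "nat \<Rightarrow> nat" where \<sigma>: "\<sigma> \<in> \<Sigma>" and c: "\<And>j. j < n \<Longrightarrow> u j = (\<Sum>\<rho>\<in>\<sigma>. int (c \<rho>) * v \<rho> j)"
      using integral_cone_decomposition[of u] by blast
    have "ip n m u \<ge> - int (\<Sum>\<rho>\<in>\<sigma>. c \<rho>)" if m: "m \<in> antican_chars n k v" for m
    proof -
      have "- int (\<Sum>\<rho>\<in>\<sigma>. c \<rho>) = (\<Sum>\<rho>\<in>\<sigma>. int (c \<rho>) * (-1))" by (simp add: sum_negf)
      also have "\<dots> \<le> (\<Sum>\<rho>\<in>\<sigma>. int (c \<rho>) * ip n m (v \<rho>))"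
        using m cone_subset[OF \<sigma>] by (intro sum_mono mult_left_mono) (auto simp: antican_chars_def)
      also have "\<dots> = ip n m u" by (subst ip_sum_right[symmetric]) (intro ip_cong c[symmetric])
      finally show ?thesis .
    qed
    then show ?thesis by blast
  qed
  then obtain M where M: "\<And>u m. m \<in> antican_chars n k v \<Longrightarrow> ip n m u \<ge> - int (M u)" by metis
  define E where "E = (\<lambda>j i :: nat. if i = j then 1 else 0 :: int)"
  define B where "B = (\<Sum>j<n. int (M (E j)) + int (M (\<lambda>i. - E j i)))"
  have "antican_chars n k v \<subseteq> {f. \<forall>j. (j \<in> {..<n} \<longrightarrow> f j \<in> {-B..B}) \<and> (j \<notin> {..<n} \<longrightarrow> f j = 0)}"
  proof
    fix m assume m: "m \<in> antican_chars n k v"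
    have "m j \<in> {-B..B}" if j: "j < n" for j
    proof -
      have e: "ip n m (E j) = m j"
        unfolding ip_def E_def using j by (simp add: if_distrib cong: if_cong)
      have "int (M (E j)) + int (M (\<lambda>i. - E j i)) \<le> B"
        unfolding B_def using j by (intro member_le_sum) auto
      then show ?thesis using M[OF m, of "E j"] M[OF m, of "\<lambda>i. - E j i"] e by (simp add: ip_uminus_right)
    qed
    moreover have "m j = 0" if "\<not> j < n" for j using m that by (auto simp: antican_chars_def)
    ultimately show "m \<in> {f. \<forall>j. (j \<in> {..<n} \<longrightarrow> f j \<in> {-B..B}) \<and> (j \<notin> {..<n} \<longrightarrow> f j = 0)}" by auto
  qed
  then show ?thesis by (rule finite_subset) (intro finite_set_of_finite_funs, auto)
qed

text \<open>Multiplying by the product of all coordinates raises each exponent by 1, and the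
  polytope inequalities make the results nonnegative.\<close>

lemma char_val_cox_lift:
  assumes x: "cox_lift n k v \<Sigma> x t" and m: "m \<in> antican_chars n k v"
  shows "of_int (\<Prod>\<rho><k. x \<rho>) * char_val n m t = of_int (\<Prod>\<rho><k. x \<rho> ^ nat (ip n m (v \<rho>) + 1))"
proof -
  have x0: "x \<rho> \<noteq> 0" if "\<rho> < k" for \<rho> using x that by (simp add: cox_lift_def)
  have "char_val n m t = (\<Prod>j<n. \<Prod>\<rho><k. of_int (x \<rho>) powi (v \<rho> j * m j))"
    unfolding char_val_def using x by (intro prod.cong) (auto simp: cox_lift_def power_int_prod power_int_mult)
  also have "\<dots> = (\<Prod>\<rho><k. of_int (x \<rho>) powi ip n m (v \<rho>))"
    unfolding ip_def by (subst prod.swap) (intro prod.cong, auto simp: power_int_sum x0 mult.commute)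
  finally have "of_int (\<Prod>\<rho><k. x \<rho>) * char_val n m t = (\<Prod>\<rho><k. of_int (x \<rho>) * of_int (x \<rho>) powi ip n m (v \<rho>))"
    by (simp add: prod.distrib)
  also have "\<dots> = (\<Prod>\<rho><k. of_int (x \<rho>) ^ nat (ip n m (v \<rho>) + 1))"
  proof (rule prod.cong[OF refl])
    fix \<rho> assume "\<rho> \<in> {..<k}"
    then have "ip n m (v \<rho>) + 1 \<ge> 0" "x \<rho> \<noteq> 0" using m x0 by (auto simp: antican_chars_def)
    then show "of_int (x \<rho>) * of_int (x \<rho>) powi ip n m (v \<rho>) = (of_int (x \<rho>) ^ nat (ip n m (v \<rho>) + 1) :: rat)"
      by (simp add: power_int_add_1' flip: power_int_of_nat)
  qed
  finally show ?thesis by simp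
qed

end

context gg_fan
begin

text \<open>\<open>vertex\<close> is constrained only through \<open>ip n\<close>, whereas
  characters must vanish from index \<open>n\<close> on; truncation repairs this.\<close>

lemma vertex_in_chars:
  assumes "\<sigma> \<in> \<Sigma>"
  shows "\<exists>m\<in>antican_chars n k v. \<forall>u. ip n m u = ip n (vertex \<sigma>) u"
proof -
  let ?m = "\<lambda>j. if j < n then vertex \<sigma> j else 0"
  have "ip n ?m u = ip n (vertex \<sigma>) u" for u unfolding ip_def by (intro sum.cong) auto
  then show ?thesis using vertex(2)[OF assms] by (intro bexI[of _ ?m]) (auto simp: antican_chars_def)
qed

text \<open>For a prime \<open>p\<close> choose the cone outside of which no coordinate is divisible
  by \<open>p\<close>. Its vertex monomial involves only such coordinates, so \<open>p\<close> does
  not divide it. The sign \<open>u\<close> is allowed because the height uses a positive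
  scaling.\<close>

lemma Gcd_cox_monomials:
  assumes x: "cox_lift n k v \<Sigma> x t" and u: "\<bar>u\<bar> = 1"
  shows "Gcd ((\<lambda>m. u * (\<Prod>\<rho><k. x \<rho> ^ nat (ip n m (v \<rho>) + 1))) ` antican_chars n k v) = 1" (is "?g = 1")
proof (rule ccontr)
  assume "?g \<noteq> 1"
  from prime_dvd_Gcd_exists[OF this] obtain p :: nat where p: "prime p" "int p dvd ?g" by blast
  obtain \<sigma> where \<sigma>: "\<sigma> \<in> \<Sigma>" "\<And>\<rho>. \<rho> < k \<Longrightarrow> \<rho> \<notin> \<sigma> \<Longrightarrow> \<not> int p dvd x \<rho>"
    using x p(1) unfolding cox_lift_def by blast
  obtain m where m: "m \<in> antican_chars n k v" "\<And>u. ip n m u = ip n (vertex \<sigma>) u"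
    using vertex_in_chars[OF \<sigma>(1)] by blast
  have "?g dvd u * (\<Prod>\<rho><k. x \<rho> ^ nat (ip n m (v \<rho>) + 1))" using m(1) by (intro Gcd_dvd) auto
  with p(2) have "int p dvd u * (\<Prod>\<rho><k. x \<rho> ^ nat (ip n m (v \<rho>) + 1))" by (rule dvd_trans)
  moreover have "u = 1 \<or> u = -1" using u by linarith
  ultimately have "int p dvd (\<Prod>\<rho><k. x \<rho> ^ nat (ip n m (v \<rho>) + 1))" by auto
  then obtain \<rho> where \<rho>: "\<rho> < k" "int p dvd x \<rho> ^ nat (ip n m (v \<rho>) + 1)"
    using p(1) by (subst (asm) prime_dvd_prod_iff) auto
  have "int p dvd x \<rho>" using \<rho>(2) p(1) prime_dvd_power[of "int p"] by auto
  then have "\<rho> \<in> \<sigma>" using \<sigma>(2)[OF \<rho>(1)] by blast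
  then have "nat (ip n m (v \<rho>) + 1) = 0" using vertex(1)[OF \<sigma>(1)] m(2) by simp
  with \<rho>(2) have "int p dvd 1" by simp
  with p(1) show False by (simp add: prime_gt_1_nat)
qed

lemma H_tor_ge:
  assumes x: "cox_lift n k v \<Sigma> x t" and m: "m \<in> antican_chars n k v"
  shows "real_of_int (\<Prod>\<rho><k. \<bar>x \<rho>\<bar> ^ nat (ip n m (v \<rho>) + 1)) \<le> H_tor n k v t"
proof -
  define P where "P = (\<Prod>\<rho><k. x \<rho>)"
  have P: "P \<noteq> 0" using x by (auto simp: P_def cox_lift_def)
  define Y where "Y = (\<lambda>m. \<Prod>\<rho><k. x \<rho> ^ nat (ip n m (v \<rho>) + 1))"
  \<comment> \<open>The height demands a positive scaling factor, hence \<open>\<bar>P\<bar>\<close>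
    in place of \<open>P\<close> and the sign moved into \<open>z\<close>.\<close>
  define z where "z = (\<lambda>m. sgn P * Y m)"
  let ?A = "antican_chars n k v"
  have z: "of_int \<bar>P\<bar> * char_val n m t = of_int (z m)" if "m \<in> ?A" for m
  proof -
    have "(of_int \<bar>P\<bar> :: rat) = of_int (sgn P) * of_int P" by (simp add: abs_sgn mult.commute flip: of_int_mult)
    then show ?thesis using char_val_cox_lift[OF x that] by (simp add: z_def Y_def P_def mult.assoc)
  qed
  have g: "Gcd (z ` ?A) = 1" unfolding z_def Y_def by (rule Gcd_cox_monomials[OF x]) (use P in \<open>simp add: abs_sgn_eq\<close>)
  have H: "H_tor n k v t = real_of_rat (Max ((\<lambda>a. \<bar>of_int \<bar>P\<bar> * char_val n a t\<bar>) ` ?A))"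
    unfolding H_tor_def using P z g by (intro proj_height_eq[where z = z]) auto
  have "\<bar>of_int \<bar>P\<bar> * char_val n m t\<bar> \<le> Max ((\<lambda>a. \<bar>of_int \<bar>P\<bar> * char_val n a t\<bar>) ` ?A)"
    using m finite_antican_chars by (intro Max_ge) auto
  moreover have "\<bar>of_int \<bar>P\<bar> * char_val n m t\<bar> = of_int \<bar>z m\<bar>" unfolding z[OF m] by simp
  moreover have "\<bar>z m\<bar> = (\<Prod>\<rho><k. \<bar>x \<rho>\<bar> ^ nat (ip n m (v \<rho>) + 1))"
    using P by (simp add: z_def Y_def abs_mult abs_sgn_eq abs_prod power_abs)
  ultimately have "of_int (\<Prod>\<rho><k. \<bar>x \<rho>\<bar> ^ nat (ip n m (v \<rho>) + 1)) \<le> Max ((\<lambda>a. \<bar>of_int \<bar>P\<bar> * char_val n a t\<bar>) ` ?A)"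
    by simp
  then have "real_of_rat (of_int (\<Prod>\<rho><k. \<bar>x \<rho>\<bar> ^ nat (ip n m (v \<rho>) + 1))) \<le> H_tor n k v t"
    unfolding H of_rat_less_eq .
  then show ?thesis by (simp only: of_rat_of_int_eq)
qed

text \<open>Each monomial is at least the power of 2 given by the lower ends of the dyadic intervals
  and is at most the height. Being integers, exponents below \<open>L + 1\<close> are at most
  \<open>L\<close>.\<close>

lemma cox_lift_exponents:
  assumes x: "cox_lift n k v \<Sigma> x t" and H: "H_tor n k v t \<le> B" and B: "B < 2 ^ (L + 1)"
    and \<alpha>: "\<alpha> \<in> extensional {..<k}" "\<And>\<rho>. \<rho> < k \<Longrightarrow> 2 ^ \<alpha> \<rho> \<le> \<bar>x \<rho>\<bar>"
  shows "\<alpha> \<in> exponents L"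
proof -
  have key: "(\<Sum>\<rho><k. nat (ip n m (v \<rho>) + 1) * \<alpha> \<rho>) \<le> L" if m: "m \<in> antican_chars n k v" for m
  proof -
    have "(2::int) ^ (\<Sum>\<rho><k. nat (ip n m (v \<rho>) + 1) * \<alpha> \<rho>) = (\<Prod>\<rho><k. (2 ^ \<alpha> \<rho>) ^ nat (ip n m (v \<rho>) + 1))"
      by (simp add: power_sum power_mult[symmetric] mult.commute)
    also have "\<dots> \<le> (\<Prod>\<rho><k. \<bar>x \<rho>\<bar> ^ nat (ip n m (v \<rho>) + 1))"
      using \<alpha>(2) by (intro prod_mono) (auto intro!: power_mono)
    finally have "real_of_int (2 ^ (\<Sum>\<rho><k. nat (ip n m (v \<rho>) + 1) * \<alpha> \<rho>)) \<le> real_of_int (\<Prod>\<rho><k. \<bar>x \<rho>\<bar> ^ nat (ip n m (v \<rho>) + 1))"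
      by (simp only: of_int_le_iff)
    also have "\<dots> \<le> B" using H_tor_ge[OF x m] H by (rule order.trans)
    also note B
    finally have "(2::real) ^ (\<Sum>\<rho><k. nat (ip n m (v \<rho>) + 1) * \<alpha> \<rho>) < 2 ^ (L + 1)" by simp
    then have "(\<Sum>\<rho><k. nat (ip n m (v \<rho>) + 1) * \<alpha> \<rho>) < L + 1" by (rule power_less_imp_less_exp[rotated]) simp
    then show ?thesis by simp
  qed
  have "(\<lambda>_. 0) \<in> antican_chars n k v" by (simp add: antican_chars_def ip_def)
  from key[OF this] have 1: "(\<Sum>\<rho><k. \<alpha> \<rho>) \<le> L" by (simp add: ip_def)
  have 2: "(\<Sum>\<rho><k. expo \<sigma> \<rho> * \<alpha> \<rho>) \<le> L" if \<sigma>: "\<sigma> \<in> \<Sigma>" for \<sigma>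
  proof -
    obtain m where m: "m \<in> antican_chars n k v" "\<And>u. ip n m u = ip n (vertex \<sigma>) u"
      using vertex_in_chars[OF \<sigma>] by blast
    show ?thesis using key[OF m(1)] by (simp add: expo_def m(2))
  qed
  show ?thesis using 1 2 \<alpha>(1) by (auto simp: exponents_def PiE_def)
qed

end

section \<open>Counting bad points\<close>

lemma polyfun_mp_eval:
  assumes "vars_in S f"
  shows "(\<lambda>x. mp_eval id f x) \<in> polyfun S"
  unfolding mp_eval_def
  by (intro polyfun_sum polyfun.mult polyfun.const polyfun_prod polyfun_power polyfun.var)
    (use assms in \<open>auto simp: vars_in_def\<close>)

lemma dyadic_exists:
  assumes "y \<noteq> 0"
  shows "\<exists>a. y \<in> dyadic a"
proof -
  have "1 \<le> nat \<bar>y\<bar>" using assms by linarith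
  then obtain a where a: "2 ^ a \<le> nat \<bar>y\<bar>" "nat \<bar>y\<bar> < 2 ^ (a + 1)" using ex_power_ivl1[of 2 "nat \<bar>y\<bar>"] by auto
  have "2 ^ a \<le> \<bar>y\<bar>" using a(1) by (simp add: le_nat_iff)
  moreover have "\<bar>y\<bar> < 2 ^ (a + 1)" using a(2) by (simp add: nat_less_iff)
  ultimately show ?thesis by (auto simp: dyadic_def)
qed

context gg_fan
begin

definition bad_points :: "((nat \<Rightarrow>\<^sub>0 nat) \<Rightarrow>\<^sub>0 rat) set \<Rightarrow> real \<Rightarrow> real \<Rightarrow> (nat \<Rightarrow> rat) set" where
  "bad_points F N B = {t \<in> torus_points n. H_tor n k v t \<le> B \<and>
            (\<exists>p. prime p \<and> real p \<ge> N \<and> red_in_closure n k v \<Sigma> F p t)}"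

text \<open>For \<open>n = 0\<close> there are no rays, and a chain of a single point already
  violates the codimension bound. So the cone misses \<open>cox_U\<close>, the polynomial 1 vanishes
  on the empty intersection, and no prime divides 1.\<close>

lemma bad_points_empty:
  assumes "n = 0" and codim: "codim_ge_2 k \<Sigma> F"
  shows "bad_points F N B = {}"
proof -
  have k: "k = 0"
  proof (rule ccontr)
    assume "k \<noteq> 0"
    then obtain \<sigma> where "\<sigma> \<in> \<Sigma>" "0 \<in> \<sigma>" using ray_in_cone[of 0] by auto
    then show False using card_cone[of \<sigma>] finite_cone[of \<sigma>] assms(1) by auto
  qed
  have "cone_Z k F \<inter> cox_U k \<Sigma> = {}"
  proof (rule ccontr)
    assume "\<not> ?thesis"
    then obtain z where z: "z \<in> cone_Z k F" "z \<in> cox_U k \<Sigma>" by blast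
    have sing: "cox_space k = {z}" using z(1) by (auto simp: k cox_space_def cone_Z_def)
    have "zar_closed k {z}"
      unfolding zar_closed_def by (rule exI[of _ "{}"]) (simp add: sing)
    then have "zar_irreducible k {z}" by (auto simp: zar_irreducible_def)
    then have "0 + 2 \<le> k"
      using codim[unfolded codim_ge_2_def, rule_format, of 0 "\<lambda>_. {z}"] z by auto
    then show False by (simp add: k)
  qed
  then have "\<not> red_in_closure n k v \<Sigma> F p t" if "prime p" for p t
  proof -
    have "\<not> int p dvd mp_eval id 1 x" for x
      using prime_gt_1_nat[OF that] by (simp add: mp_eval_one)
    moreover have "vars_below k (1 :: (nat \<Rightarrow>\<^sub>0 nat) \<Rightarrow>\<^sub>0 int)" by (simp add: vars_below_vars_in)
    ultimately show ?thesis unfolding red_in_closure_def \<open>cone_Z k F \<inter> cox_U k \<Sigma> = {}\<close> by blast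
  qed
  then show ?thesis unfolding bad_points_def by blast
qed

text \<open>A bad point is recovered from any of its lifts, so a choice of one lift suffices for an
  upper bound. Membership in the closure is tested only on the equations \<open>c i\<close>.\<close>

lemma card_bad_points_le:
  assumes c: "\<And>i. i < k \<Longrightarrow> vars_in ({..<k} - {i}) (c i) \<and> (\<forall>z\<in>cone_Z k F \<inter> cox_U k \<Sigma>. mp_eval of_int (c i) z = 0)"
    and B: "B < 2 ^ (L + 1)"
  shows "real (card (bad_points F N B)) \<le> (\<Sum>\<alpha>\<in>exponents L. real (card
     {x \<in> dyadic_box {..<k} \<alpha>. \<exists>p::nat. prime p \<and> N \<le> real p \<and> (\<forall>i\<in>{..<k}. int p dvd mp_eval id (c i) x)}))"
proof -
  let ?Bad = "\<lambda>\<alpha>. {x \<in> dyadic_box {..<k} \<alpha>. \<exists>p::nat. prime p \<and> N \<le> real p \<and> (\<forall>i\<in>{..<k}. int p dvd mp_eval id (c i) x)}"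
  \<comment> \<open>The value 1 from index \<open>n\<close> on matches the convention in
    \<open>torus_points\<close>.\<close>
  define \<tau> :: "(nat \<Rightarrow> int) \<Rightarrow> nat \<Rightarrow> rat" where
    "\<tau> = (\<lambda>x j. if j < n then \<Prod>\<rho><k. of_int (x \<rho>) powi v \<rho> j else 1)"
  have "bad_points F N B \<subseteq> \<tau> ` (\<Union>\<alpha>\<in>exponents L. ?Bad \<alpha>)"
  proof
    fix t assume "t \<in> bad_points F N B"
    then obtain p x where t: "t \<in> torus_points n" "H_tor n k v t \<le> B" and p: "prime p" "N \<le> real p"
      and x: "cox_lift n k v \<Sigma> x t" and dv: "\<And>f::((nat \<Rightarrow>\<^sub>0 nat) \<Rightarrow>\<^sub>0 int). vars_below k f \<Longrightarrow>
            (\<forall>z\<in>cone_Z k F \<inter> cox_U k \<Sigma>. mp_eval of_int f z = 0) \<Longrightarrow> int p dvd mp_eval id f x"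
      unfolding bad_points_def red_in_closure_def by blast
    have "\<forall>\<rho><k. \<exists>a. x \<rho> \<in> dyadic a" using x dyadic_exists by (auto simp: cox_lift_def)
    then obtain a where a: "\<And>\<rho>. \<rho> < k \<Longrightarrow> x \<rho> \<in> dyadic (a \<rho>)" by metis
    define \<alpha> where "\<alpha> = restrict a {..<k}"
    define x' where "x' = restrict x {..<k}"
    have "\<alpha> \<in> exponents L"
      by (rule cox_lift_exponents[OF x t(2) B]) (use a in \<open>auto simp: \<alpha>_def dyadic_def\<close>)
    moreover have "x' \<in> ?Bad \<alpha>"
    proof -
      have "x' \<in> dyadic_box {..<k} \<alpha>" using a by (auto simp: dyadic_box_def x'_def \<alpha>_def)
      moreover have "int p dvd mp_eval id (c i) x'" if "i < k" for i
      proof -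
        have "mp_eval id (c i) x' = mp_eval id (c i) x"
          using c[OF that] by (intro mp_eval_cong[of "{..<k} - {i}"]) (auto simp: x'_def)
        moreover have "vars_below k (c i)"
          unfolding vars_below_vars_in using c[OF that] by (blast intro: vars_in_mono)
        ultimately show ?thesis using dv[of "c i"] c[OF that] by simp
      qed
      ultimately show ?thesis using p by auto
    qed
    moreover have "t = \<tau> x'"
    proof
      fix j
      show "t j = \<tau> x' j" using t(1) x by (auto simp: \<tau>_def torus_points_def cox_lift_def x'_def)
    qed
    ultimately show "t \<in> \<tau> ` (\<Union>\<alpha>\<in>exponents L. ?Bad \<alpha>)" by blast
  qed
  then have "card (bad_points F N B) \<le> card (\<tau> ` (\<Union>\<alpha>\<in>exponents L. ?Bad \<alpha>))"
    using finite_exponents by (intro card_mono) auto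
  also have "\<dots> \<le> card (\<Union>\<alpha>\<in>exponents L. ?Bad \<alpha>)"
    using finite_exponents by (intro card_image_le) auto
  also have "\<dots> \<le> (\<Sum>\<alpha>\<in>exponents L. card (?Bad \<alpha>))" by (rule card_UN_le[OF finite_exponents])
  finally show ?thesis unfolding of_nat_sum[symmetric] of_nat_le_iff .
qed

text \<open>Sums the sieve bound over all boxes, with \<open>L\<close> as common bound for the
  exponents. The sieve needs \<open>N\<close> above a threshold \<open>P\<close>; smaller
  \<open>N\<close> are handled by counting all points of the boxes.\<close>

lemma card_bad_points_bound:
  assumes n: "n \<ge> 1" and codim: "codim_ge_2 k \<Sigma> F" and F: "\<forall>f\<in>F. vars_below k f"
  shows "\<exists>M\<ge>0. \<forall>N B L. N > 1 \<longrightarrow> B < 2 ^ (L + 1) \<longrightarrow> real (card (bad_points F N B)) \<le>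
     M * (2 ^ L * (real L + 1) ^ (k - n - 1) / (N * ln N) +
          (1 + ln (1 + real L)) * (2 ^ L * (real L + 1) ^ (k - n - 1) / (real L + 1)))"
proof -
  define E where "E = (\<lambda>i (c :: (nat \<Rightarrow>\<^sub>0 nat) \<Rightarrow>\<^sub>0 int). c \<noteq> 0 \<and> vars_in ({..<k} - {i}) c \<and>
    (\<forall>z\<in>cone_Z k F \<inter> cox_U k \<Sigma>. mp_eval of_int c z = 0))"
  have "\<forall>i<k. \<exists>c. E i c"
    unfolding E_def using codim_2_equation_exists[OF _ codim F fan_nonempty] by blast
  then obtain c where "\<And>i. i < k \<Longrightarrow> E i (c i)" by metis
  then have c: "\<And>i. i < k \<Longrightarrow> c i \<noteq> 0"
    "\<And>i. i < k \<Longrightarrow> vars_in ({..<k} - {i}) (c i) \<and> (\<forall>z\<in>cone_Z k F \<inter> cox_U k \<Sigma>. mp_eval of_int (c i) z = 0)"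
    unfolding E_def by auto
  define d where "d = (\<lambda>i x. mp_eval id (c i) x)"
  have "{..<k} \<noteq> {}" using expo_pos_exists[OF n] fan_nonempty by auto
  moreover have "d i \<in> polyfun ({..<k} - {i}) \<and> (\<exists>x. d i x \<noteq> 0)" if "i \<in> {..<k}" for i
    using that c mp_eval_nonzero_exists[of "c i"] polyfun_mp_eval[of "{..<k} - {i}" "c i"] by (auto simp: d_def)
  ultimately obtain C1 P1 where C1: "C1 \<ge> 0" and H1: "\<And>\<alpha>. sieve_bound {..<k} d C1 P1 \<alpha>"
    using sieve_bound_exists[of "{..<k}" d] by blast
  obtain C2 where C2: "C2 \<ge> 0" and H2: "\<And>L. (\<Sum>\<alpha>\<in>exponents L. (2::real) ^ (\<Sum>\<rho><k. \<alpha> \<rho>)) \<le> C2 * 2 ^ L * (real L + 1) ^ (k - n - 1)"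
    using sum_two_power_exponents_le[OF n] by blast
  have "\<forall>\<rho><k. \<exists>C\<ge>0. \<forall>L. (\<Sum>\<alpha>\<in>exponents L. (2::real) ^ (\<Sum>\<rho><k. \<alpha> \<rho>) / 2 ^ \<alpha> \<rho>)
     \<le> C * 2 ^ L * (real L + 1) ^ (k - n - 1) / (real L + 1)"
    using sum_two_power_exponents_coord_le[OF n] by blast
  then obtain C3 where C3H3: "\<forall>\<rho><k. C3 \<rho> \<ge> 0 \<and> (\<forall>L. (\<Sum>\<alpha>\<in>exponents L. (2::real) ^ (\<Sum>\<rho><k. \<alpha> \<rho>) / 2 ^ \<alpha> \<rho>)
     \<le> C3 \<rho> * 2 ^ L * (real L + 1) ^ (k - n - 1) / (real L + 1))"
    unfolding choice_iff' by blast
  then have C3: "\<And>\<rho>. \<rho> < k \<Longrightarrow> C3 \<rho> \<ge> 0" and H3: "\<And>\<rho> L. \<rho> < k \<Longrightarrow>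
     (\<Sum>\<alpha>\<in>exponents L. (2::real) ^ (\<Sum>\<rho><k. \<alpha> \<rho>) / 2 ^ \<alpha> \<rho>) \<le> C3 \<rho> * 2 ^ L * (real L + 1) ^ (k - n - 1) / (real L + 1)"
    by blast+
  define P where "P = max P1 2"
  define CC where "CC = (\<Sum>\<rho><k. C3 \<rho>)"
  have CC: "CC \<ge> 0" using C3 by (auto simp: CC_def intro!: sum_nonneg)
  have P: "P \<ge> 2" "P \<ge> P1" by (auto simp: P_def)
  define M where "M = C1 * C2 + C1 * CC + 2 ^ k * C2 * (P * ln P)"
  have vol: "vol {..<k} \<alpha> = 2 ^ (\<Sum>\<rho><k. \<alpha> \<rho>)" for \<alpha> by (simp add: vol_def power_sum)
  have "real (card (bad_points F N B)) \<le>
     M * (2 ^ L * (real L + 1) ^ (k - n - 1) / (N * ln N) +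
          (1 + ln (1 + real L)) * (2 ^ L * (real L + 1) ^ (k - n - 1) / (real L + 1)))"
    if N: "N > 1" and B: "B < 2 ^ (L + 1)" for N B :: real and L
  proof -
    define X where "X = 2 ^ L * (real L + 1) ^ (k - n - 1)"
    define \<Lambda> where "\<Lambda> = 1 + ln (1 + real L)"
    have X: "X \<ge> 0" by (simp add: X_def)
    have \<Lambda>: "\<Lambda> \<ge> 0" by (simp add: \<Lambda>_def)
    have NN: "N * ln N > 0" using N by simp
    have nn: "X / (N * ln N) \<ge> 0" "\<Lambda> * (X / (real L + 1)) \<ge> 0" using X \<Lambda> NN by auto
    let ?Bad = "\<lambda>\<alpha>. {x \<in> dyadic_box {..<k} \<alpha>. \<exists>p::nat. prime p \<and> N \<le> real p \<and> (\<forall>i\<in>{..<k}. int p dvd mp_eval id (c i) x)}"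
    have le: "real (card (bad_points F N B)) \<le> (\<Sum>\<alpha>\<in>exponents L. real (card (?Bad \<alpha>)))"
      by (rule card_bad_points_le[OF c(2) B])
    have "real (card (bad_points F N B)) \<le> M * (X / (N * ln N) + \<Lambda> * (X / (real L + 1)))"
    proof (cases "N \<ge> P")
      case True
      have "(\<Sum>\<alpha>\<in>exponents L. real (card (?Bad \<alpha>))) \<le>
         (\<Sum>\<alpha>\<in>exponents L. C1 * vol {..<k} \<alpha> * (1 / (N * ln N) + \<Lambda> * recip {..<k} \<alpha>))"
      proof (rule sum_mono)
        fix \<alpha> assume "\<alpha> \<in> exponents L"
        then have "\<forall>s\<in>{..<k}. \<alpha> s \<le> L" using exponents_le by blast
        then show "real (card (?Bad \<alpha>)) \<le> C1 * vol {..<k} \<alpha> * (1 / (N * ln N) + \<Lambda> * recip {..<k} \<alpha>)"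
          using H1[of \<alpha>] True P unfolding sieve_bound_def d_def \<Lambda>_def by (meson order.trans)
      qed
      also have "\<dots> = C1 * ((\<Sum>\<alpha>\<in>exponents L. vol {..<k} \<alpha>) / (N * ln N) + \<Lambda> * (\<Sum>\<alpha>\<in>exponents L. vol {..<k} \<alpha> * recip {..<k} \<alpha>))"
        by (simp add: sum_distrib_left sum_divide_distrib sum.distrib[symmetric] algebra_simps)
      also have "(\<Sum>\<alpha>\<in>exponents L. vol {..<k} \<alpha> * recip {..<k} \<alpha>) = (\<Sum>\<rho><k. \<Sum>\<alpha>\<in>exponents L. 2 ^ (\<Sum>\<rho><k. \<alpha> \<rho>) / 2 ^ \<alpha> \<rho>)"
        unfolding vol recip_def sum_distrib_left by (subst sum.swap) simp
      also have "C1 * ((\<Sum>\<alpha>\<in>exponents L. vol {..<k} \<alpha>) / (N * ln N) + \<Lambda> * (\<Sum>\<rho><k. \<Sum>\<alpha>\<in>exponents L. 2 ^ (\<Sum>\<rho><k. \<alpha> \<rho>) / 2 ^ \<alpha> \<rho>))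
         \<le> C1 * (C2 * X / (N * ln N) + \<Lambda> * (\<Sum>\<rho><k. C3 \<rho> * X / (real L + 1)))"
        using H2[of L] H3[of _ L] C1 NN \<Lambda> unfolding vol X_def
        by (intro mult_left_mono add_mono divide_right_mono sum_mono) (auto simp: mult.assoc)
      also have "\<dots> = C1 * C2 * (X / (N * ln N)) + C1 * CC * (\<Lambda> * (X / (real L + 1)))"
        by (simp add: CC_def sum_distrib_left sum_distrib_right sum_divide_distrib algebra_simps)
      also have "\<dots> \<le> M * (X / (N * ln N)) + M * (\<Lambda> * (X / (real L + 1)))"
        using C1 C2 CC P nn unfolding M_def by (intro add_mono mult_right_mono) auto
      finally show ?thesis unfolding distrib_left by (rule order.trans[OF le])
    next
      case False
      have "(\<Sum>\<alpha>\<in>exponents L. real (card (?Bad \<alpha>))) \<le> (\<Sum>\<alpha>\<in>exponents L. 2 ^ k * vol {..<k} \<alpha>)"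
      proof (rule sum_mono)
        fix \<alpha>
        have "card (?Bad \<alpha>) \<le> card (dyadic_box {..<k} \<alpha>)" by (intro card_mono) auto
        then show "real (card (?Bad \<alpha>)) \<le> 2 ^ k * vol {..<k} \<alpha>"
          using card_dyadic_box_le[of "{..<k}" \<alpha>] by simp
      qed
      also have "\<dots> \<le> 2 ^ k * (C2 * X)"
        unfolding sum_distrib_left[symmetric] vol X_def using H2[of L] by (simp add: mult.assoc)
      also have "\<dots> \<le> (2 ^ k * C2 * (P * ln P)) * (X / (N * ln N))"
      proof -
        \<comment> \<open>For \<open>N\<close> below the threshold, \<open>1 / (N * ln N)\<close> is
          bounded below by a constant, so the trivial count fits into the first term.\<close>
        have "N * ln N \<le> P * ln P" using False N by (intro mult_mono) auto
        then have "1 \<le> P * ln P / (N * ln N)" using NN by simp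
        then have "2 ^ k * (C2 * X) * 1 \<le> 2 ^ k * (C2 * X) * (P * ln P / (N * ln N))"
          using C2 X by (intro mult_left_mono) auto
        then show ?thesis by (simp add: mult_ac)
      qed
      also have "\<dots> \<le> M * (X / (N * ln N))"
        using C1 C2 CC P nn unfolding M_def by (intro mult_right_mono) auto
      also have "\<dots> \<le> M * (X / (N * ln N) + \<Lambda> * (X / (real L + 1)))"
        using C1 C2 CC P nn unfolding M_def by (intro mult_left_mono) auto
      finally show ?thesis using le by linarith
    qed
    then show ?thesis unfolding X_def \<Lambda>_def by (simp add: mult.assoc)
  qed
  moreover have "M \<ge> 0" using C1 C2 CC P by (simp add: M_def)
  ultimately show ?thesis by blast
qed

end

theorem theorem1p2:
  fixes n k :: nat and v :: "nat \<Rightarrow> nat \<Rightarrow> int" and \<Sigma> :: "nat set set"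
    and F :: "((nat \<Rightarrow>\<^sub>0 nat) \<Rightarrow>\<^sub>0 rat) set"
  assumes fan: "complete_regular_fan n k v \<Sigma>"
    and proj: "projective_fan n k v \<Sigma>"
    and gg: "anticanonical_gg n k v \<Sigma>"
    and F_fin: "finite F"
    and F_vars: "\<forall>f\<in>F. vars_below k f"
    and F_hom: "\<forall>f\<in>F. pic_homogeneous n k v f"
    and codim: "codim_ge_2 k \<Sigma> F"
  shows "\<exists>C>0. \<exists>B0. \<forall>N B::real. N > 1 \<longrightarrow> B \<ge> B0 \<longrightarrow>
     real (card {t \<in> torus_points n. H_tor n k v t \<le> B \<and>
            (\<exists>p. prime p \<and> real p \<ge> N \<and> red_in_closure n k v \<Sigma> F p t)})
       \<le> C * (B * ln B powr (real k - real n - 1) / (N * ln N)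
              + B * ln B powr (real k - real n - 2) * ln (ln B))"
proof -
  interpret gg_fan n k v \<Sigma> by unfold_locales (rule fan, rule gg)
  \<comment> \<open>The threshold \<open>exp (exp 1)\<close> makes both logarithms at least 1, so
    constants can be absorbed into them.\<close>
  have large: "ln B \<ge> 1" "ln (ln B) \<ge> 1" "B > 1" if "B \<ge> exp (exp 1)" for B :: real
  proof -
    have "B > 0" using that exp_gt_zero[of "exp 1"] by linarith
    then have "ln B \<ge> ln (exp (exp 1))" using that by (subst ln_le_cancel_iff) auto
    then have e: "ln B \<ge> exp 1" by simp
    moreover have e1: "exp 1 \<ge> (1::real)" by simp
    ultimately show 1: "ln B \<ge> 1" by linarith
    have "ln (ln B) \<ge> ln (exp 1)" using e 1 by (subst ln_le_cancel_iff) auto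
    then show "ln (ln B) \<ge> 1" by simp
    have "exp (exp 1) > (1::real)" by simp
    with that show "B > 1" by linarith
  qed
  show ?thesis unfolding bad_points_def[symmetric]
  proof (cases "n = 0")
    case True
    show "\<exists>C>0. \<exists>B0. \<forall>N B::real. N > 1 \<longrightarrow> B \<ge> B0 \<longrightarrow> real (card (bad_points F N B))
       \<le> C * (B * ln B powr (real k - real n - 1) / (N * ln N) + B * ln B powr (real k - real n - 2) * ln (ln B))"
      unfolding bad_points_empty[OF True codim]
    proof (rule exI[of _ 1], intro conjI exI[of _ "exp (exp 1)"] allI impI)
      fix N B :: real assume "N > 1" "B \<ge> exp (exp 1)"
      with large[of B] show "real (card {}) \<le> 1 * (B * ln B powr (real k - real n - 1) / (N * ln N) + B * ln B powr (real k - real n - 2) * ln (ln B))"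
        by simp
    qed simp
  next
    case False
    then have n: "n \<ge> 1" by simp
    obtain \<sigma> where \<sigma>: "\<sigma> \<in> \<Sigma>" using fan_nonempty by blast
    obtain \<rho> where \<rho>: "\<rho> < k" "expo \<sigma> \<rho> \<ge> 1" using expo_pos_exists[OF n \<sigma>] by blast
    have kn: "k \<ge> n + 1"
    proof -
      have "\<rho> \<notin> \<sigma>" using expo_cone[OF \<sigma>] \<rho> by fastforce
      then have "card (insert \<rho> \<sigma>) = n + 1" using card_cone[OF \<sigma>] finite_cone[OF \<sigma>] by simp
      moreover have "card (insert \<rho> \<sigma>) \<le> card {..<k}" using cone_subset[OF \<sigma>] \<rho> by (intro card_mono) auto
      ultimately show ?thesis by simp
    qed
    define r where "r = k - n - 1"
    \<comment> \<open>\<open>r\<close> is the Picard rank minus one; \<open>k \<ge> n + 1\<close>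
      makes the truncated subtraction exact. The second exponent is -1 for rank one, hence
      \<open>powr\<close>.\<close>
    have r: "real k - real n - 1 = real r" "real k - real n - 2 = real r - 1" using kn by (auto simp: r_def)
    obtain M where M: "M \<ge> 0" and H: "\<And>N B L. N > 1 \<Longrightarrow> B < 2 ^ (L + 1) \<Longrightarrow> real (card (bad_points F N B)) \<le>
     M * (2 ^ L * (real L + 1) ^ r / (N * ln N) + (1 + ln (1 + real L)) * (2 ^ L * (real L + 1) ^ r / (real L + 1)))"
      using card_bad_points_bound[OF n codim F_vars] unfolding r_def by blast
    \<comment> \<open>\<open>3 ^ r\<close> comes from \<open>L + 1 \<le> 3 * ln B\<close>, the 4
      from \<open>1 + ln (1 + L) \<le> 4 * ln (ln B)\<close>, and the final 1 keeps \<open>C\<close>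
      positive.\<close>
    define C where "C = M * 3 ^ r * 4 + 1"
    show "\<exists>C>0. \<exists>B0. \<forall>N B::real. N > 1 \<longrightarrow> B \<ge> B0 \<longrightarrow> real (card (bad_points F N B))
       \<le> C * (B * ln B powr (real k - real n - 1) / (N * ln N) + B * ln B powr (real k - real n - 2) * ln (ln B))"
    proof (rule exI[of _ C], intro conjI exI[of _ "exp (exp 1)"] allI impI)
      show "C > 0" using M by (simp add: C_def add_nonneg_pos)
      fix N B :: real assume N: "N > 1" and B: "B \<ge> exp (exp 1)"
      note lg = large[OF B]
      \<comment> \<open>So \<open>2 ^ L \<le> B < 2 ^ (L + 1)\<close>: the upper bound feeds the
        count, the lower one returns from \<open>2 ^ L\<close> to \<open>B\<close>.\<close>
      define L where "L = nat \<lfloor>log 2 B\<rfloor>"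
      have log: "log 2 B \<ge> 0" using lg by simp
      then have L: "real L \<le> log 2 B" "log 2 B < real L + 1" by (auto simp: L_def)
      have BL: "B < 2 ^ (L + 1)"
      proof -
        have "B < 2 powr (real L + 1)" using L(2) lg by (simp add: log_less_iff)
        also have "2 powr (real L + 1) = 2 ^ (L + 1)" by (simp add: powr_add powr_realpow)
        finally show ?thesis .
      qed
      have LB: "2 ^ L \<le> B"
      proof -
        have "2 powr real L \<le> B" using L(1) lg by (simp add: le_log_iff)
        then show ?thesis by (simp add: powr_realpow)
      qed
      have ln2: "ln 2 \<ge> (1 / 2 :: real)" "ln 2 \<le> (1 :: real)" using ln2_ge_two_thirds ln_2_less_1 by auto
      have L3: "real L + 1 \<le> 3 * ln B"
      proof -
        have "log 2 B \<le> ln B / (1 / 2)" unfolding log_def using ln2 lg by (intro divide_left_mono) auto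
        then have "log 2 B \<le> 2 * ln B" by simp
        with L lg show ?thesis by linarith
      qed
      have L1: "ln B \<le> real L + 1"
      proof -
        have "ln B / 1 \<le> log 2 B" unfolding log_def using ln2 lg by (intro divide_left_mono) auto
        with L show ?thesis by linarith
      qed
      have \<Lambda>: "1 + ln (1 + real L) \<le> 4 * ln (ln B)"
      proof -
        have "ln (1 + real L) \<le> ln (3 * ln B)" using L3 lg by (intro ln_mono) auto
        also have "\<dots> = ln 3 + ln (ln B)" by (rule ln_mult_pos) (use lg in linarith)+
        also have "ln 3 \<le> (3 :: real) - 1" by (rule ln_le_minus_one) simp
        finally show ?thesis using lg by linarith
      qed
      define W where "W = B * ln B ^ r"
      have W: "W \<ge> 0" using lg by (simp add: W_def)
      have X: "2 ^ L * (real L + 1) ^ r \<le> 3 ^ r * W"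
      proof -
        have "2 ^ L * (real L + 1) ^ r \<le> B * (3 * ln B) ^ r"
          using LB L3 lg by (intro mult_mono power_mono) auto
        then show ?thesis by (simp add: W_def power_mult_distrib mult.left_commute)
      qed
      have NN: "N * ln N > 0" using N by simp
      have "real (card (bad_points F N B)) \<le> M * (2 ^ L * (real L + 1) ^ r / (N * ln N) + (1 + ln (1 + real L)) * (2 ^ L * (real L + 1) ^ r / (real L + 1)))"
        by (rule H[OF N BL])
      also have "\<dots> \<le> M * (3 ^ r * W / (N * ln N) + 4 * ln (ln B) * (3 ^ r * W / ln B))"
      proof (intro mult_left_mono add_mono divide_right_mono X mult_mono \<Lambda> frac_le L1)
        show "0 < ln B" using lg by linarith
      qed (use NN lg M W in auto)
      also have "\<dots> \<le> M * (4 * 3 ^ r * (W / (N * ln N)) + 4 * 3 ^ r * (W / ln B * ln (ln B)))"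
      proof (intro mult_left_mono add_mono M)
        have "1 * (3 ^ r * W / (N * ln N)) \<le> 4 * (3 ^ r * W / (N * ln N))"
          using NN W by (intro mult_right_mono divide_nonneg_pos) auto
        then show "3 ^ r * W / (N * ln N) \<le> 4 * 3 ^ r * (W / (N * ln N))" by simp
        show "4 * ln (ln B) * (3 ^ r * W / ln B) \<le> 4 * 3 ^ r * (W / ln B * ln (ln B))"
          by (simp add: mult_ac)
      qed
      also have "\<dots> = (M * 3 ^ r * 4) * (W / (N * ln N) + W / ln B * ln (ln B))"
        by (simp add: algebra_simps)
      also have "\<dots> \<le> C * (W / (N * ln N) + W / ln B * ln (ln B))"
        unfolding C_def using W NN lg by (intro mult_right_mono add_nonneg_nonneg) auto
      also have "W = B * ln B powr (real k - real n - 1)"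
        unfolding W_def r using lg by (simp add: powr_realpow)
      also have "B * ln B powr (real k - real n - 1) / ln B = B * ln B powr (real k - real n - 2)"
        unfolding r using lg by (simp add: powr_diff)
      finally show "real (card (bad_points F N B)) \<le> C * (B * ln B powr (real k - real n - 1) / (N * ln N) + B * ln B powr (real k - real n - 2) * ln (ln B))" .
    qed
  qed
qed

end
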